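(* For every integer $s\geq 0$, Subset Odd Cycle Transversal can be solved in polynomial time for $(sP_1+P_3)$-free graphs.
   Context: For a graph $G=(V,E)$ and $T\subseteq V$, an odd $T$-cycle is a cycle of $G$ with an odd number of vertices that contains a vertex of $T$, and an odd $T$-cycle transversal is a set $S_T\subseteq V$ containing at least one vertex of every odd $T$-cycle. The problem Subset Odd Cycle Transversal takes as input a graph $G=(V,E)$, a subset $T\subseteq V$ and a positive integer $k$, and asks whether $G$ has an odd $T$-cycle transversal of size at most $k$. $sP_1+P_3$ denotes the disjoint union of $s$ isolated vertices and a path on 3 vertices; a graph is $H$-free if it has no induced subgraph isomorphic to $H$. *)

theory Defs
  imports "HOL-Computational_Algebra.Polynomial"
begin

section \<open>Finite simple graphs\<close>

record 'a ugraph =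
  verts :: "'a set"
  edges :: "'a set set"

definition simple_graph :: "'a ugraph \<Rightarrow> bool" where
  "simple_graph G \<longleftrightarrow> finite (verts G) \<and> (\<forall>e\<in>edges G. e \<subseteq> verts G \<and> card e = 2)"

definition induced_subgraph :: "'a ugraph \<Rightarrow> 'a set \<Rightarrow> 'a ugraph" where
  "induced_subgraph G W = \<lparr>verts = W, edges = {e \<in> edges G. e \<subseteq> W}\<rparr>"

definition graph_iso :: "'a ugraph \<Rightarrow> 'b ugraph \<Rightarrow> bool" where
  "graph_iso G H \<longleftrightarrow> (\<exists>f. bij_betw f (verts G) (verts H) \<and>
     (\<forall>u\<in>verts G. \<forall>v\<in>verts G. {u, v} \<in> edges G \<longleftrightarrow> {f u, f v} \<in> edges H))"

definition H_free :: "'b ugraph \<Rightarrow> 'a ugraph \<Rightarrow> bool" where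
  "H_free H G \<longleftrightarrow> \<not> (\<exists>W\<subseteq>verts G. graph_iso H (induced_subgraph G W))"

definition path_graph :: "nat \<Rightarrow> nat ugraph" where
  "path_graph n = \<lparr>verts = {..<n}, edges = {{i, Suc i} | i. Suc i < n}\<rparr>"

definition edgeless_graph :: "nat \<Rightarrow> nat ugraph" where
  "edgeless_graph n = \<lparr>verts = {..<n}, edges = {}\<rparr>"

definition disjoint_union :: "'a ugraph \<Rightarrow> 'b ugraph \<Rightarrow> ('a + 'b) ugraph" where
  "disjoint_union G H =
     \<lparr>verts = verts G <+> verts H, edges = (`) Inl ` edges G \<union> (`) Inr ` edges H\<rparr>"

definition sP1_P3 :: "nat \<Rightarrow> (nat + nat) ugraph" where
  "sP1_P3 s = disjoint_union (edgeless_graph s) (path_graph 3)"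


section \<open>Subset Odd Cycle Transversal\<close>

text \<open>A cycle is given by the list of its vertices in cyclic order, without repetition.\<close>

definition is_cycle :: "'a ugraph \<Rightarrow> 'a list \<Rightarrow> bool" where
  "is_cycle G c \<longleftrightarrow> length c \<ge> 3 \<and> distinct c \<and> set c \<subseteq> verts G \<and>
     (\<forall>i<length c. {c ! i, c ! (Suc i mod length c)} \<in> edges G)"

definition odd_T_cycle :: "'a ugraph \<Rightarrow> 'a set \<Rightarrow> 'a list \<Rightarrow> bool" where
  "odd_T_cycle G T c \<longleftrightarrow> is_cycle G c \<and> odd (length c) \<and> set c \<inter> T \<noteq> {}"

definition odd_T_cycle_transversal :: "'a ugraph \<Rightarrow> 'a set \<Rightarrow> 'a set \<Rightarrow> bool" where
  "odd_T_cycle_transversal G T S \<longleftrightarrow>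
     S \<subseteq> verts G \<and> (\<forall>c. odd_T_cycle G T c \<longrightarrow> set c \<inter> S \<noteq> {})"

text \<open>As inputs to algorithms, graphs have vertex set \<open>{..<n}\<close> for some \<open>n\<close>.\<close>

record soct_instance =
  graph_of :: "nat ugraph"
  terminals :: "nat set"
  budget :: nat

definition valid_instance :: "soct_instance \<Rightarrow> bool" where
  "valid_instance I \<longleftrightarrow> simple_graph (graph_of I) \<and> (\<exists>n. verts (graph_of I) = {..<n}) \<and>
     terminals I \<subseteq> verts (graph_of I) \<and> budget I > 0"

definition subset_odd_cycle_transversal :: "soct_instance \<Rightarrow> bool" where
  "subset_odd_cycle_transversal I \<longleftrightarrow>
     (\<exists>S. odd_T_cycle_transversal (graph_of I) (terminals I) S \<and> card S \<le> budget I)"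

fun binary :: "nat \<Rightarrow> bool list" where  \<comment> \<open>least significant bit first\<close>
  "binary n = (if n = 0 then [] else odd n # binary (n div 2))"

declare binary.simps [simp del]

text \<open>
  An instance is written as a bit string consisting of the number of vertices \<open>n\<close> in
  unary (terminated by a zero), the \<open>n \<times> n\<close> adjacency matrix row by row, the
  characteristic vector of the terminal set, and the budget in binary.
\<close>

definition encode_instance :: "soct_instance \<Rightarrow> bool list" where
  "encode_instance I =
     (let G = graph_of I; n = card (verts G) in
      replicate n True @ [False]
      @ concat (map (\<lambda>i. map (\<lambda>j. {i, j} \<in> edges G) [0..<n]) [0..<n])
      @ map (\<lambda>i. i \<in> terminals I) [0..<n]
      @ binary (budget I))"


section \<open>Polynomial time\<close>

text \<open>
  The model of computation is the language WHILE of N. D. Jones (Computability and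
  Complexity from a Programming Perspective, MIT Press, 1997): imperative programs whose
  variables hold binary trees, with one unit of time charged per operation. Its
  polynomial-time problems are those of Turing machines. Every operation is a constant-time
  pointer operation: a step allocates at most one cell per pair operator in the program
  text, trees are shared and never copied, and the only test on trees is whether the root
  is the atom. Conversely, the two halves of a Turing machine tape are lists.
\<close>

datatype tree = Atom | Pair tree tree

fun head :: "tree \<Rightarrow> tree" where
  "head Atom = Atom"
| "head (Pair a b) = a"

fun tail :: "tree \<Rightarrow> tree" where
  "tail Atom = Atom"
| "tail (Pair a b) = b"

datatype expr = Var nat | Const tree | PairE expr expr | HeadE expr | TailE expr

datatype com =
  Skip
| Assign nat expr
| Seq com com
| If expr com com
| While expr com

type_synonym store = "nat \<Rightarrow> tree"

fun eval_expr :: "expr \<Rightarrow> store \<Rightarrow> tree" where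
  "eval_expr (Var x) \<sigma> = \<sigma> x"
| "eval_expr (Const a) \<sigma> = a"
| "eval_expr (PairE e f) \<sigma> = Pair (eval_expr e \<sigma>) (eval_expr f \<sigma>)"
| "eval_expr (HeadE e) \<sigma> = head (eval_expr e \<sigma>)"
| "eval_expr (TailE e) \<sigma> = tail (eval_expr e \<sigma>)"

fun expr_cost :: "expr \<Rightarrow> nat" where
  "expr_cost (Var x) = 1"
| "expr_cost (Const a) = 1"
| "expr_cost (PairE e f) = 1 + expr_cost e + expr_cost f"
| "expr_cost (HeadE e) = 1 + expr_cost e"
| "expr_cost (TailE e) = 1 + expr_cost e"

text \<open>
  \<open>exec c \<sigma> t \<sigma>'\<close>: started in the store \<open>\<sigma>\<close>, the program \<open>c\<close> halts after \<open>t\<close> time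
  units in the store \<open>\<sigma>'\<close>. The atom represents false, any other tree represents true.
\<close>

inductive exec :: "com \<Rightarrow> store \<Rightarrow> nat \<Rightarrow> store \<Rightarrow> bool" where
  Skip: "exec Skip \<sigma> 1 \<sigma>"
| Assign: "exec (Assign x e) \<sigma> (1 + expr_cost e) (\<sigma>(x := eval_expr e \<sigma>))"
| Seq: "exec c \<sigma> t \<sigma>' \<Longrightarrow> exec d \<sigma>' u \<sigma>'' \<Longrightarrow> exec (Seq c d) \<sigma> (t + u) \<sigma>''"
| IfTrue: "eval_expr e \<sigma> \<noteq> Atom \<Longrightarrow> exec c \<sigma> t \<sigma>' \<Longrightarrow>
    exec (If e c d) \<sigma> (1 + expr_cost e + t) \<sigma>'"
| IfFalse: "eval_expr e \<sigma> = Atom \<Longrightarrow> exec d \<sigma> t \<sigma>' \<Longrightarrow>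
    exec (If e c d) \<sigma> (1 + expr_cost e + t) \<sigma>'"
| WhileFalse: "eval_expr e \<sigma> = Atom \<Longrightarrow> exec (While e c) \<sigma> (1 + expr_cost e) \<sigma>"
| WhileTrue: "eval_expr e \<sigma> \<noteq> Atom \<Longrightarrow> exec c \<sigma> t \<sigma>' \<Longrightarrow> exec (While e c) \<sigma>' u \<sigma>'' \<Longrightarrow>
    exec (While e c) \<sigma> (1 + expr_cost e + t + u) \<sigma>''"

inductive_cases exec_SkipE: "exec Skip \<sigma> t \<sigma>'"
inductive_cases exec_AssignE: "exec (Assign x e) \<sigma> t \<sigma>'"
inductive_cases exec_SeqE: "exec (Seq c d) \<sigma> t \<sigma>'"
inductive_cases exec_IfE: "exec (If e c d) \<sigma> t \<sigma>'"
inductive_cases exec_WhileE: "exec (While e c) \<sigma> t \<sigma>'"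

lemma exec_deterministic:
  "exec c \<sigma> t \<tau> \<Longrightarrow> exec c \<sigma> t' \<tau>' \<Longrightarrow> t = t' \<and> \<tau> = \<tau>'"
proof (induction arbitrary: t' \<tau>' rule: exec.induct)
  case (Skip \<sigma>)
  then show ?case by (auto elim: exec_SkipE)
next
  case (Assign x e \<sigma>)
  then show ?case by (auto elim: exec_AssignE)
next
  case (Seq c \<sigma> t \<sigma>' d u \<sigma>'')
  from Seq.prems show ?case by (rule exec_SeqE) (metis Seq.IH)
next
  case (IfTrue e \<sigma> c t \<sigma>' d)
  from IfTrue.prems show ?case by (rule exec_IfE) (unfold plus_1_eq_Suc add_Suc, (metis IfTrue.IH IfTrue.hyps(1))+)
next
  case (IfFalse e \<sigma> d t \<sigma>' c)
  from IfFalse.prems show ?case by (rule exec_IfE) (unfold plus_1_eq_Suc add_Suc, (metis IfFalse.IH IfFalse.hyps(1))+)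
next
  case (WhileFalse e \<sigma> c)
  from WhileFalse.prems show ?case by (rule exec_WhileE) (unfold plus_1_eq_Suc add_Suc, (metis WhileFalse.hyps(1))+)
next
  case (WhileTrue e \<sigma> c t \<sigma>' u \<sigma>'')
  from WhileTrue.prems show ?case by (rule exec_WhileE) (unfold plus_1_eq_Suc add_Suc, (metis WhileTrue.IH WhileTrue.hyps(1))+)
qed

fun tree_of_bool :: "bool \<Rightarrow> tree" where
  "tree_of_bool False = Atom"
| "tree_of_bool True = Pair Atom Atom"

fun tree_of_bools :: "bool list \<Rightarrow> tree" where
  "tree_of_bools [] = Atom"
| "tree_of_bools (b # bs) = Pair (tree_of_bool b) (tree_of_bools bs)"

text \<open>Variable \<open>0\<close> holds the input initially and the output finally.\<close>

definition initial_store :: "bool list \<Rightarrow> store" where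
  "initial_store w = (\<lambda>_. Atom)(0 := tree_of_bools w)"

text \<open>
  The decision problem \<open>P\<close> restricted to the instances in \<open>A\<close>: nothing is required of the
  program on inputs that do not encode an instance in \<open>A\<close>.
\<close>

definition solvable_in_poly_time :: "('i \<Rightarrow> bool list) \<Rightarrow> 'i set \<Rightarrow> ('i \<Rightarrow> bool) \<Rightarrow> bool" where
  "solvable_in_poly_time enc A P \<longleftrightarrow>
     (\<exists>(c :: com) (p :: nat poly). \<forall>I\<in>A. \<exists>t \<sigma>.
        exec c (initial_store (enc I)) t \<sigma> \<and> t \<le> poly p (length (enc I)) \<and>
        (\<sigma> 0 \<noteq> Atom \<longleftrightarrow> P I))"

end

theory Submission
  imports Defs
begin

text \<open>
  Complementing a transversal, one looks for a largest vertex set \<open>W\<close> such that no odd cycle of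
  \<open>G[W]\<close> meets \<open>T\<close>. Since the non-terminals are always such a set, a largest \<open>W\<close> with few
  terminals differs from their set in boundedly many vertices; it is found by brute force and
  verified by brute force as well, because in an \<open>(sP\<^sub>1 + P\<^sub>3)\<close>-free graph a shortest odd
  \<open>T\<close>-cycle has at most \<open>4s + 5\<close> vertices. If \<open>W\<close> has many terminals, there are \<open>s + 1\<close>
  independent terminals \<open>X \<subseteq> W\<close> such that \<open>B = W \<inter> N(X)\<close> is independent, the rest
  \<open>C = W - N(X)\<close> is a disjoint union of cliques, and each clique is attached to \<open>B\<close> in a
  restricted way that can be checked clique by clique. If no vertex of \<open>X\<close> has \<open>s + 2\<close>
  neighbours in \<open>B\<close>, then \<open>B\<close> can be guessed. Otherwise all but fewer than \<open>s\<close> of the cliques of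
  \<open>C\<close> are single vertices, and after guessing a bounded part \<open>Y\<close> of \<open>B\<close> and one vertex of each
  larger clique, the remaining choices are independent of each other: one vertex per clique of an
  induced disjoint union of cliques.

  Hence the answer is the value of a fixed term over the adjacency matrix, built from bounded
  sums, differences and case distinctions; such terms are compiled to polynomial-time programs.
\<close>

text \<open>The obstacle is that the independent side \<open>B\<close> and the cliques of
  \<open>C\<close> constrain each other while \<open>B\<close> may be large. The constraint is
  local: if both ends of an edge inside a clique have neighbours in \<open>B\<close>, these must be
  one and the same vertex. So a vertex with two neighbours in the guessed part \<open>Y\<close>
  already rules out every chosen clique-mate that has a neighbour in \<open>Y\<close>, and further
  vertices of \<open>B\<close> cannot make this worse. Large degree into \<open>B\<close> forces
  exactly this situation: \<open>Y\<close> has at least \<open>s + 2\<close> independent vertices,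
  deleting two of them leaves \<open>s\<close>, and freeness then yields the second neighbour in
  \<open>Y\<close>.

  Terms have neither guessing nor data structures. A vertex set of bounded size is a tuple of
  variables, a guess is a sum over all values of the tuple, and the largest admissible part of a
  clique is a maximum of boundedly many counts.\<close>

fun unary :: "nat \<Rightarrow> tree" where
  "unary 0 = Atom"
| "unary (Suc n) = Pair Atom (unary n)"

lemma unary_eq_Atom_iff [simp]: "unary n = Atom \<longleftrightarrow> n = 0"
  by (cases n) auto

lemma tail_unary [simp]: "tail (unary n) = unary (n - 1)"
  by (cases n) auto

lemma tree_of_bool_eq_unary: "tree_of_bool b = unary (of_bool b)"
  by (cases b) auto

lemma tail_tree_of_bools [simp]: "tail (tree_of_bools bs) = tree_of_bools (drop 1 bs)"
  by (cases bs) auto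

lemma head_tree_of_bools_drop:
  "head (tree_of_bools (drop k bs)) = unary (of_bool (k < length bs \<and> bs ! k))"
proof (cases "k < length bs")
  case True
  then show ?thesis
    by (simp add: Cons_nth_drop_Suc[symmetric] tree_of_bool_eq_unary)
qed simp

section \<open>Time-bounded total correctness of programs\<close>

definition runs :: "com \<Rightarrow> store \<Rightarrow> nat \<Rightarrow> (store \<Rightarrow> bool) \<Rightarrow> bool" where
  "runs c s b Q \<longleftrightarrow> (\<exists>t s'. exec c s t s' \<and> t \<le> b \<and> Q s')"

lemma runs_mono: "runs c s b Q \<Longrightarrow> b \<le> b' \<Longrightarrow> (\<And>s'. Q s' \<Longrightarrow> Q' s') \<Longrightarrow> runs c s b' Q'"
  unfolding runs_def by (meson le_trans)

lemma runs_Assign: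
  "Q (s(x := eval_expr e s)) \<Longrightarrow> 1 + expr_cost e \<le> b \<Longrightarrow> runs (Assign x e) s b Q"
  unfolding runs_def using exec.Assign by blast

lemma runs_Seq:
  assumes "runs c s b1 R" "\<And>s'. R s' \<Longrightarrow> runs d s' b2 Q" "b1 + b2 \<le> b"
  shows "runs (Seq c d) s b Q"
proof -
  obtain t s' where 1: "exec c s t s'" "t \<le> b1" "R s'" using assms(1) by (auto simp: runs_def)
  obtain u s'' where 2: "exec d s' u s''" "u \<le> b2" "Q s''"
    using assms(2)[OF 1(3)] by (auto simp: runs_def)
  show ?thesis unfolding runs_def
    using exec.Seq[OF 1(1) 2(1)] 1 2 assms(3) by (intro exI[of _ "t + u"] exI[of _ s'']) auto
qed

lemma runs_If:
  assumes "eval_expr e s \<noteq> Atom \<Longrightarrow> runs c s b1 Q" "eval_expr e s = Atom \<Longrightarrow> runs d s b1 Q"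
    "1 + expr_cost e + b1 \<le> b"
  shows "runs (If e c d) s b Q"
proof (cases "eval_expr e s = Atom")
  case True
  then obtain t s' where 1: "exec d s t s'" "t \<le> b1" "Q s'" using assms(2) by (auto simp: runs_def)
  then show ?thesis unfolding runs_def
    using exec.IfFalse[OF True 1(1)] assms(3) by (intro exI) (auto intro: conjI)
next
  case False
  then obtain t s' where 1: "exec c s t s'" "t \<le> b1" "Q s'" using assms(1) by (auto simp: runs_def)
  then show ?thesis unfolding runs_def
    using exec.IfTrue[OF False 1(1)] assms(3) by (intro exI) (auto intro: conjI)
qed

text \<open>The index of the invariant is the number of iterations still to come, so it serves at
  once as termination measure and as iteration count. The factor \<open>Suc a\<close> also pays for
  the final, failing test.\<close>

lemma runs_While:
  assumes step: "\<And>i s. Inv (Suc i) s \<Longrightarrow> eval_expr e s \<noteq> Atom \<and> runs c s b (Inv i)"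
    and stop: "\<And>s. Inv 0 s \<Longrightarrow> eval_expr e s = Atom"
    and "Inv a s"
  shows "runs (While e c) s (Suc a * (1 + expr_cost e + b)) (Inv 0)"
  using \<open>Inv a s\<close>
proof (induction a arbitrary: s)
  case 0
  show ?case unfolding runs_def
    using exec.WhileFalse[OF stop[OF 0]] 0 by (intro exI) (auto intro: conjI)
next
  case (Suc a)
  obtain t s' where 1: "exec c s t s'" "t \<le> b" "Inv a s'"
    using step[OF Suc.prems] by (auto simp: runs_def)
  obtain u s'' where 2: "exec (While e c) s' u s''" "u \<le> Suc a * (1 + expr_cost e + b)" "Inv 0 s''"
    using Suc.IH[OF 1(3)] by (auto simp: runs_def)
  have ne: "eval_expr e s \<noteq> Atom" using step[OF Suc.prems] by simp
  show ?case unfolding runs_def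
    using exec.WhileTrue[OF ne 1(1) 2(1)] 1 2 by (intro exI) (auto intro!: conjI)
qed

text \<open>The counter is decremented before the body runs, so the body sees the values
  \<open>a - 1\<close> down to \<open>0\<close>. A compiled sum uses its bound variable as the
  counter.\<close>

definition Loop :: "nat \<Rightarrow> com \<Rightarrow> com" where
  "Loop x c = While (Var x) (Seq (Assign x (TailE (Var x))) c)"

text \<open>The constant 5 is the cost of one round outside the body: 2 for the test and 3 for the
  decrement.\<close>

lemma runs_Loop:
  assumes step: "\<And>i s. i < a \<Longrightarrow> s x = unary (Suc i) \<Longrightarrow> Inv (Suc i) s \<Longrightarrow>
      runs c (s(x := unary i)) b (\<lambda>s'. s' x = unary i \<and> Inv i s')"
    and "s x = unary a" "Inv a s" and "Suc a * (b + 5) \<le> b'"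
  shows "runs (Loop x c) s b' (\<lambda>s'. s' x = Atom \<and> Inv 0 s')"
proof -
  have "runs (While (Var x) (Seq (Assign x (TailE (Var x))) c)) s (Suc a * (1 + expr_cost (Var x) + (b + 3)))
    ((\<lambda>i s'. i \<le> a \<and> s' x = unary i \<and> Inv i s') 0)"
  proof (rule runs_While, goal_cases)
    case (1 i s)
    have "runs (Seq (Assign x (TailE (Var x))) c) s (b + 3) (\<lambda>s'. i \<le> a \<and> s' x = unary i \<and> Inv i s')"
    proof (rule runs_Seq)
      show "runs (Assign x (TailE (Var x))) s 3 (\<lambda>s'. s' = s(x := unary i))"
        using 1 by (intro runs_Assign) auto
      show "\<And>s'. s' = s(x := unary i) \<Longrightarrow> runs c s' b (\<lambda>s'. i \<le> a \<and> s' x = unary i \<and> Inv i s')"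
        using step[of i s] 1 by (auto intro: runs_mono)
    qed simp
    then show ?case using 1 by simp
  qed (use assms(2,3) in auto)
  then show ?thesis unfolding Loop_def
    by (rule runs_mono) (use assms(4) in \<open>auto simp: add.commute\<close>)
qed

section \<open>Compiling arithmetic terms\<close>

text \<open>Sums range over \<open>n\<close> values only and there is no product, so for variables
  bounded by \<open>n\<close> the value and the running time of a fixed term are polynomial in
  \<open>n\<close>. Truncated subtraction gives negation and sums give bounded quantifiers, so
  first-order properties of the table and counting become terms.\<close>

datatype tm =
  V nat
| One
| Look nat nat
| Add tm tm
| Sub tm tm
| Cond tm tm tm
| Sum nat tm

fun tval :: "bool list \<Rightarrow> nat \<Rightarrow> (nat \<Rightarrow> nat) \<Rightarrow> tm \<Rightarrow> nat" where
  "tval bs n e (V x) = e x"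
| "tval bs n e One = 1"
| "tval bs n e (Look x y) = of_bool (e x * n + e y < length bs \<and> bs ! (e x * n + e y))"
| "tval bs n e (Add a b) = tval bs n e a + tval bs n e b"
| "tval bs n e (Sub a b) = tval bs n e a - tval bs n e b"
| "tval bs n e (Cond a b c) = (if tval bs n e a > 0 then tval bs n e b else tval bs n e c)"
| "tval bs n e (Sum x a) = (\<Sum>i<n. tval bs n (e(x := i)) a)"

fun fv :: "tm \<Rightarrow> nat set" where
  "fv (V x) = {x}"
| "fv One = {}"
| "fv (Look x y) = {x, y}"
| "fv (Add a b) = fv a \<union> fv b"
| "fv (Sub a b) = fv a \<union> fv b"
| "fv (Cond a b c) = fv a \<union> fv b \<union> fv c"
| "fv (Sum x a) = fv a - {x}"

text \<open>Registers from \<open>r\<close> on are scratch space, so all variables, bound ones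
  included, lie below \<open>r\<close>. Bound variables avoid 0 and 1, which hold the bit string and
  \<open>n\<close>.\<close>

fun below :: "nat \<Rightarrow> tm \<Rightarrow> bool" where
  "below r (V x) \<longleftrightarrow> x < r"
| "below r One \<longleftrightarrow> True"
| "below r (Look x y) \<longleftrightarrow> x < r \<and> y < r"
| "below r (Add a b) \<longleftrightarrow> below r a \<and> below r b"
| "below r (Sub a b) \<longleftrightarrow> below r a \<and> below r b"
| "below r (Cond a b c) \<longleftrightarrow> below r a \<and> below r b \<and> below r c"
| "below r (Sum x a) \<longleftrightarrow> 2 \<le> x \<and> x < r \<and> below r a"

fun proper :: "tm \<Rightarrow> bool" where
  "proper (V x) \<longleftrightarrow> 0 < x"
| "proper One \<longleftrightarrow> True"
| "proper (Look x y) \<longleftrightarrow> 0 < x \<and> 0 < y"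
| "proper (Add a b) \<longleftrightarrow> proper a \<and> proper b"
| "proper (Sub a b) \<longleftrightarrow> proper a \<and> proper b"
| "proper (Cond a b c) \<longleftrightarrow> proper a \<and> proper b \<and> proper c"
| "proper (Sum x a) \<longleftrightarrow> 2 \<le> x \<and> proper a"

lemma fv_proper: "proper t \<Longrightarrow> v \<in> fv t \<Longrightarrow> 0 < v"
  by (induction t) auto

lemma below_mono: "below r t \<Longrightarrow> r \<le> r' \<Longrightarrow> below r' t"
  by (induction t) auto

lemma ex_below: "proper t \<Longrightarrow> \<exists>r. below r t"
proof (induction t)
  case (V x)
  then show ?case by (intro exI[of _ "Suc x"]) simp
next
  case (Look x y)
  then show ?case by (intro exI[of _ "Suc (x + y)"]) simp
next
  case (Add a b)
  then obtain r r' where "below r a" "below r' b" by auto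
  then show ?case by (intro exI[of _ "r + r'"]) (auto intro: below_mono)
next
  case (Sub a b)
  then obtain r r' where "below r a" "below r' b" by auto
  then show ?case by (intro exI[of _ "r + r'"]) (auto intro: below_mono)
next
  case (Cond a b c)
  then obtain r r' r'' where "below r a" "below r' b" "below r'' c" by auto
  then show ?case by (intro exI[of _ "r + r' + r''"]) (auto intro: below_mono)
next
  case (Sum x a)
  then obtain r where "below r a" by auto
  then show ?case using Sum.prems by (intro exI[of _ "r + Suc x"]) (auto intro: below_mono)
qed simp

lemma fv_below: "below r t \<Longrightarrow> v \<in> fv t \<Longrightarrow> v < r"
  by (induction t) auto

text \<open>The result goes to register \<open>r\<close>; registers below are preserved and those
  above are scratch. A sum accumulates in \<open>r\<close> and saves the old value of its bound
  variable in \<open>r + 1\<close>, hence its body is compiled for \<open>r + 2\<close>. A lookup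
  has to walk along the bit list, since trees have no random access.\<close>

fun compile :: "nat \<Rightarrow> tm \<Rightarrow> com" where
  "compile r (V x) = Assign r (Var x)"
| "compile r One = Assign r (Const (unary 1))"
| "compile r (Look x y) =
    Seq (Assign r (Var 0))
   (Seq (Assign (r + 1) (Var x))
   (Seq (Loop (r + 1)
          (Seq (Assign (r + 2) (Var 1))
               (Loop (r + 2) (Assign r (TailE (Var r))))))
   (Seq (Assign (r + 1) (Var y))
   (Seq (Loop (r + 1) (Assign r (TailE (Var r))))
        (Assign r (HeadE (Var r)))))))"
| "compile r (Add a b) =
    Seq (compile r a) (Seq (compile (r + 1) b)
      (Loop (r + 1) (Assign r (PairE (Const Atom) (Var r)))))"
| "compile r (Sub a b) =
    Seq (compile r a) (Seq (compile (r + 1) b)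
      (Loop (r + 1) (Assign r (TailE (Var r)))))"
| "compile r (Cond a b c) = Seq (compile r a) (If (Var r) (compile r b) (compile r c))"
| "compile r (Sum x a) =
    Seq (Assign r (Const Atom))
   (Seq (Assign (r + 1) (Var x))
   (Seq (Assign x (Var 1))
   (Seq (Loop x
          (Seq (compile (r + 2) a)
               (Loop (r + 2) (Assign r (PairE (Const Atom) (Var r))))))
        (Assign x (Var (r + 1))))))"

text \<open>The bound is \<open>e v \<le> n\<close> and not \<open>e v < n\<close>: variable 1 has
  the value \<open>n\<close>, which as a row index selects the row of terminals.\<close>

definition rep :: "bool list \<Rightarrow> nat \<Rightarrow> (nat \<Rightarrow> nat) \<Rightarrow> nat set \<Rightarrow> store \<Rightarrow> bool" where
  "rep bs n e A s \<longleftrightarrow> s 0 = tree_of_bools bs \<and> s 1 = unary n \<and>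
     (\<forall>v\<in>A. s v = unary (e v) \<and> e v \<le> n)"

abbreviation returns :: "nat \<Rightarrow> nat \<Rightarrow> store \<Rightarrow> store \<Rightarrow> bool" where
  "returns r k s s' \<equiv> s' r = unary k \<and> (\<forall>v<r. s' v = s v)"

lemma runs_Loop_tail:
  assumes "s x = unary a" "x \<noteq> r" "Suc a * 8 \<le> b"
  shows "runs (Loop x (Assign r (TailE (Var r)))) s b
    (\<lambda>s'. s' r = (tail ^^ a) (s r) \<and> (\<forall>v. v \<noteq> r \<longrightarrow> v \<noteq> x \<longrightarrow> s' v = s v))"
proof -
  have "runs (Loop x (Assign r (TailE (Var r)))) s b
    (\<lambda>s'. s' x = Atom \<and> (\<lambda>i s'. s' r = (tail ^^ (a - i)) (s r) \<and> (\<forall>v. v \<noteq> r \<longrightarrow> v \<noteq> x \<longrightarrow> s' v = s v)) 0 s')"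
  proof (rule runs_Loop[where b=3 and a=a], goal_cases)
    case (1 i s')
    have "a - i = Suc (a - Suc i)" using 1 by simp
    then show ?case using 1 assms by (intro runs_Assign) auto
  qed (use assms in auto)
  then show ?thesis by (rule runs_mono) auto
qed

lemma runs_Loop_Pair:
  assumes "s x = unary a" "s r = unary k" "x \<noteq> r" "Suc a * 9 \<le> b"
  shows "runs (Loop x (Assign r (PairE (Const Atom) (Var r)))) s b
    (\<lambda>s'. s' r = unary (k + a) \<and> (\<forall>v. v \<noteq> r \<longrightarrow> v \<noteq> x \<longrightarrow> s' v = s v))"
proof -
  have "runs (Loop x (Assign r (PairE (Const Atom) (Var r)))) s b
    (\<lambda>s'. s' x = Atom \<and> (\<lambda>i s'. s' r = unary (k + (a - i)) \<and> (\<forall>v. v \<noteq> r \<longrightarrow> v \<noteq> x \<longrightarrow> s' v = s v)) 0 s')"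
  proof (rule runs_Loop[where b=4 and a=a], goal_cases)
    case (1 i s')
    have "a - i = Suc (a - Suc i)" using 1 by simp
    then show ?case using 1 assms by (intro runs_Assign) auto
  qed (use assms in auto)
  then show ?thesis by (rule runs_mono) auto
qed

lemma funpow_tail_unary: "(tail ^^ a) (unary k) = unary (k - a)"
  by (induction a) auto

lemma funpow_tail_tree_of_bools: "(tail ^^ a) (tree_of_bools bs) = tree_of_bools (drop a bs)"
  by (induction a) auto

text \<open>Compiled programs use computed values as loop counters, so their running time is bounded
  only if these values are.\<close>

lemma tval_bound:
  "\<exists>p :: nat poly. \<forall>bs n e. (\<forall>v\<in>fv t. e v \<le> n) \<longrightarrow> tval bs n e t \<le> poly p n"
proof (induction t)
  case (V x)
  show ?case by (rule exI[of _ "[:0, 1:]"]) auto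
next
  case One
  show ?case by (rule exI[of _ "[:1:]"]) auto
next
  case (Look x y)
  show ?case by (rule exI[of _ "[:1:]"]) auto
next
  case (Add a b)
  then obtain p q :: "nat poly" where
    "\<forall>bs n e. (\<forall>v\<in>fv a. e v \<le> n) \<longrightarrow> tval bs n e a \<le> poly p n"
    "\<forall>bs n e. (\<forall>v\<in>fv b. e v \<le> n) \<longrightarrow> tval bs n e b \<le> poly q n" by blast
  then show ?case by (intro exI[of _ "p + q"]) (auto intro!: add_mono)
next
  case (Sub a b)
  then obtain p :: "nat poly" where
    "\<forall>bs n e. (\<forall>v\<in>fv a. e v \<le> n) \<longrightarrow> tval bs n e a \<le> poly p n" by blast
  then show ?case by (intro exI[of _ p]) (auto intro: le_trans[OF diff_le_self])
next
  case (Cond a b c)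
  then obtain p q :: "nat poly" where
    "\<forall>bs n e. (\<forall>v\<in>fv b. e v \<le> n) \<longrightarrow> tval bs n e b \<le> poly p n"
    "\<forall>bs n e. (\<forall>v\<in>fv c. e v \<le> n) \<longrightarrow> tval bs n e c \<le> poly q n" by blast
  then show ?case by (intro exI[of _ "p + q"]) (auto intro: trans_le_add1 trans_le_add2)
next
  case (Sum x a)
  then obtain p :: "nat poly" where
    p: "\<And>bs n e. (\<forall>v\<in>fv a. e v \<le> n) \<Longrightarrow> tval bs n e a \<le> poly p n" by blast
  have "tval bs n e (Sum x a) \<le> poly ([:0, 1:] * p) n" if "\<forall>v\<in>fv (Sum x a). e v \<le> n" for bs n e
  proof -
    have "(\<Sum>i<n. tval bs n (e(x := i)) a) \<le> of_nat (card {..<n}) * poly p n"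
      by (rule sum_bounded_above, rule p) (use that in auto)
    then show ?thesis by simp
  qed
  then show ?case by blast
qed

text \<open>The common part of addition and subtraction: \<open>L\<close> combines registers
  \<open>r\<close> and \<open>r + 1\<close> in time linear in the second value, and
  \<open>tval_bound\<close> makes that polynomial in \<open>n\<close>.\<close>

lemma compile_binary:
  fixes p q :: "nat poly"
  assumes p: "\<And>bs n e s. rep bs n e (fv a) s \<Longrightarrow> runs (compile r a) s (poly p n) (returns r (tval bs n e a) s)"
    and q: "\<And>bs n e s. rep bs n e (fv b) s \<Longrightarrow>
      runs (compile (r + 1) b) s (poly q n) (returns (r + 1) (tval bs n e b) s)"
    and loop: "\<And>s x y. s r = unary x \<Longrightarrow> s (r + 1) = unary y \<Longrightarrow> runs L s (Suc y * 9) (returns r (g x y) s)"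
    and below: "below r b" "2 \<le> r"
  shows "\<exists>p :: nat poly. \<forall>bs n e s. rep bs n e (fv a \<union> fv b) s \<longrightarrow>
    runs (Seq (compile r a) (Seq (compile (r + 1) b) L)) s (poly p n) (returns r (g (tval bs n e a) (tval bs n e b)) s)"
proof -
  obtain w :: "nat poly" where w: "\<And>bs n e. (\<forall>v\<in>fv b. e v \<le> n) \<Longrightarrow> tval bs n e b \<le> poly w n"
    using tval_bound[of b] by blast
  have "runs (Seq (compile r a) (Seq (compile (r + 1) b) L)) s (poly (p + (q + ([:1:] + w) * [:9:])) n)
      (returns r (g (tval bs n e a) (tval bs n e b)) s)"
    if rep: "rep bs n e (fv a \<union> fv b) s" for bs n e s
  proof (rule runs_Seq[OF p[of bs n e]])
    fix s1 assume 1: "returns r (tval bs n e a) s s1"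
    show "runs (Seq (compile (r + 1) b) L) s1 (poly q n + (1 + poly w n) * 9)
      (returns r (g (tval bs n e a) (tval bs n e b)) s)"
    proof (rule runs_Seq[OF q[of bs n e]])
      show "rep bs n e (fv b) s1" using rep 1 fv_below[OF below(1)] below(2) by (auto simp: rep_def)
      fix s2 assume 2: "returns (r + 1) (tval bs n e b) s1 s2"
      show "runs L s2 ((1 + poly w n) * 9) (returns r (g (tval bs n e a) (tval bs n e b)) s)"
        by (rule runs_mono[OF loop[where x="tval bs n e a" and y="tval bs n e b"]])
          (use 1 2 w[of e n bs] rep in \<open>auto simp: rep_def\<close>)
    qed simp
  qed (use rep in \<open>auto simp: rep_def\<close>)
  then show ?thesis by blast
qed

text \<open>The order of quantifiers is the point: the polynomial is fixed before the table,
  \<open>n\<close>, the environment and the store. The register stays arbitrary in the induction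
  because subterms are compiled for higher registers.\<close>

lemma compile_correct:
  assumes "below r t" "2 \<le> r"
  shows "\<exists>p :: nat poly. \<forall>bs n e s. rep bs n e (fv t) s \<longrightarrow>
    runs (compile r t) s (poly p n) (returns r (tval bs n e t) s)"
  using assms
proof (induction t arbitrary: r)
  case (V x)
  show ?case by (rule exI[of _ "[:2:]"]) (auto intro!: runs_Assign simp: rep_def)
next
  case One
  show ?case by (rule exI[of _ "[:2:]"]) (auto intro!: runs_Assign simp: rep_def)
next
  case (Look x y)
  have "runs (compile r (Look x y)) s ((n + 1) * (10 + (n + 1) * 8) + 9 * (n + 1) + 10)
     (returns r (tval bs n e (Look x y)) s)"
    if rep: "rep bs n e {x, y} s" for bs n e s
  proof -
    define L2 where "L2 = Loop (r + 2) (Assign r (TailE (Var r)))"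
    \<comment> \<open>\<open>I k\<close> says that \<open>k\<close> bits have been passed. After
      \<open>e x\<close> rounds of \<open>n\<close> steps and \<open>e y\<close> further steps,
      \<open>k\<close> is the index of the table entry.\<close>
    define I where "I k s' \<longleftrightarrow> s' r = tree_of_bools (drop k bs) \<and> (\<forall>v<r. s' v = s v)" for k s'
    have A: "runs (Loop (r + 1) (Seq (Assign (r + 2) (Var 1)) L2)) s'
          ((n + 1) * (10 + (n + 1) * 8)) (\<lambda>s'. s' (r + 1) = Atom \<and> I ((e x - 0) * n) s')"
      if "I 0 s'" "s' (r + 1) = unary (e x)" for s'
    proof (rule runs_Loop[where b="2 + (n + 1) * 8" and a="e x" and Inv="\<lambda>i. I ((e x - i) * n)"], goal_cases)
      case (1 i u)
      show ?case
      proof (rule runs_Seq)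
        show "runs (Assign (r + 2) (Var 1)) (u(r + 1 := unary i)) 2
          (\<lambda>u'. u' = u(r + 1 := unary i, r + 2 := unary n))"
          using 1 rep Look.prems by (intro runs_Assign) (auto simp: I_def rep_def)
        fix u' assume u': "u' = u(r + 1 := unary i, r + 2 := unary n)"
        have e: "(e x - i) * n = n + (e x - Suc i) * n"
        proof -
          have "e x - i = Suc (e x - Suc i)" using 1 by simp
          then show ?thesis by simp
        qed
        show "runs L2 u' ((n + 1) * 8) (\<lambda>s'. s' (r + 1) = unary i \<and> I ((e x - i) * n) s')"
          unfolding L2_def
          by (rule runs_mono[OF runs_Loop_tail[where a=n]])
            (use 1 in \<open>auto simp: u' I_def funpow_tail_tree_of_bools e\<close>)
      qed simp
    next
      case 4
      show ?case using rep by (intro mult_mono) (auto simp: rep_def)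
    qed (use that in auto)
    have B: "runs (Loop (r + 1) (Assign r (TailE (Var r)))) s' (8 * (n + 1))
       (\<lambda>s'. I (e x * n + e y) s')" if "I (e x * n) s'" "s' (r + 1) = unary (e y)" for s'
      by (rule runs_mono[OF runs_Loop_tail[where a="e y"]])
        (use that rep in \<open>auto simp: I_def rep_def funpow_tail_tree_of_bools add.commute\<close>)
    have xy: "x < r" "y < r" "2 \<le> r" using Look.prems by auto
    define rest3 where "rest3 = Seq (Loop (r + 1) (Assign r (TailE (Var r)))) (Assign r (HeadE (Var r)))"
    define rest2 where "rest2 = Seq (Assign (r + 1) (Var y)) rest3"
    define rest1 where "rest1 = Seq (Loop (r + 1) (Seq (Assign (r + 2) (Var 1)) L2)) rest2"
    let ?Q = "returns r (tval bs n e (Look x y)) s"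
    have 3: "runs rest3 s' (8 * (n + 1) + 3) ?Q" if "I (e x * n) s'" "s' (r + 1) = unary (e y)" for s'
      unfolding rest3_def
      by (rule runs_Seq[OF B[OF that], where ?b2.0=3])
        (auto intro!: runs_Assign simp: I_def head_tree_of_bools_drop)
    have 2: "runs rest2 s' (8 * (n + 1) + 5) ?Q" if "I (e x * n) s'" for s'
      unfolding rest2_def
      by (rule runs_Seq[where ?b1.0=2 and R="\<lambda>s'. I (e x * n) s' \<and> s' (r + 1) = unary (e y)", OF _ 3])
        (use that rep xy in \<open>auto intro!: runs_Assign simp: I_def rep_def\<close>)
    have 1: "runs rest1 s' ((n + 1) * (10 + (n + 1) * 8) + (8 * (n + 1) + 5)) ?Q"
      if "I 0 s'" "s' (r + 1) = unary (e x)" for s'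
      unfolding rest1_def by (rule runs_Seq[OF A[OF that] 2]) auto
    show ?thesis unfolding compile.simps L2_def[symmetric] rest3_def[symmetric] rest2_def[symmetric] rest1_def[symmetric]
    proof (rule runs_Seq[where ?b1.0=2 and R="I 0"])
      show "runs (Assign r (Var 0)) s 2 (I 0)" using rep xy by (intro runs_Assign) (auto simp: I_def rep_def)
      show "runs (Seq (Assign (r + 1) (Var x)) rest1) s' ((n + 1) * (10 + (n + 1) * 8) + (8 * (n + 1) + 5) + 2) ?Q"
        if "I 0 s'" for s'
        by (rule runs_Seq[where ?b1.0=2 and R="\<lambda>s'. I 0 s' \<and> s' (r + 1) = unary (e x)", OF _ 1])
          (use that rep xy in \<open>auto intro!: runs_Assign simp: I_def rep_def\<close>)
    qed simp
  qed
  then show ?case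
    by (intro exI[of _ "[:1, 1:] * ([:10:] + [:1, 1:] * [:8:]) + [:9:] * [:1, 1:] + [:10:]"])
      (simp add: algebra_simps)
next
  case (Add a b)
  obtain p q where
    "\<And>bs n e s. rep bs n e (fv a) s \<Longrightarrow> runs (compile r a) s (poly p n) (returns r (tval bs n e a) s)"
    "\<And>bs n e s. rep bs n e (fv b) s \<Longrightarrow>
      runs (compile (r + 1) b) s (poly q n) (returns (r + 1) (tval bs n e b) s)"
    using Add.IH(1)[of r] Add.IH(2)[of "r + 1"] Add.prems below_mono[of r b "r + 1"] by auto
  then show ?case unfolding compile.simps fv.simps tval.simps
  proof (rule compile_binary)
    fix s :: store and x y assume "s r = unary x" "s (r + 1) = unary y"
    then show "runs (Loop (r + 1) (Assign r (PairE (Const Atom) (Var r)))) s (Suc y * 9) (returns r (x + y) s)"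
      by (intro runs_mono[OF runs_Loop_Pair]) auto
  qed (use Add.prems in simp_all)
next
  case (Sub a b)
  obtain p q where
    "\<And>bs n e s. rep bs n e (fv a) s \<Longrightarrow> runs (compile r a) s (poly p n) (returns r (tval bs n e a) s)"
    "\<And>bs n e s. rep bs n e (fv b) s \<Longrightarrow>
      runs (compile (r + 1) b) s (poly q n) (returns (r + 1) (tval bs n e b) s)"
    using Sub.IH(1)[of r] Sub.IH(2)[of "r + 1"] Sub.prems below_mono[of r b "r + 1"] by auto
  then show ?case unfolding compile.simps fv.simps tval.simps
  proof (rule compile_binary)
    fix s :: store and x y assume "s r = unary x" "s (r + 1) = unary y"
    then show "runs (Loop (r + 1) (Assign r (TailE (Var r)))) s (Suc y * 9) (returns r (x - y) s)"
      by (intro runs_mono[OF runs_Loop_tail[where a=y]]) (auto simp: funpow_tail_unary)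
  qed (use Sub.prems in simp_all)
next
  case (Cond a b c)
  obtain p q u where
    p: "\<And>bs n e s. rep bs n e (fv a) s \<Longrightarrow>
      runs (compile r a) s (poly p n) (returns r (tval bs n e a) s)"
    and q: "\<And>bs n e s. rep bs n e (fv b) s \<Longrightarrow>
      runs (compile r b) s (poly q n) (returns r (tval bs n e b) s)"
    and u: "\<And>bs n e s. rep bs n e (fv c) s \<Longrightarrow>
      runs (compile r c) s (poly u n) (returns r (tval bs n e c) s)"
    using Cond.IH(1)[of r] Cond.IH(2)[of r] Cond.IH(3)[of r] Cond.prems by auto
  have "runs (compile r (Cond a b c)) s (poly (p + ([:2:] + (q + u))) n)
     (returns r (tval bs n e (Cond a b c)) s)"
    if rep: "rep bs n e (fv (Cond a b c)) s" for bs n e s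
    unfolding compile.simps
  proof (rule runs_Seq[OF p[of bs n e]])
    fix s1 assume 1: "s1 r = unary (tval bs n e a) \<and> (\<forall>v<r. s1 v = s v)"
    have rep': "rep bs n e (fv b) s1" "rep bs n e (fv c) s1"
      using rep 1 fv_below[of r b] fv_below[of r c] Cond.prems by (auto simp: rep_def)
    show "runs (If (Var r) (compile r b) (compile r c)) s1 (2 + (poly q n + poly u n))
       (returns r (tval bs n e (Cond a b c)) s)"
    proof (rule runs_If)
      assume "eval_expr (Var r) s1 \<noteq> Atom"
      then show "runs (compile r b) s1 (poly q n + poly u n)
         (returns r (tval bs n e (Cond a b c)) s)"
        using 1 by (intro runs_mono[OF q[OF rep'(1)]]) auto
    next
      assume "eval_expr (Var r) s1 = Atom"
      then show "runs (compile r c) s1 (poly q n + poly u n)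
         (returns r (tval bs n e (Cond a b c)) s)"
        using 1 by (intro runs_mono[OF u[OF rep'(2)]]) auto
    qed simp
  qed (use rep in \<open>auto simp: rep_def\<close>)
  then show ?case by blast
next
  case (Sum x a)
  have x: "2 \<le> x" "x < r" "below r a" using Sum.prems by auto
  obtain p where
    p: "\<And>bs n e s. rep bs n e (fv a) s \<Longrightarrow>
      runs (compile (r + 2) a) s (poly p n)
        (returns (r + 2) (tval bs n e a) s)"
    using Sum.IH[of "r + 2"] x below_mono[of r a "r + 2"] by auto
  obtain w :: "nat poly" where w: "\<And>bs n e. (\<forall>v\<in>fv a. e v \<le> n) \<Longrightarrow> tval bs n e a \<le> poly w n"
    using tval_bound[of a] by blast
  define B where "B = [:1, 1:] * (p + ([:1:] + w) * [:9:] + [:5:])"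
  have "runs (compile r (Sum x a)) s (poly (B + [:8:]) n)
     (returns r (tval bs n e (Sum x a)) s)"
    if rep: "rep bs n e (fv (Sum x a)) s" for bs n e s
    unfolding compile.simps
  proof (rule runs_Seq[where ?b1.0=2 and ?b2.0="poly B n + 6"])
    show "runs (Assign r (Const Atom)) s 2 (\<lambda>s'. s' = s(r := Atom))"
      by (intro runs_Assign) auto
    fix s1 assume 1: "s1 = s(r := Atom)"
    let ?L = "Loop x (Seq (compile (r + 2) a) (Loop (r + 2) (Assign r (PairE (Const Atom) (Var r)))))"
    let ?Q = "\<lambda>s'. s' r = unary (tval bs n e (Sum x a)) \<and> (\<forall>v<r. s' v = s v)"
    show "runs (Seq (Assign (r + 1) (Var x)) (Seq (Assign x (Var 1)) (Seq ?L (Assign x (Var (r + 1))))))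
       s1 (poly B n + 6) ?Q"
    proof (rule runs_Seq[where ?b1.0=2 and ?b2.0="poly B n + 4"])
      show "runs (Assign (r + 1) (Var x)) s1 2 (\<lambda>s'. s' = s(r := Atom, r + 1 := s x))"
        using x by (intro runs_Assign) (auto simp: 1)
      fix s2 assume 2: "s2 = s(r := Atom, r + 1 := s x)"
      show "runs (Seq (Assign x (Var 1)) (Seq ?L (Assign x (Var (r + 1))))) s2 (poly B n + 4) ?Q"
      proof (rule runs_Seq[where ?b1.0=2 and ?b2.0="poly B n + 2"])
        show "runs (Assign x (Var 1)) s2 2 (\<lambda>s'. s' = s(r := Atom, r + 1 := s x, x := unary n))"
          using x rep Sum.prems by (intro runs_Assign) (auto simp: 2 rep_def)
        fix s3 assume 3: "s3 = s(r := Atom, r + 1 := s x, x := unary n)"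
        let ?g = "\<lambda>i. tval bs n (e(x := i)) a"
        \<comment> \<open>The counter runs downwards, so the accumulator holds the sum over the
          upper segment \<open>{i..<n}\<close>. Preservation is claimed for \<open>x\<close> only
          once it has been restored from \<open>r + 1\<close>.\<close>
        define I where "I i s' \<longleftrightarrow> s' r = unary (sum ?g {i..<n}) \<and>
          (\<forall>v<r. v \<noteq> x \<longrightarrow> s' v = s v) \<and> s' (r + 1) = s x" for i s'
        show "runs (Seq ?L (Assign x (Var (r + 1)))) s3 (poly B n + 2) ?Q"
        proof (rule runs_Seq[where ?b2.0=2])
          show "runs ?L s3 (poly B n) (\<lambda>s'. s' x = Atom \<and> I 0 s')"
          proof (rule runs_Loop[where a=n and b="poly p n + (1 + poly w n) * 9"], goal_cases)
            case (1 i u)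
            have rep': "rep bs n (e(x := i)) (fv a) (u(x := unary i))"
              using 1 rep Sum.prems fv_below[of r a] by (force simp: rep_def I_def)
            show ?case
            proof (rule runs_Seq[OF p[OF rep']])
              fix u' assume u': "u' (r + 2) = unary (?g i) \<and> (\<forall>v<r + 2. u' v = (u(x := unary i)) v)"
              have g: "?g i \<le> poly w n" using rep' by (intro w) (auto simp: rep_def)
              have s: "sum ?g {i..<n} = sum ?g {Suc i..<n} + ?g i"
                using 1 by (simp add: sum.atLeast_Suc_lessThan)
              show "runs (Loop (r + 2) (Assign r (PairE (Const Atom) (Var r)))) u' ((1 + poly w n) * 9)
                (\<lambda>s'. s' x = unary i \<and> I i s')"
                by (rule runs_mono[OF runs_Loop_Pair[where a="?g i" and k="sum ?g {Suc i..<n}"]])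
                  (use 1 u' g x in \<open>auto simp: I_def s\<close>)
            qed simp
          qed (use 3 x in \<open>auto simp: I_def B_def algebra_simps\<close>)
          fix s4 assume "s4 x = Atom \<and> I 0 s4"
          then show "runs (Assign x (Var (r + 1))) s4 2 ?Q"
            using x by (intro runs_Assign) (auto simp: I_def atLeast0LessThan)
        qed simp
      qed simp
    qed simp
  qed simp
  then show ?case by blast
qed

section \<open>Reading an encoded instance\<close>

lemma tree_of_bool_eq_Atom_iff [simp]: "tree_of_bool b = Atom \<longleftrightarrow> \<not> b"
  by (cases b) auto

lemma poly_nat_mono: "x \<le> y \<Longrightarrow> poly (p :: nat poly) x \<le> poly p y"
  by (induction p) (auto intro!: add_mono mult_mono)

lemma runs_Skip: "Q s \<Longrightarrow> 1 \<le> b \<Longrightarrow> runs Skip s b Q"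
  unfolding runs_def using exec.Skip by blast

definition strip_unary :: com where
  "strip_unary = Seq
     (While (HeadE (Var 0)) (Seq (Assign 1 (PairE (Const Atom) (Var 1))) (Assign 0 (TailE (Var 0)))))
     (Assign 0 (TailE (Var 0)))"

lemma runs_strip_unary:
  assumes "s 0 = tree_of_bools (replicate n True @ False # bs)" "s 1 = Atom" "13 * (n + 1) \<le> b"
  shows "runs strip_unary s b (\<lambda>s'. s' 0 = tree_of_bools bs \<and> s' 1 = unary n)"
proof -
  let ?I = "\<lambda>i (s' :: store). s' 0 = tree_of_bools (replicate i True @ False # bs) \<and> i \<le> n \<and> s' 1 = unary (n - i)"
  have *: "runs (While (HeadE (Var 0)) (Seq (Assign 1 (PairE (Const Atom) (Var 1))) (Assign 0 (TailE (Var 0)))))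
    s (Suc n * (1 + expr_cost (HeadE (Var 0)) + 7)) (?I 0)"
  proof (rule runs_While[where Inv="?I"], goal_cases)
    case (1 i s')
    have e: "n - i = Suc (n - Suc i)" using 1 by auto
    show ?case
      by (intro conjI runs_Seq[where ?b1.0=4 and ?b2.0=3
            and R="\<lambda>u. u = s'(1 := unary (n - i))"] runs_Assign)
        (use 1 e in auto)
  qed (use assms in auto)
  show ?thesis unfolding strip_unary_def
    by (rule runs_Seq[OF *, where ?b2.0=3]) (use assms(3) in \<open>auto intro!: runs_Assign\<close>)
qed

text \<open>The counter starts at \<open>n + 1\<close> because the \<open>n\<close> rows of the
  adjacency matrix and the row of terminals precede the budget.\<close>

definition skip_rows :: com where
  "skip_rows = Seq (Assign 3 (Var 0)) (Seq (Assign 4 (PairE (Const Atom) (Var 1)))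
     (Loop 4 (Seq (Assign 5 (Var 1)) (Loop 5 (Assign 3 (TailE (Var 3)))))))"

lemma runs_skip_rows:
  assumes "s 0 = tree_of_bools bs" "s 1 = unary n" "6 + (n + 2) * (8 * n + 15) \<le> b"
  shows "runs skip_rows s b (\<lambda>s'. s' 0 = tree_of_bools bs \<and> s' 1 = unary n \<and>
    s' 3 = tree_of_bools (drop ((n + 1) * n) bs))"
  unfolding skip_rows_def
proof (rule runs_Seq[where ?b1.0=2 and ?b2.0="4 + (n + 2) * (8 * n + 15)"])
  show "runs (Assign 3 (Var 0)) s 2 (\<lambda>s'. s' = s(3 := tree_of_bools bs))"
    using assms by (intro runs_Assign) auto
  fix s1 assume 1: "s1 = s(3 := tree_of_bools bs)"
  let ?Q = "\<lambda>s'. s' 0 = tree_of_bools bs \<and> s' 1 = unary n \<and>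
    s' 3 = tree_of_bools (drop ((n + 1) * n) bs)"
  show "runs (Seq (Assign 4 (PairE (Const Atom) (Var 1)))
     (Loop 4 (Seq (Assign 5 (Var 1)) (Loop 5 (Assign 3 (TailE (Var 3))))))) s1 (4 + (n + 2) * (8 * n + 15)) ?Q"
  proof (rule runs_Seq[where ?b1.0=4 and ?b2.0="(n + 2) * (8 * n + 15)"])
    show "runs (Assign 4 (PairE (Const Atom) (Var 1))) s1 4 (\<lambda>s'. s' = s1(4 := unary (n + 1)))"
      using assms 1 by (intro runs_Assign) auto
    fix s2 assume 2: "s2 = s1(4 := unary (n + 1))"
    define I where "I i s' \<longleftrightarrow> s' 0 = tree_of_bools bs \<and> s' 1 = unary n \<and>
      s' 3 = tree_of_bools (drop ((n + 1 - i) * n) bs)" for i and s' :: store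
    have "runs (Loop 4 (Seq (Assign 5 (Var 1)) (Loop 5 (Assign 3 (TailE (Var 3)))))) s2 ((n + 2) * (8 * n + 15))
      (\<lambda>s'. s' 4 = Atom \<and> I 0 s')"
    proof (rule runs_Loop[where a="n + 1" and b="8 * n + 10"], goal_cases)
      case (1 i u)
      have e: "(Suc n - i) * n = n + (n - i) * n"
      proof -
        have "Suc n - i = Suc (n - i)" using 1 by simp
        then show ?thesis by simp
      qed
      show ?case
        by (rule runs_Seq[where ?b1.0=2 and ?b2.0="8 * n + 8"
              and R="\<lambda>s'. s' = u(4 := unary i, 5 := unary n)"],
            intro runs_Assign, use 1 in \<open>force simp: I_def\<close>, simp,
            rule runs_mono[OF runs_Loop_tail[where a=n]])
          (use 1 in \<open>auto simp: I_def funpow_tail_tree_of_bools e\<close>)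
    qed (use 2 1 assms in \<open>auto simp: I_def\<close>)
    then show "runs (Loop 4 (Seq (Assign 5 (Var 1)) (Loop 5 (Assign 3 (TailE (Var 3)))))) s2
      ((n + 2) * (8 * n + 15)) ?Q"
      by (rule runs_mono) (auto simp: I_def)
  qed simp
qed (use assms(3) in simp)

text \<open>Variable 6 holds the weight of the current bit, capped at the number of vertices.\<close>

definition double_weight :: tm where
  "double_weight = Sub (V 1) (Sub (Sub (V 1) (V 6)) (V 6))"

text \<open>The budget is given in binary and may be exponential in the length of the input, so it
  is never converted to unary. Its bits are subtracted from \<open>n\<close> one at a time; with
  truncation at zero, capping the weights at \<open>n\<close> does not change the result.\<close>

definition subtract_budget :: com where
  "subtract_budget =
    Seq (Assign 2 (Var 1))
   (Seq (compile 6 (Sub (V 1) (Sub (V 1) One)))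
     (While (Var 3)
       (Seq (If (HeadE (Var 3)) (Seq (compile 7 (Sub (V 2) (V 6))) (Assign 2 (Var 7))) Skip)
       (Seq (compile 7 double_weight)
       (Seq (Assign 6 (Var 7))
            (Assign 3 (TailE (Var 3))))))))"

lemma runs_subtract_budget:
  "\<exists>p :: nat poly. \<forall>s bs n K. s 0 = tree_of_bools bs \<longrightarrow> s 1 = unary n \<longrightarrow> s 3 = tree_of_bools (binary K) \<longrightarrow>
     runs subtract_budget s (poly p (n + length (binary K)))
       (\<lambda>s'. s' 0 = tree_of_bools bs \<and> s' 1 = unary n \<and> s' 2 = unary (n - K))"
proof -
  obtain p1 p2 p3 where
    p1: "\<And>bs n e s. rep bs n e {1} s \<Longrightarrow> runs (compile 6 (Sub (V 1) (Sub (V 1) One))) s (poly p1 n)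
       (returns 6 (e 1 - (e 1 - 1)) s)"
    and p2: "\<And>bs n e s. rep bs n e {2, 6} s \<Longrightarrow> runs (compile 7 (Sub (V 2) (V 6))) s (poly p2 n)
       (returns 7 (e 2 - e 6) s)"
    and p3: "\<And>bs n e s. rep bs n e {1, 6} s \<Longrightarrow> runs (compile 7 double_weight) s (poly p3 n)
       (returns 7 (e 1 - (e 1 - e 6 - e 6)) s)"
    using compile_correct[of 6 "Sub (V 1) (Sub (V 1) One)"] compile_correct[of 7 "Sub (V 2) (V 6)"]
      compile_correct[of 7 double_weight] unfolding double_weight_def by (auto simp: insert_commute)
  define B where "B = p2 + p3 + [:13:]"
  define q where "q = [:2:] + (p1 + [:1, 1:] * ([:2:] + B))"
  have "runs subtract_budget s (poly q (n + length (binary K)))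
       (\<lambda>s'. s' 0 = tree_of_bools bs \<and> s' 1 = unary n \<and> s' 2 = unary (n - K))"
    if s: "s 0 = tree_of_bools bs" "s 1 = unary n" "s 3 = tree_of_bools (binary K)" for s bs n K
  proof -
    \<comment> \<open>\<open>W\<close> is the true weight of the current bit, while only
      \<open>min W n\<close> is stored. Since \<open>r \<le> n\<close>, subtracting the capped
      weight from \<open>r\<close> gives the same as subtracting \<open>W\<close>.\<close>
    define J where "J W k r s' \<longleftrightarrow> s' 0 = tree_of_bools bs \<and> s' 1 = unary n \<and>
       s' 3 = tree_of_bools (binary k) \<and> s' 6 = unary (min W n) \<and> s' 2 = unary r \<and> r \<le> n \<and>
       r - W * k = n - K" for W k r and s' :: store
    define I where "I i s' \<longleftrightarrow> (\<exists>W k r. length (binary k) = i \<and> J W k r s')" for i and s' :: store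
    let ?Q = "\<lambda>s'. s' 0 = tree_of_bools bs \<and> s' 1 = unary n \<and> s' 2 = unary (n - K)"
    define body where "body = Seq (If (HeadE (Var 3)) (Seq (compile 7 (Sub (V 2) (V 6))) (Assign 2 (Var 7))) Skip)
       (Seq (compile 7 double_weight) (Seq (Assign 6 (Var 7)) (Assign 3 (TailE (Var 3)))))"
    have body: "runs body u (poly B n) (I i)" if I: "I (Suc i) u" for i u
    proof -
      obtain W k r where k: "length (binary k) = Suc i" and J: "J W k r u"
        using I by (auto simp: I_def)
      have k0: "k > 0" using k binary.simps[of 0] by (intro Nat.gr0I) auto
      have bk: "binary k = odd k # binary (k div 2)" using k0 by (subst binary.simps) auto
      define r' where "r' = (if odd k then r - min W n else r)"
      have r': "r' - 2 * W * (k div 2) = n - K"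
      proof (cases "odd k")
        case True
        have kk: "k = 2 * (k div 2) + 1" using True by presburger
        have "W * k = W + 2 * W * (k div 2)"
          by (subst kk) (simp add: algebra_simps del: odd_two_times_div_two_succ odd_two_times_div_two_nat)
        moreover have "r - min W n = r - W" using J by (auto simp: J_def min_def)
        ultimately show ?thesis using True J by (simp add: r'_def J_def)
      next
        case False
        then have e: "2 * W * (k div 2) = W * k"
          by (metis dvd_mult_div_cancel mult.assoc mult.commute)
        show ?thesis using J False unfolding r'_def e by (simp add: J_def)
      qed
      show ?thesis unfolding body_def
      proof (rule runs_Seq[where ?b1.0="poly p2 n + 6" and ?b2.0="poly p3 n + 5"])
        let ?R = "\<lambda>s'. s' 2 = unary r' \<and> (\<forall>v<7. v \<noteq> 2 \<longrightarrow> s' v = u v)"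
        show "runs (If (HeadE (Var 3)) (Seq (compile 7 (Sub (V 2) (V 6))) (Assign 2 (Var 7))) Skip) u
          (poly p2 n + 6) ?R"
        proof (rule runs_If[where ?b1.0="poly p2 n + 2"])
          assume "eval_expr (HeadE (Var 3)) u \<noteq> Atom"
          then have odd: "odd k" using J by (auto simp: J_def bk)
          have rep: "rep bs n ((\<lambda>_. 0)(2 := r, 6 := min W n)) {2, 6} u"
            using J by (auto simp: rep_def J_def)
          show "runs (Seq (compile 7 (Sub (V 2) (V 6))) (Assign 2 (Var 7))) u (poly p2 n + 2) ?R"
            by (rule runs_Seq[OF p2[OF rep]]) (use odd in \<open>auto intro!: runs_Assign simp: r'_def\<close>)
        next
          assume "eval_expr (HeadE (Var 3)) u = Atom"
          then have "even k" using J by (auto simp: J_def bk)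
          then show "runs Skip u (poly p2 n + 2) ?R"
            using J by (intro runs_Skip) (auto simp: r'_def J_def)
        qed simp
        fix u1 assume u1: "?R u1"
        have rep: "rep bs n ((\<lambda>_. 0)(1 := n, 6 := min W n)) {1, 6} u1"
          using u1 J by (auto simp: rep_def J_def)
        show "runs (Seq (compile 7 double_weight) (Seq (Assign 6 (Var 7)) (Assign 3 (TailE (Var 3))))) u1
          (poly p3 n + 5) (I i)"
        proof (rule runs_Seq[OF p3[OF rep], where ?b2.0=5])
          fix u2 :: store
          let ?e = "(\<lambda>_. 0)(1 :: nat := n, 6 := min W n)"
          assume u2: "u2 7 = unary (?e 1 - (?e 1 - ?e 6 - ?e 6)) \<and> (\<forall>v<7. u2 v = u1 v)"
          \<comment> \<open>With truncated subtraction, \<open>n - (n - w - w)\<close> is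
            \<open>min (2 * w) n\<close>.\<close>
          have t7: "u2 7 = unary (min (2 * W) n)" using u2 by (auto simp: min_def intro!: arg_cong[where f=unary])
          show "runs (Seq (Assign 6 (Var 7)) (Assign 3 (TailE (Var 3)))) u2 5 (I i)"
          proof (rule runs_Seq[where ?b1.0=2 and ?b2.0=3])
            show "runs (Assign 6 (Var 7)) u2 2 (\<lambda>s'. s' = u2(6 := unary (min (2 * W) n)))"
              using t7 by (intro runs_Assign) auto
            fix u3 assume u3: "u3 = u2(6 := unary (min (2 * W) n))"
            have "J (2 * W) (k div 2) r' (u3(3 := tree_of_bools (binary (k div 2))))"
              using J u1 u2 r' unfolding J_def u3 by (auto simp: r'_def)
            moreover have "tail (u3 3) = tree_of_bools (binary (k div 2))"
              using J u1 u2 by (auto simp: u3 J_def bk)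
            moreover have "length (binary (k div 2)) = i" using k by (simp add: bk)
            ultimately show "runs (Assign 3 (TailE (Var 3))) u3 3 (I i)"
              by (intro runs_Assign) (auto simp: I_def)
          qed simp
        qed simp
      qed (simp add: B_def)
    qed
    let ?B = "Suc (length (binary K)) * (1 + expr_cost (Var 3) + poly B n)"
    have loop: "runs (While (Var 3) body) u ?B (I 0)"
      if "I (length (binary K)) u" for u
    proof (rule runs_While[where Inv=I], goal_cases)
      case (1 i s)
      then show ?case using body[of i s] by (auto simp: I_def J_def length_Suc_conv)
    qed (use that in \<open>auto simp: I_def J_def\<close>)
    show ?thesis unfolding subtract_budget_def body_def[symmetric]
    proof (rule runs_Seq[where ?b1.0=2 and ?b2.0="poly p1 n + ?B"])
      show "runs (Assign 2 (Var 1)) s 2 (\<lambda>s'. s' = s(2 := unary n))"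
        using s by (intro runs_Assign) auto
      fix s1 assume 1: "s1 = s(2 := unary n)"
      have rep: "rep bs n (\<lambda>_. n) {1} s1" using s 1 by (auto simp: rep_def)
      show "runs (Seq (compile 6 (Sub (V 1) (Sub (V 1) One))) (While (Var 3) body)) s1
         (poly p1 n + ?B) ?Q"
      proof (rule runs_Seq[OF p1[OF rep]])
        fix s2 assume 2: "s2 6 = unary (n - (n - 1)) \<and> (\<forall>v<6. s2 v = s1 v)"
        \<comment> \<open>The initial weight 1 has to be capped as well, for the case
          \<open>n = 0\<close>.\<close>
        have "n - (n - 1) = min 1 n" by auto
        then have "J 1 K n s2" using 1 2 s by (auto simp: J_def)
        then have "I (length (binary K)) s2" by (auto simp: I_def)
        from loop[OF this] show "runs (While (Var 3) body) s2
           ?B ?Q"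
        proof (rule runs_mono)
          fix s' assume "I 0 s'"
          then obtain W k r where k: "length (binary k) = 0" and J: "J W k r s'"
            by (auto simp: I_def)
          have "k = 0" using k by (subst (asm) binary.simps) (auto split: if_splits)
          then show "?Q s'" using J by (simp add: J_def)
        qed simp
      qed simp
    next
      have "poly p1 n \<le> poly p1 (n + length (binary K))" "poly B n \<le> poly B (n + length (binary K))"
        by (auto intro: poly_nat_mono)
      then show "2 + (poly p1 n + ?B)
        \<le> poly q (n + length (binary K))"
        unfolding q_def poly_add poly_mult
        by (intro add_mono mult_mono) (auto intro: mult_le_mono le_trans)
    qed
  qed
  then show ?thesis by blast
qed

text \<open>The part of the input that stays in variable 0 while the term is evaluated. Matrix and
  terminal vector together act as one table with \<open>n + 1\<close> rows of length
  \<open>n\<close>.\<close>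

definition instance_bits :: "soct_instance \<Rightarrow> bool list" where
  "instance_bits I =
     (let G = graph_of I; n = card (verts G) in
      concat (map (\<lambda>i. map (\<lambda>j. {i, j} \<in> edges G) [0..<n]) [0..<n])
      @ map (\<lambda>i. i \<in> terminals I) [0..<n]
      @ binary (budget I))"

lemma encode_instance_eq:
  "encode_instance I = replicate (card (verts (graph_of I))) True @ False # instance_bits I"
  by (simp add: encode_instance_def instance_bits_def Let_def)

lemma length_concat_map_upt: "length (concat (map (\<lambda>i. map (f i) [0..<n]) [0..<m])) = m * n"
  by (induction m) auto

lemma nth_concat_map_upt:
  "i < m \<Longrightarrow> j < n \<Longrightarrow> concat (map (\<lambda>i. map (f i) [0..<n]) [0..<m]) ! (i * n + j) = f i j"
proof (induction m)
  case (Suc m)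
  have len: "length (concat (map (\<lambda>i. map (f i) [0..<n]) [0..<m])) = m * n"
    by (rule length_concat_map_upt)
  show ?case
  proof (cases "i < m")
    case True
    have "i * n + j < Suc i * n" using Suc.prems by simp
    also have "\<dots> \<le> m * n" using True by (intro mult_le_mono1) simp
    finally show ?thesis using Suc True len by (simp add: nth_append)
  next
    case False
    then have "i = m" using Suc.prems by simp
    then show ?thesis using Suc.prems len by (simp add: nth_append)
  qed
qed simp

lemma drop_instance_bits:
  assumes "n = card (verts (graph_of I))"
  shows "drop ((n + 1) * n) (instance_bits I) = binary (budget I)"
proof -
  have "instance_bits I = (concat (map (\<lambda>i. map (\<lambda>j. {i, j} \<in> edges (graph_of I)) [0..<n]) [0..<n])
      @ map (\<lambda>i. i \<in> terminals I) [0..<n]) @ binary (budget I)"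
    by (simp add: instance_bits_def Let_def assms)
  moreover have "length (concat (map (\<lambda>i. map (\<lambda>j. {i, j} \<in> edges (graph_of I)) [0..<n]) [0..<n])
      @ map (\<lambda>i. i \<in> terminals I) [0..<n]) = (n + 1) * n"
    by (simp add: length_concat_map_upt del: length_concat)
  ultimately show ?thesis by (metis append_eq_conv_conj)
qed

lemma tval_Look:
  assumes "n = card (verts (graph_of I))" "e y < n"
  shows "e x < n \<Longrightarrow> tval (instance_bits I) n e (Look x y) = of_bool ({e x, e y} \<in> edges (graph_of I))"
    and "e x = n \<Longrightarrow> tval (instance_bits I) n e (Look x y) = of_bool (e y \<in> terminals I)"
proof -
  let ?M = "concat (map (\<lambda>i. map (\<lambda>j. {i, j} \<in> edges (graph_of I)) [0..<n]) [0..<n])"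
  have eq: "instance_bits I = ?M @ map (\<lambda>i. i \<in> terminals I) [0..<n] @ binary (budget I)"
    by (simp add: instance_bits_def Let_def assms)
  have len: "length ?M = n * n" by (rule length_concat_map_upt)
  {
    assume x: "e x < n"
    have "e x * n + e y < Suc (e x) * n" using assms by simp
    also have "\<dots> \<le> n * n" using x by (intro mult_le_mono1) simp
    finally have lt: "e x * n + e y < n * n" .
    then show "tval (instance_bits I) n e (Look x y) = of_bool ({e x, e y} \<in> edges (graph_of I))"
      using nth_concat_map_upt[OF x assms(2), of "\<lambda>i j. {i, j} \<in> edges (graph_of I)"]
      by (simp add: eq nth_append len del: length_concat)
  }
  {
    assume "e x = n"
    then show "tval (instance_bits I) n e (Look x y) = of_bool (e y \<in> terminals I)"
      using assms(2) by (simp add: eq nth_append len del: length_concat)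
  }
qed

text \<open>Reading the budget leaves values in variables from 3 on, whereas the term is to be
  evaluated in an environment that is 0 there.\<close>

definition reset :: "nat list \<Rightarrow> com" where
  "reset vs = foldr (\<lambda>v c. Seq (Assign v (Const Atom)) c) vs Skip"

lemma runs_reset:
  "runs (reset vs) s (2 * length vs + 1) (\<lambda>s'. \<forall>v. s' v = (if v \<in> set vs then Atom else s v))"
proof (induction vs arbitrary: s)
  case Nil
  show ?case by (auto simp: reset_def intro: runs_Skip)
next
  case (Cons v vs)
  have e: "reset (v # vs) = Seq (Assign v (Const Atom)) (reset vs)" by (simp add: reset_def)
  show ?case unfolding e
  proof (rule runs_Seq[where ?b1.0=2 and R="\<lambda>s'. s' = s(v := Atom)"])
    show "runs (Assign v (Const Atom)) s 2 (\<lambda>s'. s' = s(v := Atom))" by (intro runs_Assign) auto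
    show "runs (reset vs) s' (2 * length vs + 1)
        (\<lambda>s'. \<forall>u. s' u = (if u \<in> set (v # vs) then Atom else s u))" if "s' = s(v := Atom)" for s'
      by (rule runs_mono[OF Cons.IH]) (auto simp: that)
  qed simp
qed

text \<open>The interface between programs and graphs: after this, only a fixed term expressing the
  problem is required. Variable 2 holds the least size that the complement of a transversal within
  budget can have.\<close>

lemma solvable_by_term:
  assumes "proper t"
    and correct: "\<And>I. I \<in> A \<Longrightarrow> tval (instance_bits I) (card (verts (graph_of I)))
          ((\<lambda>_. 0)(1 := card (verts (graph_of I)), 2 := card (verts (graph_of I)) - budget I)) t > 0
        \<longleftrightarrow> P I"
  shows "solvable_in_poly_time encode_instance A P"
proof -
  obtain r where r: "below r t" using ex_below[OF assms(1)] by blast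
  \<comment> \<open>Adding 3 keeps the result register apart from variables 0, 1 and 2, and gives
    \<open>[3..<r']\<close> the length \<open>r\<close>.\<close>
  define r' where "r' = r + 3"
  have r': "below r' t" "2 \<le> r'" using below_mono[OF r] by (auto simp: r'_def)
  obtain p where p: "\<And>bs n e s. rep bs n e (fv t) s \<Longrightarrow>
    runs (compile r' t) s (poly p n) (\<lambda>s'. s' r' = unary (tval bs n e t) \<and> (\<forall>v<r'. s' v = s v))"
    using compile_correct[OF r'] by blast
  obtain q :: "nat poly" where q: "\<And>s bs n K. s 0 = tree_of_bools bs \<Longrightarrow> s 1 = unary n \<Longrightarrow>
     s 3 = tree_of_bools (binary K) \<Longrightarrow>
     runs subtract_budget s (poly q (n + length (binary K)))
       (\<lambda>s'. s' 0 = tree_of_bools bs \<and> s' 1 = unary n \<and> s' 2 = unary (n - K))"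
    using runs_subtract_budget by blast
  let ?c1 = "Seq (compile r' t) (Assign 0 (Var r'))"
  let ?c2 = "Seq (reset [3..<r']) ?c1"
  let ?c3 = "Seq subtract_budget ?c2"
  define c where "c = Seq strip_unary (Seq skip_rows ?c3)"
  define w where "w = [:13:] * [:1, 1:] + (([:6:] + [:2, 1:] * [:15, 8:]) + (q + ([:2 * r + 1:] + (p + [:2:]))))"
  have "\<exists>t s. exec c (initial_store (encode_instance I)) t s \<and> t \<le> poly w (length (encode_instance I)) \<and>
        (s 0 \<noteq> Atom \<longleftrightarrow> P I)" if "I \<in> A" for I
  proof -
    define n where "n = card (verts (graph_of I))"
    define bs where "bs = instance_bits I"
    define l where "l = length (encode_instance I)"
    have n: "n \<le> l" by (simp add: n_def l_def encode_instance_eq)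
    have K: "n + length (binary (budget I)) \<le> l"
      by (simp add: n_def l_def encode_instance_eq instance_bits_def Let_def)
    define e :: "nat \<Rightarrow> nat" where "e = (\<lambda>_. 0)(1 := n, 2 := n - budget I)"
    let ?b1 = "(2 * r + 1) + (poly p n + 2)"
    let ?b2 = "poly q (n + length (binary (budget I))) + ?b1"
    let ?Q = "\<lambda>s' :: store. s' 0 = unary (tval bs n e t)"
    have "runs c (initial_store (encode_instance I)) (poly w l) ?Q"
      unfolding c_def
    proof (rule runs_Seq[OF runs_strip_unary[where n=n and bs=bs and b="13 * (n + 1)"]])
      fix s1 :: store assume 1: "s1 0 = tree_of_bools bs \<and> s1 1 = unary n"
      show "runs (Seq skip_rows ?c3) s1
        ((6 + (n + 2) * (8 * n + 15)) + ?b2) ?Q"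
      proof (rule runs_Seq[OF runs_skip_rows[where n=n and bs=bs and b="6 + (n + 2) * (8 * n + 15)"]])
        fix s2 :: store assume 2: "s2 0 = tree_of_bools bs \<and> s2 1 = unary n \<and> s2 3 = tree_of_bools (drop ((n + 1) * n) bs)"
        show "runs ?c3 s2
          ?b2 ?Q"
        proof (rule runs_Seq[OF q[of _ bs n "budget I"]])
          fix s3 :: store assume 3: "s3 0 = tree_of_bools bs \<and> s3 1 = unary n \<and> s3 2 = unary (n - budget I)"
          show "runs ?c2 s3 ?b1 ?Q"
          proof (rule runs_Seq[OF runs_reset])
            fix s4 :: store assume 4: "\<forall>v. s4 v = (if v \<in> set [3..<r'] then Atom else s3 v)"
            have v: "v = 1 \<or> v = 2 \<or> v \<in> set [3..<r']" if "v \<in> fv t" for v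
              using fv_below[OF r'(1) that] fv_proper[OF assms(1) that] by auto
            have "rep bs n e (fv t) s4" unfolding rep_def
            proof (intro conjI ballI)
              fix u assume "u \<in> fv t"
              from v[OF this] show "s4 u = unary (e u)" "e u \<le> n"
                using 3 4 by (auto simp: e_def)
            qed (use 3 4 in auto)
            from p[OF this] show "runs ?c1 s4 (poly p n + 2) ?Q"
              by (rule runs_Seq) (auto intro!: runs_Assign)
          qed (simp add: r'_def)
        qed (use 2 drop_instance_bits[of n I] in \<open>auto simp: n_def bs_def\<close>)
      qed (use 1 in auto)
    next
      have "poly q (n + length (binary (budget I))) \<le> poly q l" "poly p n \<le> poly p l"
        using n K by (auto intro: poly_nat_mono)
      moreover have "6 + (n + 2) * (8 * n + 15) \<le> 6 + (l + 2) * (8 * l + 15)"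
        using n by (intro add_mono mult_mono) auto
      moreover have "13 * (n + 1) \<le> 13 * (l + 1)" using n by simp
      ultimately show "13 * (n + 1) + ((6 + (n + 2) * (8 * n + 15)) + ?b2)
        \<le> poly w l" unfolding w_def by (simp add: algebra_simps)
    qed (auto simp: initial_store_def encode_instance_eq n_def bs_def)
    then obtain u s where "exec c (initial_store (encode_instance I)) u s" "u \<le> poly w l" "?Q s"
      by (auto simp: runs_def)
    moreover have "tval bs n e t > 0 \<longleftrightarrow> P I"
      using correct[OF that] by (simp add: bs_def n_def e_def)
    ultimately show ?thesis unfolding l_def by (metis not_gr_zero unary_eq_Atom_iff)
  qed
  then show ?thesis unfolding solvable_in_poly_time_def by blast
qed

section \<open>Cycles, clusters and the forbidden induced subgraph\<close>

definition odd_T_cycle_free :: "'a ugraph \<Rightarrow> 'a set \<Rightarrow> 'a set \<Rightarrow> bool" where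
  "odd_T_cycle_free G T W \<longleftrightarrow> W \<subseteq> verts G \<and> (\<forall>c. odd_T_cycle G T c \<longrightarrow> \<not> set c \<subseteq> W)"

lemma odd_T_cycle_transversal_iff:
  "odd_T_cycle_transversal G T S \<longleftrightarrow> S \<subseteq> verts G \<and> odd_T_cycle_free G T (verts G - S)"
  unfolding odd_T_cycle_transversal_def odd_T_cycle_free_def
  by (auto simp: odd_T_cycle_def is_cycle_def)

locale fin_graph =
  fixes G :: "'a ugraph"
  assumes simple: "simple_graph G"
begin

definition adj :: "'a \<Rightarrow> 'a \<Rightarrow> bool" where
  "adj u v \<longleftrightarrow> {u, v} \<in> edges G"

lemma finite_verts: "finite (verts G)"
  using simple by (simp add: simple_graph_def)

lemma adj_sym: "adj u v \<Longrightarrow> adj v u"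
  by (simp add: adj_def insert_commute)

lemma adj_irrefl [simp]: "\<not> adj u u"
  using simple by (auto simp: adj_def simple_graph_def)

lemma adj_verts: "adj u v \<Longrightarrow> u \<in> verts G \<and> v \<in> verts G"
  using simple by (auto simp: adj_def simple_graph_def)

text \<open>Replaces indices modulo the length by \<open>successively\<close> and a closing edge,
  the form that suits rotating, cutting and splicing lists.\<close>

lemma is_cycle_iff:
  "is_cycle G c \<longleftrightarrow> 3 \<le> length c \<and> distinct c \<and> successively adj c \<and> adj (last c) (hd c)"
proof (cases "3 \<le> length c")
  case True
  then have ne: "c \<noteq> []" by auto
  have "(\<forall>i<length c. adj (c ! i) (c ! (Suc i mod length c))) \<longleftrightarrow>
     successively adj c \<and> adj (last c) (hd c)" (is "?l \<longleftrightarrow> ?r")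
  proof
    assume l: ?l
    have "adj (c ! i) (c ! Suc i)" if "Suc i < length c" for i
      using l[rule_format, of i] that by simp
    moreover have "adj (last c) (hd c)"
      using l[rule_format, of "length c - 1"] True ne by (simp add: last_conv_nth hd_conv_nth)
    ultimately show ?r by (simp add: successively_conv_nth)
  next
    assume r: ?r
    show ?l
    proof (intro allI impI)
      fix i assume i: "i < length c"
      show "adj (c ! i) (c ! (Suc i mod length c))"
      proof (cases "Suc i < length c")
        case True
        then show ?thesis using r by (simp add: successively_conv_nth)
      next
        case False
        then have "i = length c - 1" "Suc i = length c" using i by auto
        then show ?thesis using r ne by (simp add: last_conv_nth hd_conv_nth)
      qed
    qed
  qed
  moreover have "set c \<subseteq> verts G" if "\<forall>i<length c. adj (c ! i) (c ! (Suc i mod length c))"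
  proof
    fix x assume "x \<in> set c"
    then obtain i where "i < length c" "x = c ! i" by (auto simp: in_set_conv_nth)
    then show "x \<in> verts G" using that[rule_format, of i] adj_verts by blast
  qed
  ultimately show ?thesis unfolding is_cycle_def adj_def[symmetric] by blast
qed (auto simp: is_cycle_def)

lemma is_cycle_rotate: "is_cycle G (xs @ ys) \<Longrightarrow> is_cycle G (ys @ xs)"
  by (cases "xs = []"; cases "ys = []") (auto simp: is_cycle_iff successively_append_iff)

definition indep :: "'a set \<Rightarrow> bool" where
  "indep X \<longleftrightarrow> (\<forall>u\<in>X. \<forall>v\<in>X. \<not> adj u v)"

text \<open>Absence of an induced path on three vertices; equivalently, \<open>Q\<close> induces a
  disjoint union of cliques.\<close>

definition cluster :: "'a set \<Rightarrow> bool" where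
  "cluster Q \<longleftrightarrow> (\<forall>u\<in>Q. \<forall>v\<in>Q. \<forall>w\<in>Q. adj u v \<longrightarrow> adj v w \<longrightarrow> u \<noteq> w \<longrightarrow> adj u w)"

lemma cluster_subset: "cluster Q \<Longrightarrow> C \<subseteq> Q \<Longrightarrow> cluster C"
  by (auto simp: cluster_def)

lemma indep_subset: "indep Q \<Longrightarrow> C \<subseteq> Q \<Longrightarrow> indep C"
  by (auto simp: indep_def)

text \<open>Every use of freeness goes through this form. \<open>I\<close> may have more than
  \<open>s\<close> vertices, as any \<open>s\<close> of them serve for the embedding.\<close>

lemma H_freeD:
  assumes free: "H_free (sP1_P3 s) G"
    and I: "I \<subseteq> verts G" "indep I" "s \<le> card I"
    and p: "adj a b" "adj b c" "\<not> adj a c" "a \<noteq> c"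
    and sep: "\<And>v x. v \<in> I \<Longrightarrow> x \<in> {a, b, c} \<Longrightarrow> v \<noteq> x \<and> \<not> adj v x"
  shows False
proof -
  have "finite I" using I(1) finite_verts finite_subset by blast
  obtain J where J: "J \<subseteq> I" "card J = s" "finite J"
    using obtain_subset_with_card_n[OF I(3)] by metis
  obtain f where f: "bij_betw f {..<s} J"
    using ex_bij_betw_nat_finite[OF J(3)] J(2) by (auto simp: atLeast0LessThan)
  define P where "P = [a, b, c]"
  have P: "P ! 0 = a" "P ! Suc 0 = b" "P ! 2 = c" by (auto simp: P_def)
  have abc: "a \<noteq> b" "b \<noteq> c" "a \<in> verts G" "b \<in> verts G" "c \<in> verts G" "\<not> adj c a" "adj b a" "adj c b"
    using p adj_verts adj_sym by auto
  define g where "g = case_sum f (\<lambda>i. P ! i)"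
  let ?W = "J \<union> {a, b, c}"
  have three: "{..<3} = {0, Suc 0, 2}" by auto
  have bij: "bij_betw g ({..<s} <+> {..<3}) ?W"
  proof -
    have 1: "bij_betw g (Inr ` {..<3}) {a, b, c}"
      unfolding three using abc p by (auto simp: bij_betw_def g_def P)
    have 2: "bij_betw g (Inl ` {..<s}) J"
      using f by (auto simp: bij_betw_def g_def inj_on_def image_image)
    have 3: "J \<inter> {a, b, c} = {}" using sep J by auto
    have "bij_betw g (Inl ` {..<s} \<union> Inr ` {..<3}) (J \<union> {a, b, c})"
      by (rule bij_betw_combine[OF 2 1 3])
    then show ?thesis by (simp add: Plus_def)
  qed
  have edge: "{u, v} \<in> edges (sP1_P3 s) \<longleftrightarrow>
      (\<exists>i j. u = Inr i \<and> v = Inr j \<and> {i, j} \<in> {{0, Suc 0}, {Suc 0, 2}})" for u v :: "nat + nat"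
  proof -
    have "edges (path_graph 3) = {{0, Suc 0}, {Suc 0, 2}}"
    proof -
      have "Suc i < 3 \<longleftrightarrow> i = 0 \<or> i = Suc 0" for i by auto
      then show ?thesis by (auto simp: path_graph_def numeral_2_eq_2)
    qed
    then have "edges (sP1_P3 s) = {{Inr 0, Inr (Suc 0)}, {Inr (Suc 0), Inr 2}}"
      by (simp add: sP1_P3_def disjoint_union_def edgeless_graph_def)
    then show ?thesis by (cases u; cases v) (auto simp: doubleton_eq_iff)
  qed
  have "graph_iso (sP1_P3 s) (induced_subgraph G ?W)"
    unfolding graph_iso_def
  proof (intro exI[of _ g] conjI ballI)
    show "bij_betw g (verts (sP1_P3 s)) (verts (induced_subgraph G ?W))"
      using bij by (simp add: sP1_P3_def disjoint_union_def edgeless_graph_def path_graph_def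
          induced_subgraph_def)
    fix u v assume "u \<in> verts (sP1_P3 s)" "v \<in> verts (sP1_P3 s)"
    then have uv: "u \<in> {..<s} <+> {..<3}" "v \<in> {..<s} <+> {..<3}"
      by (simp_all add: sP1_P3_def disjoint_union_def edgeless_graph_def path_graph_def)
    then have W: "g u \<in> ?W" "g v \<in> ?W" using bij by (auto simp: bij_betw_def)
    have fJ: "f i \<in> J" if "i < s" for i using f that by (auto simp: bij_betw_def)
    have "{u, v} \<in> edges (sP1_P3 s) \<longleftrightarrow> adj (g u) (g v)"
    proof (cases u; cases v)
      fix i j assume *: "u = Inl i" "v = Inl j"
      then have "f i \<in> I" "f j \<in> I" using uv fJ J by auto
      then show ?thesis using * I(2) by (auto simp: edge g_def indep_def)
    next
      fix i j assume *: "u = Inl i" "v = Inr j"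
      then have "f i \<in> I" "P ! j \<in> {a, b, c}" using uv fJ J unfolding three by (auto simp: P)
      then show ?thesis using * sep by (auto simp: edge g_def)
    next
      fix i j assume *: "u = Inr i" "v = Inl j"
      then have "f j \<in> I" "P ! i \<in> {a, b, c}" using uv fJ J unfolding three by (auto simp: P)
      then have "\<not> adj (f j) (P ! i)" using sep by blast
      then have "\<not> adj (P ! i) (f j)" using adj_sym by blast
      then show ?thesis using * by (auto simp: edge g_def)
    next
      fix i j assume *: "u = Inr i" "v = Inr j"
      have ij: "i \<in> {0, Suc 0, 2}" "j \<in> {0, Suc 0, 2}" using uv * unfolding three by auto
      have "{i, j} \<in> {{0, Suc 0}, {Suc 0, 2}} \<longleftrightarrow> adj (P ! i) (P ! j)"
        using ij by (elim insertE emptyE) (simp_all add: P p abc doubleton_eq_iff del: One_nat_def)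
      then show ?thesis using * by (simp add: edge g_def)
    qed
    then show "{u, v} \<in> edges (sP1_P3 s) \<longleftrightarrow> {g u, g v} \<in> edges (induced_subgraph G ?W)"
      using W by (simp add: adj_def induced_subgraph_def)
  qed
  moreover have "?W \<subseteq> verts G" using J(1) I(1) abc(3-5) by auto
  ultimately show False using free unfolding H_free_def by blast
qed

section \<open>Independent sets attached to disjoint cliques\<close>

text \<open>Both clauses concern edges inside \<open>C\<close>, so for a cluster \<open>C\<close>
  they can be checked clique by clique. The first keeps terminals out of triangles in
  \<open>C\<close>. The second forbids passing through an edge of \<open>C\<close> between different
  vertices of \<open>B\<close>, and terminals on a triangle with one vertex in \<open>B\<close>;
  exchanging \<open>x\<close> and \<open>y\<close> covers the other end of the edge.\<close>

definition compatible :: "'a set \<Rightarrow> 'a set \<Rightarrow> 'a set \<Rightarrow> bool" where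
  "compatible T B C \<longleftrightarrow>
     (\<forall>x\<in>C. \<forall>y\<in>C. \<forall>z\<in>C. adj x y \<longrightarrow> adj y z \<longrightarrow> adj x z \<longrightarrow> x \<notin> T) \<and>
     (\<forall>x\<in>C. \<forall>y\<in>C. \<forall>b\<in>B. \<forall>b'\<in>B. adj x y \<longrightarrow> adj b x \<longrightarrow> adj b' y \<longrightarrow> b = b' \<and> x \<notin> T \<and> b \<notin> T)"

lemma compatible_triangleD:
  assumes "compatible T B C" "x \<in> C" "y \<in> C" "z \<in> C" "adj x y" "adj y z" "adj x z"
  shows "x \<notin> T"
  using assms(1)[unfolded compatible_def, THEN conjunct1, rule_format, OF assms(2-)] .

lemma compatible_edgeD:
  assumes "compatible T B C" "x \<in> C" "y \<in> C" "b \<in> B" "b' \<in> B" "adj x y" "adj b x" "adj b' y"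
  shows "b = b' \<and> x \<notin> T \<and> b \<notin> T"
  using assms(1)[unfolded compatible_def, THEN conjunct2, rule_format, OF assms(2-)] .

text \<open>A path in a cluster never leaves its clique: transitivity links the first vertex to each
  later one.\<close>

lemma successively_adj_cluster:
  assumes "successively adj xs" "set xs \<subseteq> C" "cluster C" "distinct xs" "u \<in> set xs" "v \<in> set xs" "u \<noteq> v"
  shows "adj u v"
  using assms(1,2,4-)
proof (induction xs arbitrary: u v)
  case (Cons x xs)
  have *: "adj x z" if "z \<in> set xs" for z
  proof -
    obtain y ys where xs: "xs = y # ys" using \<open>z \<in> set xs\<close> by (cases xs) auto
    have "adj x y" using Cons.prems xs by auto
    moreover have "adj y z" if "z \<noteq> y"
      using Cons.IH[of y z] Cons.prems xs that \<open>z \<in> set xs\<close> by auto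
    moreover have "x \<noteq> z" using Cons.prems that by auto
    ultimately show ?thesis
      using assms(3) Cons.prems that xs by (cases "z = y") (auto simp: cluster_def)
  qed
  have "successively adj xs" using Cons.prems(1) by (cases xs) auto
  then have "adj u v" if "u \<in> set xs" "v \<in> set xs"
    by (rule Cons.IH) (use Cons.prems(2-3,6) that in auto)
  moreover have "adj v x" if "v \<in> set xs" for v using adj_sym[OF *[OF that]] .
  ultimately show ?case using Cons.prems(4-) * by (cases "u = x"; cases "v = x") auto
qed simp

text \<open>Since \<open>B\<close> is independent and no two consecutive vertices are in
  \<open>C\<close>, the path alternates between the two sides.\<close>

lemma alternating_parity:
  assumes "successively adj xs" "xs \<noteq> []" "set xs \<subseteq> B \<union> C" "indep B" "B \<inter> C = {}"
    and "successively (\<lambda>x y. \<not> (x \<in> C \<and> y \<in> C)) xs"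
  shows "(hd xs \<in> B \<longleftrightarrow> last xs \<in> B) \<longleftrightarrow> odd (length xs)"
  using assms(1-3,6)
proof (induction xs)
  case (Cons x xs)
  show ?case
  proof (cases xs)
    case (Cons y ys)
    have "x \<in> B \<longleftrightarrow> y \<notin> B" using Cons.prems assms(4,5) Cons by (auto simp: indep_def)
    moreover have "(y \<in> B \<longleftrightarrow> last xs \<in> B) \<longleftrightarrow> odd (length xs)"
      using Cons.IH Cons.prems Cons by auto
    ultimately show ?thesis using Cons by auto
  qed simp
qed simp

lemma not_successively_split:
  "\<not> successively P xs \<Longrightarrow> \<exists>as x y bs. xs = as @ x # y # bs \<and> \<not> P x y \<and> successively P (as @ [x])"
proof (induction xs)
  case (Cons a xs)
  then obtain b ys where xs: "xs = b # ys" by (cases xs) auto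
  show ?case
  proof (cases "P a b")
    case False
    then show ?thesis using xs by (intro exI[of _ "[]"]) auto
  next
    case True
    then obtain as x y bs where *: "xs = as @ x # y # bs" "\<not> P x y" "successively P (as @ [x])"
      using Cons xs by auto
    then have "successively P ((a # as) @ [x])" using True xs by (cases as) auto
    then show ?thesis using * by (intro exI[of _ "a # as"]) auto
  qed
qed simp

text \<open>An odd cycle inside \<open>C\<close> lies in one clique, so a terminal on it would be in
  a triangle. An odd cycle meeting \<open>B\<close> cannot alternate between the sides, so it
  contains a run of at least two vertices of \<open>C\<close>, lying in one clique between
  \<open>p\<close> and \<open>q\<close> in \<open>B\<close>. Compatibility at the two ends of the
  run gives \<open>p = q\<close>, so the cycle is just \<open>p\<close> and the run. Then
  \<open>p\<close> and the ends are not terminals, and any other vertex of the run forms a triangle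
  with the ends.\<close>

lemma odd_T_cycle_free_decomp:
  assumes V: "B \<subseteq> verts G" "C \<subseteq> verts G" "B \<inter> C = {}" and B: "indep B" and C: "cluster C"
    and comp: "compatible T B C"
  shows "odd_T_cycle_free G T (B \<union> C)"
proof -
  have False if c: "odd_T_cycle G T c" "set c \<subseteq> B \<union> C" for c
  proof (cases "set c \<inter> B = {}")
    case True
    from c(1) obtain t where t: "t \<in> set c" "t \<in> T" by (auto simp: odd_T_cycle_def)
    have cyc: "distinct c" "3 \<le> length c" "successively adj c"
      using c(1) by (auto simp: odd_T_cycle_def is_cycle_iff)
    have sub: "set c \<subseteq> C" using c True by auto
    have "card (set c) \<ge> 3" using cyc by (simp add: distinct_card)
    then have "card (set c - {t}) \<ge> 2" using t by simp
    then obtain y z where yz: "y \<in> set c - {t}" "z \<in> set c - {t}" "y \<noteq> z"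
      by (metis One_nat_def card_le_Suc0_iff_eq not_less_eq_eq numeral_2_eq_2 finite_Diff List.finite_set)
    have "adj t y" "adj y z" "adj t z"
      using successively_adj_cluster[OF cyc(3) sub C cyc(1)] t yz by auto
    then show False using compatible_triangleD[OF comp, of t y z] t yz sub by blast
  next
    case False
    then obtain b xs ys where b: "b \<in> B" "c = xs @ b # ys" by (metis disjoint_iff in_set_conv_decomp)
    \<comment> \<open>Rotating the cycle so that it starts in \<open>B\<close> prevents the run in
      \<open>C\<close> from wrapping around the end of the list.\<close>
    define ds where "ds = ys @ xs"
    have cyc: "is_cycle G (b # ds)" using c(1) is_cycle_rotate[of xs "b # ys"]
      by (auto simp: b ds_def odd_T_cycle_def)
    have len: "even (length ds)" "set (b # ds) \<inter> T \<noteq> {}" and sub: "set ds \<subseteq> B \<union> C"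
      using c by (auto simp: b ds_def odd_T_cycle_def)
    have "ds \<noteq> []" using cyc by (auto simp: is_cycle_iff)
    then have ds: "ds \<noteq> []" "distinct (b # ds)" "successively adj (b # ds)" "adj (last ds) b"
      using cyc by (auto simp: is_cycle_iff)
    let ?P = "\<lambda>x y. \<not> (x \<in> C \<and> y \<in> C)"
    \<comment> \<open>An alternating list of odd length that starts in \<open>B\<close> also ends in
      \<open>B\<close>, so its closing edge would join two vertices of \<open>B\<close>.\<close>
    have "\<not> successively ?P ds"
    proof
      assume P: "successively ?P ds"
      have "successively ?P (b # ds)" using P b V by (cases ds) auto
      then have "(hd (b # ds) \<in> B \<longleftrightarrow> last (b # ds) \<in> B) \<longleftrightarrow> odd (length (b # ds))"
        using ds sub b B V by (intro alternating_parity) auto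
      then have "last ds \<in> B" using b len ds by auto
      then show False using ds b B by (auto simp: indep_def)
    qed
    then obtain as x y bs where split: "ds = as @ x # y # bs" "x \<in> C" "y \<in> C"
      "successively ?P (as @ [x])" using not_successively_split by blast
    define p where "p = last (b # as)"
    have p: "p \<in> B" "adj p x"
    proof -
      show "p \<in> B"
      proof (cases "as = []")
        case False
        then have "last as \<notin> C" using split by (auto simp: successively_append_iff)
        moreover have "set as \<subseteq> B \<union> C" using sub split(1) by simp
        with False have "last as \<in> B \<union> C" by (meson last_in_set subsetD)
        ultimately show ?thesis using False by (simp add: p_def)
      qed (simp add: p_def b)
      have "successively adj ((b # as) @ x # y # bs)" using ds split by simp
      then show "adj p x" unfolding p_def by (simp only: successively_append_iff) simp
    qed
    define R where "R = takeWhile (\<lambda>z. z \<in> C) (x # y # bs)"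
    define rs where "rs = dropWhile (\<lambda>z. z \<in> C) (x # y # bs)"
    have Rrs: "x # y # bs = R @ rs" by (simp add: R_def rs_def)
    obtain R' where R': "R = x # y # R'" using split by (simp add: R_def)
    have RC: "set R \<subseteq> C" unfolding R_def by (auto dest: set_takeWhileD)
    have eq: "b # ds = (b # as) @ R @ rs" using split Rrs by simp
    define l where "l = last R"
    \<comment> \<open>If the run reaches the end of the list, the next vertex on the cycle is
      \<open>b\<close>.\<close>
    define q where "q = hd (rs @ [b])"
    have q: "q \<in> B" "adj l q"
    proof -
      show "q \<in> B"
      proof (cases rs)
        case (Cons r rs')
        then have "r \<notin> C" using hd_dropWhile[of "\<lambda>z. z \<in> C" "x # y # bs"] unfolding rs_def by auto
        then show ?thesis using sub eq Cons by (auto simp: q_def)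
      qed (simp add: q_def b)
      show "adj l q"
      proof (cases "rs = []")
        case True
        then show ?thesis using ds(4) eq ds(1) R' by (simp add: l_def q_def split: if_splits)
      next
        case False
        have "successively adj ((b # as) @ R @ rs)" using ds(3) by (simp add: eq)
        then show ?thesis using False R' unfolding q_def l_def
          by (simp only: successively_append_iff) simp
      qed
    qed
    have distR: "distinct ((b # as) @ R @ rs)" using ds(2) by (simp only: eq)
    have succR: "successively adj R"
      using ds(3) unfolding eq by (simp only: successively_append_iff)
    have clique: "adj u v" if "u \<in> set R" "v \<in> set R" "u \<noteq> v" for u v
      using successively_adj_cluster[OF succR RC C] distR that by auto
    have l: "l \<in> set R" "l \<noteq> x" using R' distR unfolding l_def by auto
    have x: "x \<in> set R" using R' by simp
    have xl: "adj x l" using clique[OF x l(1)] l(2) by simp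
    have 1: "p = q \<and> x \<notin> T \<and> p \<notin> T"
      using compatible_edgeD[OF comp subsetD[OF RC x] subsetD[OF RC l(1)] p(1) q(1) xl p(2) adj_sym[OF q(2)]] .
    have 2: "l \<notin> T"
      using compatible_edgeD[OF comp subsetD[OF RC l(1)] subsetD[OF RC x] q(1) p(1) adj_sym[OF xl] adj_sym[OF q(2)] p(2)]
      by simp
    \<comment> \<open>The vertices of the list are distinct, so \<open>p = q\<close> leaves nothing
      on the cycle besides \<open>b\<close> and the run.\<close>
    have "as = []"
    proof (rule ccontr)
      assume "as \<noteq> []"
      then have "p \<in> set as" by (simp add: p_def)
      moreover have "q \<in> set rs \<union> {b}" unfolding q_def by (cases rs) auto
      ultimately show False using 1 distR by auto
    qed
    moreover have "rs = []"
    proof (rule ccontr)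
      assume "rs \<noteq> []"
      then have "q \<in> set rs" by (simp add: q_def)
      moreover have "p = b" using \<open>as = []\<close> by (simp add: p_def)
      ultimately show False using 1 distR by auto
    qed
    ultimately have all: "set (b # ds) = insert b (set R)" using eq by simp
    have "z \<notin> T" if z: "z \<in> set R" for z
    proof (cases "z = x \<or> z = l")
      case False
      then have "adj z x" "adj z l" using clique z x l by auto
      then show ?thesis
        using compatible_triangleD[OF comp subsetD[OF RC z] subsetD[OF RC x] subsetD[OF RC l(1)]] xl by blast
    qed (use 1 2 in auto)
    moreover have "b \<notin> T" using 1 \<open>as = []\<close> by (auto simp: p_def)
    ultimately show False using len(2) unfolding all by auto
  qed
  then show ?thesis using V unfolding odd_T_cycle_free_def by blast
qed

section \<open>Short odd cycles\<close>

text \<open>A cycle cut open at \<open>t\<close>, which is odd when \<open>length ps\<close> is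
  even. Keeping \<open>t\<close> outside the list ensures that shortcuts of \<open>ps\<close> never
  lose the terminal.\<close>

definition tour :: "'a \<Rightarrow> 'a set \<Rightarrow> 'a list \<Rightarrow> bool" where
  "tour t W ps \<longleftrightarrow> ps \<noteq> [] \<and> distinct (t # ps) \<and> successively adj ps \<and> adj t (hd ps) \<and>
     adj (last ps) t \<and> set (t # ps) \<subseteq> W"

lemma tour_odd_cycle:
  assumes "tour t W ps" "even (length ps)" "t \<in> T"
  shows "odd_T_cycle G T (t # ps)" "set (t # ps) \<subseteq> W"
proof -
  have "length ps \<noteq> 0" "length ps \<noteq> 1" using assms by (auto simp: tour_def)
  then have "2 \<le> length ps" by linarith
  moreover have "successively adj (t # ps)" using assms(1) by (cases ps) (auto simp: tour_def)
  ultimately show "odd_T_cycle G T (t # ps)"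
    using assms by (auto simp: odd_T_cycle_def is_cycle_iff tour_def)
  show "set (t # ps) \<subseteq> W" using assms(1) by (simp add: tour_def)
qed

lemma tour_shortcut:
  assumes "tour t W ps" "i < j" "j < length ps" "adj (ps ! i) (ps ! j)"
  shows "tour t W (take (Suc i) ps @ drop j ps)"
proof -
  have succ: "successively adj ps" using assms(1) by (simp add: tour_def)
  have "successively adj (take (Suc i) ps)" "successively adj (drop j ps)"
    using succ by (auto simp: successively_conv_nth)
  moreover have "last (take (Suc i) ps) = ps ! i" "hd (drop j ps) = ps ! j"
    using assms(2,3) by (auto simp: take_Suc_conv_app_nth hd_drop_conv_nth)
  moreover have "hd (take (Suc i) ps) = hd ps" "last (drop j ps) = last ps"
    using assms(2,3) by (auto simp: hd_take)
  moreover have "set (take (Suc i) ps) \<inter> set (drop j ps) = {}"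
    using assms by (intro set_take_disj_set_drop_if_distinct) (auto simp: tour_def)
  moreover have "set (take (Suc i) ps) \<subseteq> set ps" "set (drop j ps) \<subseteq> set ps"
    by (auto dest: in_set_takeD in_set_dropD)
  moreover have "take (Suc i) ps \<noteq> []" "drop j ps \<noteq> []" using assms(2,3) by auto
  ultimately show ?thesis
    using assms(1,4) unfolding tour_def by (auto simp: successively_append_iff)
qed

text \<open>Of \<open>2 * s + 3\<close> consecutive vertices without chords, the first three form
  the path, and the fifth, the seventh and so on provide the \<open>s\<close> isolated
  vertices.\<close>

lemma induced_path_bound:
  assumes free: "H_free (sP1_P3 s) G"
    and path: "distinct ps" "successively adj ps" "a + m \<le> length ps"
    and chordless: "\<And>i j. a \<le> i \<Longrightarrow> Suc i < j \<Longrightarrow> j < a + m \<Longrightarrow> \<not> adj (ps ! i) (ps ! j)"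
  shows "m \<le> 2 * s + 2"
proof (rule ccontr)
  assume "\<not> ?thesis"
  then have m: "2 * s + 3 \<le> m" by simp
  have step: "adj (ps ! i) (ps ! Suc i)" if "Suc i < a + m" for i
    using path that by (simp add: successively_conv_nth)
  have neq: "ps ! i \<noteq> ps ! j" if "i < a + m" "j < a + m" "i \<noteq> j" for i j
    using path that by (simp add: nth_eq_iff_index_eq)
  let ?f = "\<lambda>i. ps ! (a + 2 * i + 4)"
  have nonadj: "\<not> adj (?f i) (ps ! (a + k))" "\<not> adj (ps ! (a + k)) (?f i)" if "i < s" "k \<le> 2" for i k
    using chordless[of "a + k" "a + 2 * i + 4"] that m adj_sym by auto
  show False
  proof (rule H_freeD[OF free, where I="?f ` {..<s}" and a="ps ! a" and b="ps ! Suc a" and c="ps ! Suc (Suc a)"])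
    show "adj (ps ! a) (ps ! Suc a)" "adj (ps ! Suc a) (ps ! Suc (Suc a))" using step m by auto
    show "\<not> adj (ps ! a) (ps ! Suc (Suc a))" "ps ! a \<noteq> ps ! Suc (Suc a)"
      using chordless[of a "Suc (Suc a)"] neq m by auto
    show "?f ` {..<s} \<subseteq> verts G"
    proof
      fix v assume "v \<in> ?f ` {..<s}"
      then obtain i where i: "i < s" "v = ps ! Suc (a + 2 * i + 3)" by (auto simp: eval_nat_numeral)
      then show "v \<in> verts G" using step[of "a + 2 * i + 3"] m adj_verts by auto
    qed
    have "\<not> adj (?f i) (?f j)" if "i < s" "j < s" for i j
    proof -
      have *: "\<not> adj (?f i) (?f j)" if "i < j" "j < s" for i j
        using chordless[of "a + 2 * i + 4" "a + 2 * j + 4"] that m by auto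
      show ?thesis using *[of i j] *[of j i] that adj_sym by (cases i j rule: linorder_cases) auto
    qed
    then show "indep (?f ` {..<s})" by (auto simp: indep_def)
    have "inj_on ?f {..<s}"
    proof (intro inj_onI, rule ccontr)
      fix i j assume "i \<in> {..<s}" "j \<in> {..<s}" "?f i = ?f j" "i \<noteq> j"
      then show False using neq[of "a + 2 * i + 4" "a + 2 * j + 4"] m by auto
    qed
    then show "s \<le> card (?f ` {..<s})" by (simp add: card_image)
  next
    fix v x assume "v \<in> ?f ` {..<s}" and x: "x \<in> {ps ! a, ps ! Suc a, ps ! Suc (Suc a)}"
    then obtain i where i: "i < s" "v = ?f i" by auto
    obtain k where k: "k \<le> 2" "x = ps ! (a + k)"
    proof -
      have "x = ps ! (a + 0) \<or> x = ps ! (a + 1) \<or> x = ps ! (a + 2)" using x by simp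
      then show ?thesis using that by (metis le_refl one_le_numeral zero_le)
    qed
    show "v \<noteq> x \<and> \<not> adj v x" using nonadj[OF i(1) k(1)] neq[of "a + 2 * i + 4" "a + k"] i k m by auto
  qed
qed

text \<open>In a shortest odd cycle through a fixed terminal \<open>t\<close> within
  \<open>W\<close>, a shortcut along one chord of \<open>ps\<close> must change the parity. Two
  chords one behind the other could be used together, which restores the parity, so they cannot
  coexist. Cutting \<open>ps\<close> at the least right end \<open>j\<close> of a chord therefore
  leaves two induced paths of at most \<open>2 * s + 2\<close> vertices each; \<open>t\<close> is
  the remaining vertex of the \<open>4 * s + 5\<close>.\<close>

lemma short_odd_T_cycle:
  assumes free: "H_free (sP1_P3 s) G" and c: "odd_T_cycle G T c" "set c \<subseteq> W"
  shows "\<exists>c'. odd_T_cycle G T c' \<and> set c' \<subseteq> W \<and> length c' \<le> 4 * s + 5"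
proof -
  obtain t where t: "t \<in> set c" "t \<in> T" using c by (auto simp: odd_T_cycle_def)
  then obtain xs ys where xy: "c = xs @ t # ys" by (metis in_set_conv_decomp)
  have "is_cycle G (t # (ys @ xs))" using c(1) is_cycle_rotate[of xs "t # ys"]
    by (auto simp: xy odd_T_cycle_def)
  moreover have "set (t # (ys @ xs)) \<subseteq> W" using c(2) by (auto simp: xy)
  ultimately have "tour t W (ys @ xs)"
    by (cases "ys @ xs") (auto simp: tour_def is_cycle_iff)
  moreover have "even (length (ys @ xs))" using c(1) by (simp add: xy odd_T_cycle_def)
  ultimately obtain ps where ps: "tour t W ps" "even (length ps)"
    and min: "\<And>qs. tour t W qs \<Longrightarrow> even (length qs) \<Longrightarrow> length ps \<le> length qs"
    using ex_has_least_nat[of "\<lambda>ps. tour t W ps \<and> even (length ps)" "ys @ xs" length] by blast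
  define n where "n = length ps"
  have path: "distinct ps" "successively adj ps" using ps by (auto simp: tour_def)
  have disjoint_chords: False
    if ij: "Suc i < j" "adj (ps ! i) (ps ! j)" and kl: "Suc k < l" "l < n" "adj (ps ! k) (ps ! l)" and "j \<le> k"
    for i j k l
  proof -
    define qs where "qs = take (Suc i) ps @ drop j ps"
    have qs: "tour t W qs" unfolding qs_def
      using ij that by (intro tour_shortcut[OF ps(1)]) (auto simp: n_def)
    have lq: "length qs = Suc i + (n - j)" using that by (simp add: qs_def n_def)
    have "length qs < n" using lq that by simp
    then have oq: "odd (length qs)" using min[OF qs] unfolding n_def by linarith
    have "tour t W (take (Suc k) ps @ drop l ps)"
      using kl by (intro tour_shortcut[OF ps(1)]) (auto simp: n_def)
    from min[OF this] have ok: "odd (Suc k + (n - l))" using kl unfolding n_def by force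
    define k' l' where "k' = Suc i + (k - j)" and "l' = Suc i + (l - j)"
    have nth: "qs ! k' = ps ! k" "qs ! l' = ps ! l"
      using that by (auto simp: qs_def k'_def l'_def nth_append n_def)
    define rs where "rs = take (Suc k') qs @ drop l' qs"
    have "tour t W rs" unfolding rs_def
    proof (rule tour_shortcut[OF qs])
      show "k' < l'" "l' < length qs" using that lq by (auto simp: k'_def l'_def)
      show "adj (qs ! k') (qs ! l')" using kl(3) by (simp add: nth)
    qed
    moreover have "length rs = Suc k' + (length qs - l')"
      using that lq by (auto simp: rs_def k'_def l'_def)
    \<comment> \<open>The two shortcuts remove disjoint stretches. So the double shortcut and
      \<open>ps\<close> together are as long as the two single shortcuts together, both of which
      have odd length.\<close>
    then have lrs: "length rs + length ps = (Suc i + (n - j)) + (Suc k + (n - l))"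
      using that by (simp add: lq k'_def l'_def n_def)
    have "even (length rs + length ps)" unfolding lrs using oq ok lq by simp
    then have "even (length rs)" using ps(2) by simp
    moreover have "length rs < n" using lrs that by (simp add: n_def)
    ultimately show False using min[of rs] by (simp add: n_def)
  qed
  have "n \<le> 4 * s + 4"
  proof (cases "\<exists>j. j < n \<and> (\<exists>i. Suc i < j \<and> adj (ps ! i) (ps ! j))")
    case False
    then have "n \<le> 2 * s + 2"
      by (intro induced_path_bound[OF free path, of 0]) (auto simp: n_def)
    then show ?thesis by simp
  next
    case True
    define j where "j = (LEAST j. j < n \<and> (\<exists>i. Suc i < j \<and> adj (ps ! i) (ps ! j)))"
    obtain i where j: "j < n" "Suc i < j" "adj (ps ! i) (ps ! j)"
      using LeastI_ex[OF True] unfolding j_def by blast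
    have least: "\<not> adj (ps ! i') (ps ! j')" if "Suc i' < j'" "j' < j" for i' j'
      using not_less_Least[of j' "\<lambda>j. j < n \<and> (\<exists>i. Suc i < j \<and> adj (ps ! i) (ps ! j))"] that j
      unfolding j_def[symmetric] by auto
    have "j \<le> 2 * s + 2"
      using least j by (intro induced_path_bound[OF free path, of 0]) (auto simp: n_def)
    moreover have "n - j \<le> 2 * s + 2"
      using disjoint_chords[OF j(2,3)] j(1) by (intro induced_path_bound[OF free path, of j]) (auto simp: n_def)
    ultimately show ?thesis by simp
  qed
  then show ?thesis using tour_odd_cycle[OF ps t(2)] by (intro exI[of _ "t # ps"]) (auto simp: n_def)
qed

end

section \<open>Cliques of a cluster and their representatives\<close>

locale linorder_graph = fin_graph G for G :: "'a :: linorder ugraph"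
begin

definition clq :: "'a set \<Rightarrow> 'a \<Rightarrow> 'a set" where
  "clq Q v = {u \<in> Q. u = v \<or> adj u v}"

text \<open>For a cluster \<open>Q\<close>, the least vertex of each clique. Choosing by the order
  makes the representatives recognisable by a term with a single quantifier.\<close>

definition reps :: "'a set \<Rightarrow> 'a set" where
  "reps Q = {v \<in> Q. \<forall>w\<in>Q. adj w v \<longrightarrow> \<not> w < v}"

definition maxfit :: "'a set \<Rightarrow> 'a set \<Rightarrow> 'a set \<Rightarrow> nat" where
  "maxfit T Y L = Max (card ` {S. S \<subseteq> L \<and> compatible T Y S})"

lemma reps_subset: "reps Q \<subseteq> Q"
  by (auto simp: reps_def)

lemma clq_subset: "clq Q v \<subseteq> Q"
  by (auto simp: clq_def)

lemma adj_in_clq: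
  assumes "cluster Q" "r \<in> Q" "u \<in> clq Q r" "v \<in> clq Q r" "u \<noteq> v"
  shows "adj u v"
proof -
  have Q: "u \<in> Q" "v \<in> Q" and *: "u = r \<or> adj u r" "v = r \<or> adj v r" using assms by (auto simp: clq_def)
  show ?thesis
  proof (cases "u = r \<or> v = r")
    case True
    then show ?thesis using * adj_sym assms(5) by blast
  next
    case False
    then have "adj u r" "adj r v" using * adj_sym by auto
    then show ?thesis using assms(1,2,5) Q unfolding cluster_def by blast
  qed
qed

lemma clq_closed:
  assumes "cluster Q" "r \<in> Q" "u \<in> clq Q r" "v \<in> Q" "adj u v"
  shows "v \<in> clq Q r"
proof (cases "v = r \<or> u = r")
  case True
  then show ?thesis using assms adj_sym by (auto simp: clq_def)
next
  case False
  then have "adj v u" "adj u r" "u \<in> Q" using assms adj_sym by (auto simp: clq_def)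
  then have "adj v r" using assms(1,2,4) False unfolding cluster_def by blast
  then show ?thesis using assms(4) by (simp add: clq_def)
qed

lemma reps_not_adj: "r \<in> reps Q \<Longrightarrow> r' \<in> reps Q \<Longrightarrow> \<not> adj r r'"
proof
  assume r: "r \<in> reps Q" "r' \<in> reps Q" "adj r r'"
  then have "\<not> r < r'" "\<not> r' < r" using adj_sym[OF r(3)] by (auto simp: reps_def)
  then have "r = r'" by simp
  then show False using r(3) by simp
qed

lemma clq_disjoint:
  assumes "cluster Q" "r \<in> reps Q" "r' \<in> reps Q" "u \<in> clq Q r" "u \<in> clq Q r'"
  shows "r = r'"
proof (rule ccontr)
  assume "r \<noteq> r'"
  have Q: "r \<in> Q" "r' \<in> Q" using assms reps_subset by auto
  have "r' \<in> clq Q r'" using Q by (simp add: clq_def)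
  have "r' \<in> clq Q r"
  proof (cases "u = r'")
    case False
    then have "adj u r'" using assms(5) by (simp add: clq_def)
    then show ?thesis using clq_closed[OF assms(1) Q(1) assms(4) Q(2)] by blast
  qed (use assms(4) in simp)
  then have "adj r' r" using \<open>r \<noteq> r'\<close> by (simp add: clq_def)
  then show False using reps_not_adj[OF assms(3,2)] by blast
qed

lemma ex_rep:
  assumes "cluster Q" "finite Q" "v \<in> Q"
  shows "\<exists>r\<in>reps Q. v \<in> clq Q r"
proof
  let ?L = "clq Q v"
  have L: "finite ?L" "v \<in> ?L" using assms finite_subset[OF clq_subset] by (auto simp: clq_def)
  then have m: "Min ?L \<in> ?L" by (intro Min_in) auto
  then have mQ: "Min ?L \<in> Q" using clq_subset by blast
  have "\<not> w < Min ?L" if "w \<in> Q" "adj w (Min ?L)" for w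
  proof -
    have "w \<in> ?L" using clq_closed[OF assms(1,3) m that(1) adj_sym[OF that(2)]] .
    then show ?thesis using Min_le[OF L(1)] by (simp add: not_less)
  qed
  then show "Min ?L \<in> reps Q" using mQ by (simp add: reps_def)
  show "v \<in> clq Q (Min ?L)" using m adj_sym assms(3) by (auto simp: clq_def)
qed

lemma card_eq_sum_reps:
  assumes "cluster Q" "finite Q" "C \<subseteq> Q"
  shows "card C = (\<Sum>r\<in>reps Q. card (C \<inter> clq Q r))"
proof -
  have "C = (\<Union>r\<in>reps Q. C \<inter> clq Q r)" using ex_rep[OF assms(1,2)] assms(3) by blast
  also have "card \<dots> = (\<Sum>r\<in>reps Q. card (C \<inter> clq Q r))"
  proof (rule card_UN_disjoint)
    show "finite (reps Q)" using assms(2) reps_subset finite_subset by blast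
    show "\<forall>r\<in>reps Q. finite (C \<inter> clq Q r)" using assms(2,3) finite_subset by blast
    show "\<forall>r\<in>reps Q. \<forall>r'\<in>reps Q. r \<noteq> r' \<longrightarrow> C \<inter> clq Q r \<inter> (C \<inter> clq Q r') = {}"
      using clq_disjoint[OF assms(1)] by blast
  qed
  finally show ?thesis .
qed

text \<open>Distinct vertices of a clique are adjacent, so an independent set takes at most one from
  each. This bounds the unguessed part of \<open>B\<close>.\<close>

lemma indep_card_le_reps:
  assumes "cluster Q" "finite Q" "S \<subseteq> Q" "indep S"
  shows "card S \<le> card (reps Q)"
proof -
  have "card (S \<inter> clq Q r) \<le> 1" if "r \<in> reps Q" for r
  proof -
    have "u = v" if "u \<in> S \<inter> clq Q r" "v \<in> S \<inter> clq Q r" for u v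
    proof (rule ccontr)
      assume "u \<noteq> v"
      then have "adj u v" using adj_in_clq[OF assms(1) _, of r u v] that \<open>r \<in> reps Q\<close> reps_subset by blast
      then show False using assms(4) that by (auto simp: indep_def)
    qed
    then show ?thesis using card_le_Suc0_iff_eq[of "S \<inter> clq Q r"] finite_subset[OF assms(3,2)] by auto
  qed
  then have "(\<Sum>r\<in>reps Q. card (S \<inter> clq Q r)) \<le> (\<Sum>r\<in>reps Q. 1)" by (intro sum_mono) auto
  then show ?thesis using card_eq_sum_reps[OF assms(1-3)] by simp
qed

lemma maxfit_upper: "finite L \<Longrightarrow> S \<subseteq> L \<Longrightarrow> compatible T Y S \<Longrightarrow> card S \<le> maxfit T Y L"
  unfolding maxfit_def by (intro Max_ge) auto

lemma maxfit_attained: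
  assumes "finite L"
  shows "\<exists>S. S \<subseteq> L \<and> compatible T Y S \<and> card S = maxfit T Y L"
proof -
  have "{} \<in> {S. S \<subseteq> L \<and> compatible T Y S}" by (auto simp: compatible_def)
  then have "maxfit T Y L \<in> card ` {S. S \<subseteq> L \<and> compatible T Y S}"
    unfolding maxfit_def using assms by (intro Max_in) auto
  then show ?thesis by auto
qed

section \<open>Certificates for solutions with many terminals\<close>

text \<open>The solution consists of \<open>Y\<close>, the representatives of \<open>P\<close>, a
  largest fitting part of each clique of \<open>Q\<close> in \<open>D\<close>, and one vertex of
  every other clique. The fitting parts are computed against \<open>Y\<close> alone, and assumption
  \<open>two\<close> lifts them to the whole independent side: a vertex that sees \<open>P\<close>
  has two neighbours in \<open>Y\<close>, so compatibility with \<open>Y\<close> already forbids it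
  a chosen clique-mate with a neighbour in \<open>Y\<close>.\<close>

lemma certificate_sound:
  assumes V: "Q \<subseteq> verts G" "P \<subseteq> verts G" "Y \<subseteq> verts G"
    and disj: "Q \<inter> P = {}" "Q \<inter> Y = {}" "P \<inter> Y = {}"
    and Q: "cluster Q" and P: "cluster P" and Y: "indep Y"
    and PY: "\<And>v y. v \<in> P \<Longrightarrow> y \<in> Y \<Longrightarrow> \<not> adj v y"
    and two: "\<And>r v b. r \<in> D \<Longrightarrow> v \<in> clq Q r \<Longrightarrow> b \<in> P \<Longrightarrow> adj v b \<Longrightarrow>
       \<exists>y\<in>Y. \<exists>y'\<in>Y. y \<noteq> y' \<and> adj v y \<and> adj v y'"
  shows "\<exists>W. odd_T_cycle_free G T W \<and>
    card W = card Y + card (reps P) + (\<Sum>r\<in>reps Q. if r \<in> D then maxfit T Y (clq Q r) else 1)"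
proof -
  have fin: "finite Q" "finite P" "finite Y" using V finite_verts finite_subset by blast+
  have finL: "finite (clq Q r)" for r using fin(1) finite_subset[OF clq_subset] by blast
  have "\<exists>S. S \<subseteq> clq Q r \<and> compatible T Y S \<and> (r \<in> D \<or> S = {r}) \<and>
     card S = (if r \<in> D then maxfit T Y (clq Q r) else 1)" if "r \<in> reps Q" for r
  proof (cases "r \<in> D")
    case True
    then show ?thesis using maxfit_attained[OF finL, of r T Y] by auto
  next
    case False
    have "{r} \<subseteq> clq Q r" using that reps_subset by (auto simp: clq_def)
    then show ?thesis using False by (intro exI[of _ "{r}"]) (auto simp: compatible_def)
  qed
  then obtain F where F: "\<And>r. r \<in> reps Q \<Longrightarrow> F r \<subseteq> clq Q r \<and> compatible T Y (F r) \<and> (r \<in> D \<or> F r = {r}) \<and>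
     card (F r) = (if r \<in> D then maxfit T Y (clq Q r) else 1)" by metis
  define C where "C = (\<Union>r\<in>reps Q. F r)"
  define B where "B = Y \<union> reps P"
  have CQ: "C \<subseteq> Q" using F clq_subset unfolding C_def by blast
  have Cr: "C \<inter> clq Q r = F r" if "r \<in> reps Q" for r
  proof
    show "F r \<subseteq> C \<inter> clq Q r" using F[OF that] that unfolding C_def by blast
    show "C \<inter> clq Q r \<subseteq> F r"
    proof
      fix u assume u: "u \<in> C \<inter> clq Q r"
      then obtain r' where r': "r' \<in> reps Q" "u \<in> F r'" by (auto simp: C_def)
      then have "u \<in> clq Q r'" using F by blast
      then have "r' = r" using clq_disjoint[OF Q] r'(1) that u by blast
      then show "u \<in> F r" using r' by simp
    qed
  qed
  have BV: "B \<subseteq> verts G" using V reps_subset unfolding B_def by blast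
  have BC: "B \<inter> C = {}" using CQ disj reps_subset unfolding B_def by blast
  have indB: "indep B"
  proof -
    have "\<not> adj u v" if uv: "u \<in> B" "v \<in> B" for u v
    proof
      assume a: "adj u v"
      consider "u \<in> Y" "v \<in> Y" | "u \<in> Y" "v \<in> reps P" | "u \<in> reps P" "v \<in> Y" | "u \<in> reps P" "v \<in> reps P"
        using uv unfolding B_def by blast
      then show False
      proof cases
        case 1
        then show ?thesis using Y a unfolding indep_def by blast
      next
        case 2
        then show ?thesis using PY[of v u] adj_sym[OF a] reps_subset by blast
      next
        case 3
        then show ?thesis using PY[of u v] a reps_subset by blast
      next
        case 4
        then show ?thesis using reps_not_adj a by blast
      qed
    qed
    then show ?thesis unfolding indep_def by blast
  qed
  have same: "\<exists>r\<in>reps Q. x \<in> F r \<and> y \<in> F r" if xy: "x \<in> C" "y \<in> C" "adj x y" for x y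
  proof -
    obtain r where r: "r \<in> reps Q" "x \<in> F r" using xy by (auto simp: C_def)
    then have "x \<in> clq Q r" using F[OF r(1)] by blast
    then have "y \<in> clq Q r"
      by (rule clq_closed[OF Q subsetD[OF reps_subset r(1)] _ subsetD[OF CQ xy(2)] xy(3)])
    then have "y \<in> F r" using Cr[OF r(1)] xy(2) by blast
    then show ?thesis using r by blast
  qed
  \<comment> \<open>A vertex \<open>x\<close> that sees a representative of \<open>P\<close> has two
    neighbours in \<open>Y\<close>. The vertex \<open>y\<close> has one, namely \<open>b'\<close>
    or, if \<open>b'\<close> is in \<open>P\<close>, one supplied by \<open>two\<close>.
    Compatibility with \<open>Y\<close> would make all three equal.\<close>
  have no_new: False if r: "r \<in> reps Q" and xy: "x \<in> F r" "y \<in> F r" "adj x y" "b \<in> reps P" "adj b x" "b' \<in> B" "adj b' y"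
    for r x y b b'
  proof -
    have "x \<noteq> y" using xy(3) by auto
    then have D: "r \<in> D" using F[OF r] xy(1,2) by (metis singletonD)
    have L: "x \<in> clq Q r" "y \<in> clq Q r" using F[OF r] xy(1,2) by blast+
    have comp: "compatible T Y (F r)" using F[OF r] by blast
    obtain y1 y2 where y12: "y1 \<in> Y" "y2 \<in> Y" "y1 \<noteq> y2" "adj x y1" "adj x y2"
      using two[OF D L(1) subsetD[OF reps_subset xy(4)] adj_sym[OF xy(5)]] by blast
    obtain y3 where y3: "y3 \<in> Y" "adj y3 y"
    proof (cases "b' \<in> Y")
      case False
      then have "b' \<in> P" using xy(6) reps_subset unfolding B_def by blast
      then obtain y3 where "y3 \<in> Y" "adj y y3" using two[OF D L(2) _ adj_sym[OF xy(7)]] by blast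
      then show ?thesis using that[of y3] adj_sym[of y y3] by blast
    qed (use xy(7) in auto)
    have "y1 = y3" using compatible_edgeD[OF comp xy(1,2) y12(1) y3(1) xy(3) adj_sym[OF y12(4)] y3(2)] by blast
    moreover have "y2 = y3" using compatible_edgeD[OF comp xy(1,2) y12(2) y3(1) xy(3) adj_sym[OF y12(5)] y3(2)] by blast
    ultimately show False using y12 by blast
  qed
  have "compatible T B C"
    unfolding compatible_def
  proof (intro conjI ballI impI)
    fix x y z assume *: "x \<in> C" "y \<in> C" "z \<in> C" "adj x y" "adj y z" "adj x z"
    obtain r where r: "r \<in> reps Q" "x \<in> F r" "y \<in> F r" using same[OF *(1,2,4)] by blast
    obtain r' where r': "r' \<in> reps Q" "x \<in> F r'" "z \<in> F r'" using same[OF *(1,3,6)] by blast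
    have "x \<in> clq Q r" "x \<in> clq Q r'" using F[OF r(1)] F[OF r'(1)] r(2) r'(2) by blast+
    then have "r = r'" by (rule clq_disjoint[OF Q r(1) r'(1)])
    then have z: "z \<in> F r" using r' by simp
    have comp: "compatible T Y (F r)" using F[OF r(1)] by blast
    show "x \<notin> T" using compatible_triangleD[OF comp r(2,3) z *(4-6)] .
  next
    fix x y b b' assume *: "x \<in> C" "y \<in> C" "b \<in> B" "b' \<in> B" "adj x y" "adj b x" "adj b' y"
    obtain r where r: "r \<in> reps Q" "x \<in> F r" "y \<in> F r" using same[OF *(1,2,5)] by blast
    have comp: "compatible T Y (F r)" using F[OF r(1)] by blast
    have b: "b \<notin> reps P" using no_new[OF r *(5) _ *(6) *(4) *(7)] by blast
    have b': "b' \<notin> reps P" using no_new[OF r(1,3,2) adj_sym[OF *(5)] _ *(7) *(3) *(6)] by blast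
    have "b \<in> Y" "b' \<in> Y" using b b' *(3,4) unfolding B_def by blast+
    from compatible_edgeD[OF comp r(2,3) this *(5-7)]
    show "b = b'" "x \<notin> T" "b \<notin> T" by blast+
  qed
  then have "odd_T_cycle_free G T (B \<union> C)"
    using odd_T_cycle_free_decomp[OF BV _ BC indB cluster_subset[OF Q CQ]] CQ V(1) by blast
  moreover have "card (B \<union> C) = card Y + card (reps P) + (\<Sum>r\<in>reps Q. if r \<in> D then maxfit T Y (clq Q r) else 1)"
  proof -
    have finB: "finite (reps P)" "finite C" using fin reps_subset CQ finite_subset by blast+
    have "card (B \<union> C) = card B + card C" using BC finB fin unfolding B_def by (intro card_Un_disjoint) auto
    also have "card B = card Y + card (reps P)" unfolding B_def
      using disj(3) reps_subset finB fin by (intro card_Un_disjoint) auto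
    also have "card C = (\<Sum>r\<in>reps Q. card (F r))"
      using card_eq_sum_reps[OF Q fin(1) CQ] Cr by simp
    also have "\<dots> = (\<Sum>r\<in>reps Q. if r \<in> D then maxfit T Y (clq Q r) else 1)"
      using F by (intro sum.cong) auto
    finally show ?thesis by simp
  qed
  ultimately show ?thesis by blast
qed

definition far :: "'a set \<Rightarrow> 'a set" where
  "far X = {v \<in> verts G. \<forall>x\<in>X. \<not> adj v x}"

text \<open>With flag \<open>f\<close>, a part of the independent side is left to be chosen from \<open>free_near\<close>; without
  it, \<open>Y\<close> is the whole independent side and every clique counts as special.\<close>

definition free_near :: "bool \<Rightarrow> 'a set \<Rightarrow> 'a set \<Rightarrow> 'a set \<Rightarrow> 'a set" where
  "free_near f X Y Z = {v \<in> verts G. f \<and> (\<exists>x\<in>X. adj v x) \<and> v \<notin> Y \<and> (\<forall>y\<in>Y. \<not> adj v y) \<and> (\<forall>z\<in>Z. \<not> adj v z)}"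

definition special :: "bool \<Rightarrow> 'a set \<Rightarrow> 'a set" where
  "special f Z = {r. f \<longrightarrow> (\<exists>z\<in>Z. r = z \<or> adj r z)}"

text \<open>The last clause is hypothesis \<open>two\<close> of \<open>certificate_sound\<close>,
  with the special representatives in the role of \<open>D\<close>.\<close>

definition certificate :: "bool \<Rightarrow> 'a set \<Rightarrow> 'a set \<Rightarrow> 'a set \<Rightarrow> bool" where
  "certificate f X Y Z \<longleftrightarrow> cluster (far X) \<and> cluster (free_near f X Y Z) \<and> indep Y \<and>
     (\<forall>y\<in>Y. \<exists>x\<in>X. adj y x) \<and>
     (\<forall>r\<in>reps (far X). r \<in> special f Z \<longrightarrow> (\<forall>v\<in>clq (far X) r. \<forall>b\<in>free_near f X Y Z. adj v b \<longrightarrow>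
        (\<exists>y\<in>Y. \<exists>y'\<in>Y. y \<noteq> y' \<and> adj v y \<and> adj v y')))"

definition certified :: "'a set \<Rightarrow> bool \<Rightarrow> 'a set \<Rightarrow> 'a set \<Rightarrow> 'a set \<Rightarrow> nat" where
  "certified T f X Y Z = card Y + card (reps (free_near f X Y Z)) +
     (\<Sum>r\<in>reps (far X). if r \<in> special f Z then maxfit T Y (clq (far X) r) else 1)"

lemma certificate_solution:
  assumes "certificate f X Y Z"
  shows "\<exists>W. odd_T_cycle_free G T W \<and> card W = certified T f X Y Z"
proof -
  have YV: "Y \<subseteq> verts G" using assms adj_verts unfolding certificate_def by blast
  have "\<exists>W. odd_T_cycle_free G T W \<and> card W = card Y + card (reps (free_near f X Y Z)) +
     (\<Sum>r\<in>reps (far X). if r \<in> reps (far X) \<inter> special f Z then maxfit T Y (clq (far X) r) else 1)"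
  proof (rule certificate_sound)
    show "far X \<subseteq> verts G" "free_near f X Y Z \<subseteq> verts G" by (auto simp: far_def free_near_def)
    show "far X \<inter> free_near f X Y Z = {}" "free_near f X Y Z \<inter> Y = {}" 
      by (auto simp: far_def free_near_def)
    show "far X \<inter> Y = {}" using assms unfolding certificate_def far_def by blast
    show "\<exists>y\<in>Y. \<exists>y'\<in>Y. y \<noteq> y' \<and> adj v y \<and> adj v y'"
      if "r \<in> reps (far X) \<inter> special f Z" "v \<in> clq (far X) r" "b \<in> free_near f X Y Z" "adj v b" for r v b
      using assms that unfolding certificate_def by blast
  qed (use assms YV in \<open>auto simp: certificate_def free_near_def\<close>)
  then show ?thesis unfolding certified_def by (simp cong: sum.cong)
qed

end

section \<open>Structure of solutions with many terminals\<close>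

context fin_graph begin

lemma odd_closed_list_avoids:
  assumes "odd_T_cycle_free G T W" "3 \<le> length c" "odd (length c)" "distinct c" "set c \<subseteq> W"
    "successively adj c" "adj (last c) (hd c)"
  shows "set c \<inter> T = {}"
  using assms unfolding odd_T_cycle_free_def odd_T_cycle_def is_cycle_iff by blast

lemma no_triangle:
  assumes "odd_T_cycle_free G T W" "a \<in> W" "b \<in> W" "c \<in> W" "adj a b" "adj b c" "adj a c"
  shows "a \<notin> T"
proof -
  have "a \<noteq> b" "b \<noteq> c" "a \<noteq> c" using assms(5-7) adj_irrefl by metis+
  then have "set [a, b, c] \<inter> T = {}"
    using assms(2-6) adj_sym[OF assms(7)] by (intro odd_closed_list_avoids[OF assms(1)]) simp_all
  then show ?thesis by simp
qed

lemma no_pentagon: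
  assumes "odd_T_cycle_free G T W" "{a, b, c, d, e} \<subseteq> W" "distinct [a, b, c, d, e]"
    "adj a b" "adj b c" "adj c d" "adj d e" "adj e a"
  shows "a \<notin> T"
proof -
  have "set [a, b, c, d, e] \<inter> T = {}"
    using assms(2-) by (intro odd_closed_list_avoids[OF assms(1)]) simp_all
  then show ?thesis by simp
qed

lemma no_heptagon:
  assumes "odd_T_cycle_free G T W" "{a, b, c, d, e, f, g} \<subseteq> W" "distinct [a, b, c, d, e, f, g]"
    "adj a b" "adj b c" "adj c d" "adj d e" "adj e f" "adj f g" "adj g a"
  shows "a \<notin> T"
proof -
  have "set [a, b, c, d, e, f, g] \<inter> T = {}"
    using assms(2-) by (intro odd_closed_list_avoids[OF assms(1)]) simp_all
  then show ?thesis by simp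
qed

text \<open>Greedy choice: each chosen vertex discards itself and fewer than \<open>m\<close>
  neighbours, hence at most \<open>m\<close> candidates.\<close>

lemma ex_indep_subset:
  assumes "0 < m"
    and "finite U" "\<And>u. u \<in> U \<Longrightarrow> card {v \<in> U. adj u v} < m" "k * m \<le> card U"
  shows "\<exists>X\<subseteq>U. indep X \<and> card X = k"
  using assms(2-)
proof (induction k arbitrary: U)
  case 0
  show ?case by (rule exI[of _ "{}"]) (simp add: indep_def)
next
  case (Suc k)
  have "U \<noteq> {}" using Suc.prems(3) \<open>0 < m\<close> by auto
  then obtain u where u: "u \<in> U" by blast
  define U' where "U' = U - insert u {v \<in> U. adj u v}"
  have "card (insert u {v \<in> U. adj u v}) \<le> m"
    using Suc.prems(2)[OF u] card_insert_le_m1[of m] Suc.prems(1) by (simp add: card_insert_if)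
  then have c: "k * m \<le> card U'"
    using Suc.prems(1,3) diff_card_le_card_Diff[of "insert u {v \<in> U. adj u v}" U] unfolding U'_def by simp
  have U'U: "U' \<subseteq> U" by (auto simp: U'_def)
  have "card {v \<in> U'. adj w v} < m" if "w \<in> U'" for w
  proof -
    have "card {v \<in> U'. adj w v} \<le> card {v \<in> U. adj w v}"
      using Suc.prems(1) U'U by (intro card_mono) auto
    then show ?thesis using Suc.prems(2)[of w] that U'U by auto
  qed
  then obtain X where X: "X \<subseteq> U'" "indep X" "card X = k"
    using Suc.IH[OF finite_subset[OF U'U Suc.prems(1)] _ c] by blast
  have far: "u \<notin> X" "\<And>x. x \<in> X \<Longrightarrow> \<not> adj u x" using X(1) unfolding U'_def by blast+
  have "indep (insert u X)"
  proof -
    have "\<not> adj x u" if "x \<in> X" for x using far(2)[OF that] adj_sym by blast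
    then show ?thesis using X(2) far(2) unfolding indep_def by simp
  qed
  moreover have "card (insert u X) = Suc k"
    using X far(1) finite_subset[OF _ Suc.prems(1)] U'U by (metis card_insert_disjoint subset_trans)
  ultimately show ?case using X(1) U'U u by (intro exI[of _ "insert u X"]) auto
qed

text \<open>The neighbours of \<open>X\<close> form the independent side. \<open>X\<close> itself
  belongs to the clique side, where its vertices are isolated.\<close>

definition splitter :: "'a set \<Rightarrow> 'a set \<Rightarrow> 'a set \<Rightarrow> bool" where
  "splitter T W X \<longleftrightarrow> X \<subseteq> W \<and> indep X \<and> indep {w \<in> W. \<exists>x\<in>X. adj w x} \<and>
     compatible T {w \<in> W. \<exists>x\<in>X. adj w x} {w \<in> W. \<forall>x\<in>X. \<not> adj w x}"

text \<open>Any two vertices of \<open>X\<close> are joined through \<open>b\<close>, so every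
  violation closes up to a cycle of length 3, 5 or 7 through a terminal.\<close>

lemma splitter_neighbours:
  assumes W: "odd_T_cycle_free G T W" and b: "b \<in> W" and X: "X \<subseteq> W \<inter> T" "\<And>x. x \<in> X \<Longrightarrow> adj b x"
  shows "splitter T W X"
proof -
  let ?B = "{w \<in> W. \<exists>x\<in>X. adj w x}" and ?C = "{w \<in> W. \<forall>x\<in>X. \<not> adj w x}"
  have XW: "x \<in> W" "x \<in> T" if "x \<in> X" for x using X(1) that by blast+
  have iX: "\<not> adj x y" if "x \<in> X" "y \<in> X" for x y
  proof
    assume "adj x y"
    then have "x \<notin> T" using no_triangle[OF W XW(1)[OF that(1)] XW(1)[OF that(2)] b _ adj_sym[OF X(2)[OF that(2)]]
       adj_sym[OF X(2)[OF that(1)]]] by blast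
    then show False using XW that by blast
  qed
  have "\<not> adj w w'" if w: "w \<in> W" "x \<in> X" "adj w x" and w': "w' \<in> W" "x' \<in> X" "adj w' x'" for w w' x x'
  proof
    assume a: "adj w w'"
    have wX: "w \<notin> X" "w' \<notin> X" using iX w w' by blast+
    show False
    proof (cases "x = x' \<or> w = b \<or> w' = b")
      case True
      then obtain y where "y \<in> X" "adj w y" "adj w' y" using w w' X(2) by blast
      then have "y \<notin> T" using no_triangle[OF W XW(1) w(1) w'(1) adj_sym a adj_sym] by blast
      then show False using \<open>y \<in> X\<close> XW by blast
    next
      case False
      have "x \<noteq> b" "x' \<noteq> b" using X(2) w(2) w'(2) adj_irrefl by blast+
      have "x \<noteq> w" "x \<noteq> w'" "x' \<noteq> w" "x' \<noteq> w'" using wX w(2) w'(2) by blast+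
      have "w \<noteq> w'" using a by auto
      have "x \<notin> T"
        by (rule no_pentagon[OF W, of x w w' x' b])
          (use False w(1) w'(1) b XW(1)[OF w(2)] XW(1)[OF w'(2)] \<open>x \<noteq> b\<close> \<open>x' \<noteq> b\<close> \<open>x \<noteq> w\<close> \<open>x \<noteq> w'\<close> \<open>x' \<noteq> w\<close> \<open>x' \<noteq> w'\<close> \<open>w \<noteq> w'\<close>
            adj_sym[OF w(3)] a w'(3) adj_sym[OF X(2)[OF w'(2)]] X(2)[OF w(2)] in simp_all)
      then show False using XW w by blast
    qed
  qed
  then have iB: "indep ?B" unfolding indep_def by blast
  have "b1 = b2" if x: "x \<in> ?C" "y \<in> ?C" "adj x y" and b12: "b1 \<in> ?B" "b2 \<in> ?B" "adj b1 x" "adj b2 y" for x y b1 b2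
  proof (rule ccontr)
    assume ne: "b1 \<noteq> b2"
    have xW: "x \<in> W" "y \<in> W" "b1 \<in> W" "b2 \<in> W" using x b12 by auto
    have notX: "x \<notin> X" "y \<notin> X" using x adj_sym[OF x(3)] by auto
    have BC: "b1 \<noteq> x" "b1 \<noteq> y" "b2 \<noteq> x" "b2 \<noteq> y" "b \<noteq> x" "b \<noteq> y" if "X \<noteq> {}" 
      using x(1,2) b12(1,2) X(2) that by auto
    obtain j1 j2 where j: "j1 \<in> X" "adj b1 j1" "j2 \<in> X" "adj b2 j2" using b12 by auto
    have Xne: "X \<noteq> {}" using j by blast
    have bX: "b1 \<notin> X" "b2 \<notin> X" "b \<notin> X" using iX j X(2) adj_irrefl by blast+
    show False
    \<comment> \<open>A common neighbour in \<open>X\<close> closes the path \<open>b1\<close>,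
      \<open>x\<close>, \<open>y\<close>, \<open>b2\<close> to a pentagon; otherwise
      \<open>j2\<close>, \<open>b\<close> and \<open>j1\<close> close it to a heptagon.\<close>
    proof (cases "\<exists>j\<in>X. adj b1 j \<and> adj b2 j")
      case True
      then obtain j where j: "j \<in> X" "adj b1 j" "adj b2 j" by blast
      have "j \<notin> T"
        by (rule no_pentagon[OF W, of j b1 x y b2])
          (use ne xW XW(1)[OF j(1)] BC[OF Xne] bX notX j(1) adj_sym[OF j(2)] b12(3) x(3) adj_sym[OF b12(4)] j(3) in auto)
      then show False using j XW by blast
    next
      case False
      have nb: "b1 \<noteq> b" "b2 \<noteq> b" "j1 \<noteq> j2" using False j X(2) by blast+
      have "j1 \<notin> T"
        by (rule no_heptagon[OF W, of j1 b1 x y b2 j2 b])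
          (use ne nb b xW XW(1)[OF j(1)] XW(1)[OF j(3)] BC[OF Xne] bX notX j(1,3) adj_sym[OF j(2)] b12(3) x(3) adj_sym[OF b12(4)]
             j(4) adj_sym[OF X(2)[OF j(3)]] X(2)[OF j(1)] in auto)
      then show False using j XW by blast
    qed
  qed
  moreover have "x \<notin> T \<and> b1 \<notin> T" if "x \<in> W" "y \<in> W" "b1 \<in> W" "adj x y" "adj b1 x" "adj b1 y" for x y b1
    using no_triangle[OF W that(1,2,3,4) adj_sym[OF that(6)] adj_sym[OF that(5)]]
      no_triangle[OF W that(3,1,2,5,4,6)] by blast
  ultimately have "compatible T ?B ?C"
    unfolding compatible_def using no_triangle[OF W] by (intro conjI ballI impI) blast+
  then show ?thesis using XW iX iB unfolding splitter_def indep_def by blast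
qed

text \<open>In a cluster, a vertex adjacent to a neighbour of \<open>x \<in> X\<close> is
  \<open>x\<close> or adjacent to \<open>x\<close>. So an edge between neighbours of
  \<open>X\<close> would lie in a triangle with a terminal, and no edge of the clique side has an
  end attached to the independent side.\<close>

lemma splitter_cluster:
  assumes W: "odd_T_cycle_free G T W" "cluster W" and X: "X \<subseteq> W \<inter> T" "indep X"
  shows "splitter T W X"
proof -
  let ?B = "{w \<in> W. \<exists>x\<in>X. adj w x}" and ?C = "{w \<in> W. \<forall>x\<in>X. \<not> adj w x}"
  have XW: "x \<in> W" "x \<in> T" if "x \<in> X" for x using X(1) that by blast+
  have trans: "adj u w" if "u \<in> W" "v \<in> W" "w \<in> W" "adj u v" "adj v w" "u \<noteq> w" for u v w
    using W(2) that unfolding cluster_def by blast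
  have "\<not> adj w w'" if w: "w \<in> W" "x \<in> X" "adj w x" and w': "w' \<in> W" "x' \<in> X" "adj w' x'" for w w' x x'
  proof
    assume a: "adj w w'"
    have "x \<noteq> w'" using X(2) w w' unfolding indep_def by blast
    then have "adj x w'" using trans[OF XW(1)[OF w(2)] w(1) w'(1) adj_sym[OF w(3)] a] by blast
    then have "x \<notin> T" using no_triangle[OF W(1) XW(1)[OF w(2)] w(1) w'(1) adj_sym[OF w(3)] a] by blast
    then show False using XW w by blast
  qed
  then have iB: "indep ?B" unfolding indep_def by blast
  have no_edge: False if x: "x \<in> ?C" "y \<in> ?C" "adj x y" and b: "b \<in> ?B" "adj b x" for x y b
  proof -
    have "x \<notin> X" using x adj_sym[OF x(3)] by auto
    obtain j where j: "j \<in> X" "adj b j" using b by auto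
    have W3: "x \<in> W" "b \<in> W" using x b by auto
    have "adj x j" using trans[OF W3 XW(1)[OF j(1)] adj_sym[OF b(2)] j(2)] j(1) \<open>x \<notin> X\<close> by blast
    then show False using x j by blast
  qed
  have "compatible T ?B ?C"
    unfolding compatible_def
  proof (intro conjI ballI impI)
    fix x y z assume "x \<in> ?C" "y \<in> ?C" "z \<in> ?C" "adj x y" "adj y z" "adj x z"
    then show "x \<notin> T" using no_triangle[OF W(1), of x y z] by blast
  qed (use no_edge in blast)+
  then show ?thesis using XW X(2) iB unfolding splitter_def by blast
qed

text \<open>If some vertex of \<open>W\<close> has \<open>s + 1\<close> terminal neighbours in
  \<open>W\<close>, these serve as \<open>X\<close>. Otherwise \<open>W\<close> is a cluster: the
  vertices of an induced path and their terminal neighbours number at most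
  \<open>3 * (s + 1)\<close>, and among the at least \<open>s * (s + 1)\<close> other terminals the
  greedy choice finds \<open>s\<close> independent ones, contradicting freeness. In a cluster the
  greedy choice also yields \<open>X\<close>.\<close>

lemma ex_splitter:
  assumes free: "H_free (sP1_P3 s) G" and W: "odd_T_cycle_free G T W"
    and large: "(s + 4) * (s + 1) \<le> card (W \<inter> T)"
  shows "\<exists>X. splitter T W X \<and> card X = s + 1"
proof (cases "\<exists>b\<in>W. s + 1 \<le> card {u \<in> W \<inter> T. adj b u}")
  case True
  then obtain b where b: "b \<in> W" "s + 1 \<le> card {u \<in> W \<inter> T. adj b u}" by blast
  obtain X where "X \<subseteq> {u \<in> W \<inter> T. adj b u}" "card X = s + 1"
    using obtain_subset_with_card_n[OF b(2)] by metis
  then show ?thesis using splitter_neighbours[OF W b(1), of X] by blast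
next
  case False
  let ?U = "W \<inter> T"
  have finU: "finite ?U" using W finite_verts finite_subset unfolding odd_T_cycle_free_def by blast
  have deg: "card {u \<in> ?U. adj b u} < s + 1" if "b \<in> W" for b using False that not_le by blast
  have "cluster W"
  proof (rule ccontr)
    assume "\<not> cluster W"
    then obtain a b c where abc: "a \<in> W" "b \<in> W" "c \<in> W" "adj a b" "adj b c" "a \<noteq> c" "\<not> adj a c"
      unfolding cluster_def by blast
    define N where "N x = insert x {u \<in> ?U. adj x u}" for x
    have N: "finite (N x)" "x \<in> W \<Longrightarrow> card (N x) \<le> s + 1" for x
    proof -
      have fin: "finite {u \<in> ?U. adj x u}" using finU by (rule rev_finite_subset) blast
      then show "finite (N x)" by (simp add: N_def)
      assume "x \<in> W"
      from deg[OF this] show "card (N x) \<le> s + 1"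
        unfolding N_def card_insert_if[OF fin] by simp
    qed
    have "card (N a \<union> N b \<union> N c) \<le> card (N a) + card (N b) + card (N c)"
      using card_Un_le[of "N a \<union> N b" "N c"] card_Un_le[of "N a" "N b"] by linarith
    then have "card (N a \<union> N b \<union> N c) \<le> 3 * (s + 1)" using N(2)[OF abc(1)] N(2)[OF abc(2)] N(2)[OF abc(3)] by simp
    moreover have "card ?U - card (N a \<union> N b \<union> N c) \<le> card (?U - (N a \<union> N b \<union> N c))"
      by (rule diff_card_le_card_Diff) (use N in auto)
    ultimately have c: "s * (s + 1) \<le> card (?U - (N a \<union> N b \<union> N c))" using large by (simp add: algebra_simps)
    have "card {v \<in> ?U - (N a \<union> N b \<union> N c). adj u v} < s + 1" if "u \<in> ?U - (N a \<union> N b \<union> N c)" for u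
    proof -
      have "card {v \<in> ?U - (N a \<union> N b \<union> N c). adj u v} \<le> card {v \<in> ?U. adj u v}"
        using finU by (intro card_mono rev_finite_subset[OF finU]) auto
      then show ?thesis using deg[of u] that by auto
    qed
    then obtain I where I: "I \<subseteq> ?U - (N a \<union> N b \<union> N c)" "indep I" "card I = s"
      using ex_indep_subset[of "s + 1" "?U - (N a \<union> N b \<union> N c)" s] finU c by auto
    show False
    proof (rule H_freeD[OF free _ I(2) _ abc(4,5,7,6)])
      show "I \<subseteq> verts G" using I(1) W unfolding odd_T_cycle_free_def by blast
      fix v x assume v: "v \<in> I" and x: "x \<in> {a, b, c}"
      have "v \<notin> N x" "v \<in> ?U" using I(1) v x by auto
      then have "v \<noteq> x" "\<not> adj x v" unfolding N_def by blast+
      then show "v \<noteq> x \<and> \<not> adj v x" using adj_sym by blast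
    qed (use I in simp)
  qed
  moreover obtain X where "X \<subseteq> ?U" "indep X" "card X = s + 1"
  proof -
    have "(s + 1) * (s + 1) \<le> card ?U" using large by (simp add: algebra_simps)
    then have "\<exists>X\<subseteq>?U. indep X \<and> card X = s + 1" using finU deg by (intro ex_indep_subset) auto
    then show ?thesis using that by blast
  qed
  ultimately show ?thesis using splitter_cluster[OF W] by blast
qed

end

section \<open>From a splitter to a certificate\<close>

context linorder_graph begin

lemma compatible_mono:
  assumes comp: "compatible T B C" and sub: "B' \<subseteq> B" "C' \<subseteq> C"
  shows "compatible T B' C'"
  unfolding compatible_def
proof (intro conjI ballI impI)
  fix x y z assume "x \<in> C'" "y \<in> C'" "z \<in> C'" "adj x y" "adj y z" "adj x z"
  then show "x \<notin> T" using compatible_triangleD[OF comp, of x y z] sub(2) by blast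
next
  fix x y b b' assume *: "x \<in> C'" "y \<in> C'" "b \<in> B'" "b' \<in> B'" "adj x y" "adj b x" "adj b' y"
  from compatible_edgeD[OF comp subsetD[OF sub(2) *(1)] subsetD[OF sub(2) *(2)]
      subsetD[OF sub(1) *(3)] subsetD[OF sub(1) *(4)] *(5-7)]
  show "b = b'" "x \<notin> T" "b \<notin> T" by blast+
qed

text \<open>If every vertex of \<open>X\<close> has at most \<open>s + 1\<close> neighbours in
  \<open>B\<close>, then \<open>B\<close> is small enough to be \<open>Y\<close>. Otherwise a vertex
  \<open>j\<close> with \<open>s + 2\<close> such neighbours bounds the number of cliques with two
  vertices in \<open>C\<close>, and \<open>Y\<close> consists of these neighbours of
  \<open>j\<close> and the neighbours of a set \<open>Z\<close> with one vertex from each such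
  clique.\<close>

lemma splitter_certificate:
  assumes free: "H_free (sP1_P3 s) G" and WV: "W \<subseteq> verts G"
    and X: "splitter T W X" "card X = s + 1"
  shows "\<exists>f Y Z. certificate f X Y Z \<and> Y \<subseteq> verts G \<and> Z \<subseteq> verts G \<and>
    card Y \<le> (s + 2) * (s + 2) \<and> card Z \<le> s \<and> card W \<le> certified T f X Y Z"
proof -
  define Q where "Q = far X"
  define B where "B = {w \<in> W. \<exists>x\<in>X. adj w x}"
  define C where "C = {w \<in> W. \<forall>x\<in>X. \<not> adj w x}"
  have sp: "X \<subseteq> W" "indep X" "indep B" "compatible T B C"
    using X(1) by (auto simp: splitter_def B_def C_def)
  have QV: "Q \<subseteq> verts G" and BV: "B \<subseteq> verts G" using WV by (auto simp: Q_def far_def B_def)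
  have finQ: "finite Q" and finB: "finite B" and finW: "finite W"
    using QV BV WV finite_verts finite_subset by blast+
  have finX: "finite X" using sp(1) finW finite_subset by blast
  have CQ: "C \<subseteq> Q" using WV by (auto simp: C_def Q_def far_def)
  have QX: "\<not> adj v x" if "v \<in> Q" "x \<in> X" for v x using that by (auto simp: Q_def far_def)
  have BQ: "b \<notin> Q" if "b \<in> B" for b using that by (auto simp: B_def Q_def far_def)
  have cardW: "card W = card B + card C"
  proof -
    have "W = B \<union> C" "B \<inter> C = {}" by (auto simp: B_def C_def)
    then show ?thesis using finW finB CQ finQ finite_subset by (metis card_Un_disjoint)
  qed
  \<comment> \<open>\<open>X\<close> lies in \<open>far X\<close> as a set of isolated vertices, so
    an induced path in \<open>far X\<close> avoids \<open>X\<close> and is not adjacent to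
    it.\<close>
  have cQ: "cluster Q"
  proof (rule ccontr)
    assume "\<not> cluster Q"
    then obtain a b c where abc: "a \<in> Q" "b \<in> Q" "c \<in> Q" "adj a b" "adj b c" "a \<noteq> c" "\<not> adj a c"
      unfolding cluster_def by blast
    show False
    proof (rule H_freeD[OF free _ sp(2) _ abc(4,5,7,6)])
      show "X \<subseteq> verts G" using sp(1) WV by blast
      fix v x assume v: "v \<in> X" and x: "x \<in> {a, b, c}"
      have "x \<in> Q" using abc(1-3) x by blast
      then have "\<not> adj v x" using QX[OF _ v] adj_sym[of v x] by blast
      moreover have "v \<noteq> a" using QX[OF abc(2) v] adj_sym[OF abc(4)] by blast
      moreover have "v \<noteq> b" using QX[OF abc(1) v] abc(4) by blast
      moreover have "v \<noteq> c" using QX[OF abc(2) v] abc(5) by blast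
      ultimately show "v \<noteq> x \<and> \<not> adj v x" using x by blast
    qed (use X(2) in simp)
  qed
  have cardC: "card C = (\<Sum>r\<in>reps Q. card (C \<inter> clq Q r))"
    by (rule card_eq_sum_reps[OF cQ finQ CQ])
  have fit: "card (C \<inter> clq Q r) \<le> maxfit T Y (clq Q r)" if "Y \<subseteq> B" for Y r
    by (rule maxfit_upper[OF finite_subset[OF clq_subset finQ] _ compatible_mono[OF sp(4) that]]) auto
  show ?thesis
  proof (cases "\<forall>j\<in>X. card {b \<in> B. adj b j} \<le> s + 1")
    case True
    have "B = (\<Union>j\<in>X. {b \<in> B. adj b j})" by (auto simp: B_def)
    then have "card B \<le> (\<Sum>j\<in>X. card {b \<in> B. adj b j})" using card_UN_le[OF finX] by metis
    also have "\<dots> \<le> (\<Sum>j\<in>X. s + 1)" using True by (intro sum_mono) auto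
    finally have cB: "card B \<le> (s + 2) * (s + 2)" using X(2) by simp
    have near: "free_near False X B {} = {}" by (auto simp: free_near_def)
    have "cluster {}" "\<forall>y\<in>B. \<exists>x\<in>X. adj y x" by (simp_all add: cluster_def B_def)
    then have "certificate False X B {}"
      unfolding certificate_def near Q_def[symmetric] using cQ sp(3) by blast
    moreover have "card C \<le> (\<Sum>r\<in>reps Q. maxfit T B (clq Q r))"
      unfolding cardC using fit by (intro sum_mono) auto
    then have "card W \<le> certified T False X B {}"
      unfolding cardW certified_def near by (simp add: special_def Q_def[symmetric] reps_def)
    ultimately show ?thesis using cB BV by (intro exI[of _ False] exI[of _ B] exI[of _ "{}"]) auto
  next
    case False
    then obtain j where j: "j \<in> X" "s + 2 \<le> card {b \<in> B. adj b j}" by fastforce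
    \<comment> \<open>The number \<open>s + 2\<close> is used twice: two vertices must survive when
      the neighbours of \<open>s\<close> vertices of \<open>Z\<close> are removed, and later
      \<open>s\<close> must survive the removal of two.\<close>
    obtain Y0 where Y0: "Y0 \<subseteq> {b \<in> B. adj b j}" "card Y0 = s + 2"
      using obtain_subset_with_card_n[OF j(2)] by metis
    define R where "R = {r \<in> reps Q. 2 \<le> card (C \<inter> clq Q r)}"
    \<comment> \<open>By compatibility, if one end of an edge in \<open>C\<close> has two neighbours
      in \<open>B\<close>, the other end has none.\<close>
    have "\<exists>z. z \<in> C \<inter> clq Q r \<and> z \<notin> X \<and> (\<forall>b\<in>B. \<forall>b'\<in>B. adj z b \<longrightarrow> adj z b' \<longrightarrow> b = b')" if r: "r \<in> R" for r
    proof -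
      have "finite (C \<inter> clq Q r)" using finite_subset[OF CQ finQ] by blast
      then obtain x y where xy: "x \<in> C \<inter> clq Q r" "y \<in> C \<inter> clq Q r" "x \<noteq> y"
        using r card_le_Suc0_iff_eq[of "C \<inter> clq Q r"] unfolding R_def by fastforce
      have rQ: "r \<in> Q" using r reps_subset unfolding R_def by blast
      have a: "adj x y" using adj_in_clq[OF cQ rQ] xy by blast
      have "x \<notin> X" using QX[of y x] adj_sym[OF a] xy(2) CQ by blast
      have "y \<notin> X" using QX[of x y] a xy(1) CQ by blast
      show ?thesis
      proof (cases "\<forall>b\<in>B. \<forall>b'\<in>B. adj x b \<longrightarrow> adj x b' \<longrightarrow> b = b'")
        case True
        then show ?thesis using xy(1) \<open>x \<notin> X\<close> by blast
      next
        case False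
        then obtain b1 b2 where b: "b1 \<in> B" "b2 \<in> B" "adj x b1" "adj x b2" "b1 \<noteq> b2" by blast
        have "\<not> adj y b" if "b \<in> B" for b
        proof
          assume yb: "adj y b"
          have "b1 = b" using compatible_edgeD[OF sp(4) _ _ b(1) that a adj_sym[OF b(3)] adj_sym[OF yb]] xy by blast
          moreover have "b2 = b" using compatible_edgeD[OF sp(4) _ _ b(2) that a adj_sym[OF b(4)] adj_sym[OF yb]] xy by blast
          ultimately show False using b(5) by simp
        qed
        then show ?thesis using xy(2) \<open>y \<notin> X\<close> by blast
      qed
    qed
    then obtain z where z: "\<And>r. r \<in> R \<Longrightarrow> z r \<in> C \<inter> clq Q r \<and> z r \<notin> X \<and>
      (\<forall>b\<in>B. \<forall>b'\<in>B. adj (z r) b \<longrightarrow> adj (z r) b' \<longrightarrow> b = b')" by metis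
    have finR: "finite R" using finQ reps_subset finite_subset unfolding R_def by (metis (no_types, lifting) mem_Collect_eq subsetI)
    define Z where "Z = z ` R"
    have finZ: "finite Z" using finR by (simp add: Z_def)
    have ZC: "Z \<subseteq> C" "Z \<inter> X = {}" using z unfolding Z_def by blast+
    have Zone: "b = b'" if "u \<in> Z" "b \<in> B" "b' \<in> B" "adj u b" "adj u b'" for u b b'
      using z that unfolding Z_def by blast
    have iZ: "indep Z"
    proof -
      have "\<not> adj (z r) (z r')" if "r \<in> R" "r' \<in> R" for r r'
      proof
        assume a: "adj (z r) (z r')"
        have rr: "r \<in> reps Q" "r' \<in> reps Q" using that by (auto simp: R_def)
        have L: "z r \<in> clq Q r" "z r' \<in> clq Q r'" using z that by blast+
        have "z r' \<in> clq Q r"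
          by (rule clq_closed[OF cQ subsetD[OF reps_subset rr(1)] L(1) subsetD[OF clq_subset L(2)] a])
        then have "r = r'" using clq_disjoint[OF cQ rr _ L(2)] by blast
        then show False using a by simp
      qed
      then show ?thesis unfolding indep_def Z_def by blast
    qed
    define NZ where "NZ U = {b \<in> B. \<exists>u\<in>U. adj u b}" for U
    have cardNZ: "card (NZ U) \<le> card U" if "U \<subseteq> Z" for U
    proof -
      have finU: "finite U" using that finZ finite_subset by blast
      have "NZ U = (\<Union>u\<in>U. {b \<in> B. adj u b})" by (auto simp: NZ_def)
      then have "card (NZ U) \<le> (\<Sum>u\<in>U. card {b \<in> B. adj u b})" using card_UN_le[OF finU] by metis
      also have "\<dots> \<le> (\<Sum>u\<in>U. 1)"
      proof (rule sum_mono)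
        fix u assume "u \<in> U"
        then show "card {b \<in> B. adj u b} \<le> 1"
          using card_le_Suc0_iff_eq[of "{b \<in> B. adj u b}"] finB Zone[of u] that by auto
      qed
      finally show ?thesis by simp
    qed
    have YB: "Y0 \<subseteq> B" "\<And>b. b \<in> Y0 \<Longrightarrow> adj b j" using Y0(1) by blast+
    have finY0: "finite Y0" using YB(1) finB finite_subset by blast
    \<comment> \<open>Each vertex of \<open>Z\<close> has at most one neighbour in \<open>B\<close>,
      so \<open>s\<close> of them would miss two vertices of \<open>Y0\<close>, which form an
      induced path with middle vertex \<open>j\<close>.\<close>
    have cZ: "card Z < s"
    proof (rule ccontr)
      assume "\<not> card Z < s"
      then obtain I where I: "I \<subseteq> Z" "card I = s" using obtain_subset_with_card_n[of s Z] by (metis not_less)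
      have "2 \<le> card (Y0 - NZ I)"
      proof -
        have "card Y0 - card (NZ I) \<le> card (Y0 - NZ I)"
          by (rule diff_card_le_card_Diff) (use finB in \<open>auto simp: NZ_def\<close>)
        then show ?thesis using cardNZ[OF I(1)] I(2) Y0(2) by linarith
      qed
      then obtain b1 b2 where b: "b1 \<in> Y0 - NZ I" "b2 \<in> Y0 - NZ I" "b1 \<noteq> b2"
        using card_le_Suc0_iff_eq[of "Y0 - NZ I"] finY0 by fastforce
      have bB: "b1 \<in> B" "b2 \<in> B" using b YB by blast+
      have nb: "\<not> adj b1 b2" using sp(3) bB unfolding indep_def by blast
      have a: "adj b1 j" "adj j b2" using YB(2) b adj_sym by blast+
      show False
      proof (rule H_freeD[OF free _ indep_subset[OF iZ I(1)] _ a nb b(3)])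
        show "I \<subseteq> verts G" using I(1) ZC CQ QV by blast
        fix v x assume v: "v \<in> I" and x: "x \<in> {b1, j, b2}"
        have vQ: "v \<in> Q" "v \<notin> X" using I(1) v ZC CQ by blast+
        have 1: "v \<noteq> j \<and> \<not> adj v j" using vQ j(1) QX by blast
        have 2: "v \<noteq> b1 \<and> \<not> adj v b1" using vQ(1) BQ[OF bB(1)] b(1) bB(1) v unfolding NZ_def by blast
        have 3: "v \<noteq> b2 \<and> \<not> adj v b2" using vQ(1) BQ[OF bB(2)] b(2) bB(2) v unfolding NZ_def by blast
        show "v \<noteq> x \<and> \<not> adj v x" using x 1 2 3 by blast
      qed (use I in simp)
    qed
    \<comment> \<open>Including the neighbours of \<open>Z\<close> puts all the rest of
      \<open>B\<close> into \<open>free_near True X Y Z\<close>.\<close>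
    define Y where "Y = Y0 \<union> NZ Z"
    have YB': "Y \<subseteq> B" using YB by (auto simp: Y_def NZ_def)
    have finY: "finite Y" using YB' finB finite_subset by blast
    have cY: "card Y \<le> (s + 2) * (s + 2)"
    proof -
      have "card Y \<le> card Y0 + card (NZ Z)" unfolding Y_def by (rule card_Un_le)
      also have "\<dots> \<le> (s + 2) + s" using cardNZ[of Z] cZ Y0(2) by simp
      finally show ?thesis by simp
    qed
    have cY': "s + 2 \<le> card Y" using Y0(2) card_mono[OF finY, of Y0] by (simp add: Y_def)
    define P where "P = free_near True X Y Z"
    have P: "v \<in> verts G" "\<exists>x\<in>X. adj v x" "v \<notin> Y" "\<And>y. y \<in> Y \<Longrightarrow> \<not> adj v y" "\<And>z. z \<in> Z \<Longrightarrow> \<not> adj v z" if "v \<in> P" for v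
      using that by (auto simp: P_def free_near_def)
    have finP: "finite P" by (rule finite_subset[OF subsetI[OF P(1)] finite_verts])
    have iY: "indep Y" by (rule indep_subset[OF sp(3) YB'])
    have YV: "Y \<subseteq> verts G" using YB' BV by blast
    have cP: "cluster P"
    proof (rule ccontr)
      assume "\<not> cluster P"
      then obtain a b c where abc: "a \<in> P" "b \<in> P" "c \<in> P" "adj a b" "adj b c" "a \<noteq> c" "\<not> adj a c"
        unfolding cluster_def by blast
      show False
      proof (rule H_freeD[OF free YV iY _ abc(4,5,7,6)])
        fix v x assume v: "v \<in> Y" and x: "x \<in> {a, b, c}"
        have "x \<in> P" using abc(1-3) x by blast
        from P(3,4)[OF this] v show "v \<noteq> x \<and> \<not> adj v x" using adj_sym[of v x] by blast
      qed (use cY' in simp)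
    qed
    \<comment> \<open>Otherwise take \<open>u \<in> Z\<close> in the clique of \<open>v\<close>;
      then \<open>u\<close>, \<open>v\<close>, \<open>b\<close> is an induced path. Each of
      \<open>u\<close> and \<open>v\<close> has at most one neighbour in \<open>Y\<close> and
      \<open>b\<close> has none, so at least \<open>s\<close> vertices of \<open>Y\<close> avoid the
      path.\<close>
    have two: "\<exists>y\<in>Y. \<exists>y'\<in>Y. y \<noteq> y' \<and> adj v y \<and> adj v y'"
      if r: "r \<in> reps Q" "r \<in> special True Z" and v: "v \<in> clq Q r" and b: "b \<in> P" "adj v b" for r v b
    proof (rule ccontr)
      assume no: "\<not> ?thesis"
      obtain u where u: "u \<in> Z" "r = u \<or> adj r u" using r(2) by (auto simp: special_def)
      have uQ: "u \<in> Q" using u(1) ZC CQ by blast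
      have rQ: "r \<in> Q" using r(1) reps_subset by blast
      have ul: "u \<in> clq Q r" using u(2) uQ adj_sym[of r u] by (auto simp: clq_def)
      have ub: "\<not> adj u b" using P(5)[OF b(1) u(1)] adj_sym[of u b] by blast
      have "u \<noteq> v" using ub b(2) by blast
      then have uv: "adj u v" by (rule adj_in_clq[OF cQ rQ ul v])
      have bQ: "b \<notin> Q" using P(2)[OF b(1)] QX by blast
      have vQ: "v \<in> Q" using v clq_subset by blast
      have card1: "card {y \<in> Y. adj v y} \<le> 1" "card {y \<in> Y. adj u y} \<le> 1"
      proof -
        have "finite {y \<in> Y. adj v y}" "finite {y \<in> Y. adj u y}" using finY by simp_all
        note 1 = this[THEN card_le_Suc0_iff_eq]
        show "card {y \<in> Y. adj v y} \<le> 1" using 1(1) no by auto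
        show "card {y \<in> Y. adj u y} \<le> 1" using 1(2) Zone[OF u(1)] YB' by auto
      qed
      define I where "I = Y - ({y \<in> Y. adj v y} \<union> {y \<in> Y. adj u y})"
      have "card ({y \<in> Y. adj v y} \<union> {y \<in> Y. adj u y}) \<le> 2"
        using card_Un_le[of "{y \<in> Y. adj v y}" "{y \<in> Y. adj u y}"] card1 by linarith
      moreover have "card Y - card ({y \<in> Y. adj v y} \<union> {y \<in> Y. adj u y}) \<le> card I"
        unfolding I_def by (rule diff_card_le_card_Diff) (use finY in simp)
      ultimately have cI: "s \<le> card I" using cY' by linarith
      show False
      proof (rule H_freeD[OF free _ _ cI uv b(2) ub])
        show "u \<noteq> b" using uQ bQ by blast
        show "I \<subseteq> verts G" using YV unfolding I_def by blast
        show "indep I" by (rule indep_subset[OF iY]) (auto simp: I_def)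
        fix y x assume y: "y \<in> I" and x: "x \<in> {u, v, b}"
        have yY: "y \<in> Y" "\<not> adj v y" "\<not> adj u y" using y by (auto simp: I_def)
        have yQ: "y \<notin> Q" using yY(1) YB' BQ by blast
        have 1: "y \<noteq> u \<and> \<not> adj y u" using yQ uQ yY(3) adj_sym[of y u] by blast
        have 2: "y \<noteq> v \<and> \<not> adj y v" using yQ vQ yY(2) adj_sym[of y v] by blast
        have 3: "y \<noteq> b \<and> \<not> adj y b" using P(3,4)[OF b(1)] yY(1) adj_sym[of y b] by blast
        show "y \<noteq> x \<and> \<not> adj y x" using x 1 2 3 by blast
      qed
    qed
    have cert: "certificate True X Y Z"
      unfolding certificate_def Q_def[symmetric] P_def[symmetric]
      using cQ cP iY two YB' unfolding B_def by blast
    have "B - Y \<subseteq> P"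
    proof
      fix b assume b: "b \<in> B - Y"
      have "\<not> adj b y" if "y \<in> Y" for y using sp(3) b YB' that unfolding indep_def by blast
      moreover have "\<not> adj b u" if "u \<in> Z" for u
        using b that adj_sym[of b u] unfolding Y_def NZ_def by blast
      ultimately show "b \<in> P" using b BV unfolding P_def free_near_def B_def by blast
    qed
    then have "card (B - Y) \<le> card (reps P)"
      using indep_card_le_reps[OF cP finP _ indep_subset[OF sp(3)]] by blast
    moreover have "card B = card Y + card (B - Y)" using card_Diff_subset[OF finY YB'] card_mono[OF finB YB'] by simp
    moreover have "card C \<le> (\<Sum>r\<in>reps Q. if r \<in> special True Z then maxfit T Y (clq Q r) else 1)"
      unfolding cardC
    proof (rule sum_mono)
      fix r assume r: "r \<in> reps Q"
      show "card (C \<inter> clq Q r) \<le> (if r \<in> special True Z then maxfit T Y (clq Q r) else 1)"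
      proof (cases "r \<in> special True Z")
        case False
        \<comment> \<open>A clique with two vertices in \<open>C\<close> contributes to
          \<open>Z\<close>, which makes it special.\<close>
        have "r \<notin> R"
        proof
          assume "r \<in> R"
          then have "z r \<in> Z" "z r \<in> clq Q r" using z by (auto simp: Z_def)
          then have "r = z r \<or> adj r (z r)" using adj_sym[of "z r" r] by (auto simp: clq_def)
          then show False using False \<open>z r \<in> Z\<close> by (auto simp: special_def)
        qed
        then show ?thesis using r False by (simp add: R_def)
      qed (use fit[OF YB'] in simp)
    qed
    ultimately have "card W \<le> certified T True X Y Z"
      unfolding certified_def cardW Q_def[symmetric] P_def[symmetric] by linarith
    then show ?thesis using cert YV ZC(1) CQ QV cY cZ
      by (intro exI[of _ True] exI[of _ Y] exI[of _ Z]) auto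
  qed
qed

section \<open>The largest part of a clique compatible with a guessed set\<close>

lemma (in -) two_le_cardD: "2 \<le> card A \<Longrightarrow> \<exists>x\<in>A. \<exists>y\<in>A. x \<noteq> y"
  using card_le_Suc0_iff_eq[of A] card.infinite[of A] by (cases "finite A") auto

lemma le_maxfitI:
  assumes L: "finite L" and "A \<subseteq> L" "\<And>x. x \<in> A \<Longrightarrow> x \<notin> T"
    and "\<And>x y b b'. x \<in> A \<Longrightarrow> y \<in> A \<Longrightarrow> b \<in> Y \<Longrightarrow> b' \<in> Y \<Longrightarrow> adj x y \<Longrightarrow> adj b x \<Longrightarrow> adj b' y \<Longrightarrow> b = b' \<and> b \<notin> T"
  shows "card A \<le> maxfit T Y L"
proof (rule maxfit_upper[OF L assms(2)])
  show "compatible T Y A"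
    unfolding compatible_def
  proof (intro conjI ballI impI)
    fix x y b b' assume "x \<in> A" "y \<in> A" "b \<in> Y" "b' \<in> Y" "adj x y" "adj b x" "adj b' y"
    from assms(4)[OF this] assms(3)[OF \<open>x \<in> A\<close>] show "b = b'" "x \<notin> T" "b \<notin> T" by blast+
  qed (use assms(3) in blast)
qed

text \<open>A compatible part of a clique has one of four shapes. It is a single vertex; or, since a
  terminal excludes a triangle, a pair of which one vertex has no neighbour in \<open>Y\<close>; or
  it has no terminal and at most one vertex attached to \<open>Y\<close>; or it has no terminal and
  is attached to a single non-terminal \<open>b\<close>. Bounding \<open>k\<close> instead of naming
  the maximum matches \<open>le_tval_tMaxL\<close>.\<close>

lemma le_maxfit_iff:
  assumes Q: "cluster Q" "finite Q" "r \<in> Q" and L_def: "L = clq Q r"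
  shows "k \<le> maxfit T Y L \<longleftrightarrow>
     k \<le> 1 \<or>
     k \<le> 2 \<and> (\<exists>v\<in>L. \<exists>w\<in>L. v \<noteq> w \<and> (\<forall>y\<in>Y. \<not> adj w y)) \<or>
     k \<le> card {v \<in> L. v \<notin> T \<and> (\<forall>y\<in>Y. \<not> adj v y)} + of_bool (\<exists>v\<in>L. v \<notin> T \<and> (\<exists>y\<in>Y. adj v y)) \<or>
     (\<exists>b\<in>Y. b \<notin> T \<and> k \<le> card {v \<in> L. v \<notin> T \<and> (\<forall>y\<in>Y. y = b \<or> \<not> adj v y)})"
    (is "_ \<longleftrightarrow> ?A \<or> ?B \<or> ?C \<or> ?D")
proof -
  have finL: "finite L" unfolding L_def by (rule finite_subset[OF clq_subset Q(2)])
  have clique: "adj u v" if "u \<in> L" "v \<in> L" "u \<noteq> v" for u v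
    using adj_in_clq[OF Q(1,3)] that unfolding L_def by blast
  let ?Free = "{v \<in> L. v \<notin> T \<and> (\<forall>y\<in>Y. \<not> adj v y)}"
  let ?Only = "\<lambda>b. {v \<in> L. v \<notin> T \<and> (\<forall>y\<in>Y. y = b \<or> \<not> adj v y)}"
  let ?Att = "\<exists>v\<in>L. v \<notin> T \<and> (\<exists>y\<in>Y. adj v y)"
  let ?Pair = "\<exists>v\<in>L. \<exists>w\<in>L. v \<noteq> w \<and> (\<forall>y\<in>Y. \<not> adj w y)"
  have finFree: "finite ?Free" using finL by simp
  have A: "1 \<le> maxfit T Y L"
  proof -
    have "card {r} \<le> maxfit T Y L"
      using Q(3) by (intro maxfit_upper[OF finL]) (auto simp: L_def clq_def compatible_def)
    then show ?thesis by simp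
  qed
  have B: "2 \<le> maxfit T Y L" if vw: "v \<in> L" "w \<in> L" "v \<noteq> w" "\<forall>y\<in>Y. \<not> adj w y" for v w
  proof -
    have "card {v, w} \<le> maxfit T Y L"
    proof (rule maxfit_upper[OF finL])
      show "compatible T Y {v, w}"
        unfolding compatible_def
      proof (intro conjI ballI impI)
        fix x y z assume "x \<in> {v, w}" "y \<in> {v, w}" "z \<in> {v, w}" "adj x y" "adj y z" "adj x z"
        then have False by (elim insertE emptyE) simp_all
        then show "x \<notin> T" by blast
      next
        fix x y b b' assume *: "x \<in> {v, w}" "y \<in> {v, w}" "b \<in> Y" "b' \<in> Y" "adj x y" "adj b x" "adj b' y"
        have "x \<noteq> y" using *(5) by auto
        then have "x = w \<or> y = w" using *(1,2) by blast
        then have False using vw(4) *(3,4) adj_sym[OF *(6)] adj_sym[OF *(7)] by blast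
        then show "b = b'" "x \<notin> T" "b \<notin> T" by blast+
      qed
    qed (use vw in simp)
    then show ?thesis using vw(3) by simp
  qed
  have C: "card ?Free + of_bool ?Att \<le> maxfit T Y L"
  proof (cases ?Att)
    case True
    then obtain v where v: "v \<in> L" "v \<notin> T" "\<exists>y\<in>Y. adj v y" by blast
    have "card (insert v ?Free) \<le> maxfit T Y L"
    proof (rule le_maxfitI[OF finL])
      fix x y b b' assume *: "x \<in> insert v ?Free" "y \<in> insert v ?Free" "b \<in> Y" "b' \<in> Y" "adj x y" "adj b x" "adj b' y"
      have "x \<noteq> y" using *(5) by auto
      then have "x \<in> ?Free \<or> y \<in> ?Free" using *(1,2) by blast
      then have False using *(3,4) adj_sym[OF *(6)] adj_sym[OF *(7)] by blast
      then show "b = b' \<and> b \<notin> T" by blast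
    qed (use v in blast)+
    moreover have "v \<notin> ?Free" using v(3) by blast
    ultimately show ?thesis using True finFree by simp
  next
    case False
    have "card ?Free \<le> maxfit T Y L"
    proof (rule le_maxfitI[OF finL])
      fix x y b b' assume *: "x \<in> ?Free" "b \<in> Y" "adj b x"
      then have False using adj_sym[OF *(3)] by blast
      then show "b = b' \<and> b \<notin> T" by blast
    qed blast+
    then show ?thesis unfolding of_bool_eq_0_iff[THEN iffD2, OF False] by simp
  qed
  have D: "card (?Only b) \<le> maxfit T Y L" if "b \<in> Y" "b \<notin> T" for b
  proof (rule le_maxfitI[OF finL])
    fix x y c c' assume *: "x \<in> ?Only b" "y \<in> ?Only b" "c \<in> Y" "c' \<in> Y" "adj c x" "adj c' y"
    have "c = b" using *(1,3) adj_sym[OF *(5)] by blast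
    moreover have "c' = b" using *(2,4) adj_sym[OF *(6)] by blast
    ultimately show "c = c' \<and> c \<notin> T" using that by blast
  qed blast+
  have "?A \<or> ?B \<or> ?C \<or> ?D" if k: "k \<le> maxfit T Y L"
  proof -
    obtain S where S: "S \<subseteq> L" "compatible T Y S" "card S = maxfit T Y L"
      using maxfit_attained[OF finL] by blast
    have finS: "finite S" using S(1) finL finite_subset by blast
    have pair: "b = b' \<and> x \<notin> T \<and> b \<notin> T" if "x \<in> S" "y \<in> S" "x \<noteq> y" "b \<in> Y" "b' \<in> Y" "adj x b" "adj y b'" for x y b b'
    proof -
      have "adj x y" using clique S(1) that(1-3) by blast
      from compatible_edgeD[OF S(2) that(1,2,4,5) this adj_sym[OF that(6)] adj_sym[OF that(7)]] show ?thesis .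
    qed
    have disj: "?A \<or> ?B \<or> ?C \<or> ?D" if "card S \<le> 1 \<or> card S \<le> 2 \<and> ?Pair \<or>
      card S \<le> card ?Free + of_bool ?Att \<or>
      (\<exists>b\<in>Y. b \<notin> T \<and> card S \<le> card (?Only b))"
    proof -
      have "k \<le> card S" using k S(3) by simp
      from order_trans[OF this] that show ?thesis by blast
    qed
    show ?thesis
    proof (cases "S \<inter> T = {}")
      case False
      then obtain t where t: "t \<in> S" "t \<in> T" by blast
      have "card S \<le> 2"
      proof (rule ccontr)
        assume "\<not> card S \<le> 2"
        then have "2 \<le> card (S - {t})" using t(1) by simp
        then obtain y z where yz: "y \<in> S - {t}" "z \<in> S - {t}" "y \<noteq> z"
          using two_le_cardD by blast
        have "adj t y" "adj y z" "adj t z" using clique S(1) t(1) yz by blast+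
        then show False using compatible_triangleD[OF S(2) t(1)] yz t(2) by blast
      qed
      moreover have ?Pair if big: "\<not> card S \<le> 1"
      proof -
        obtain u where u: "u \<in> S" "u \<noteq> t"
        proof -
          have "2 \<le> card S" using big by simp
          then show ?thesis using two_le_cardD[of S] that by metis
        qed
        show ?thesis
        proof (cases "\<forall>y\<in>Y. \<not> adj t y")
          case True
          then show ?thesis using u t(1) S(1) by blast
        next
          case False
          then obtain y where y: "y \<in> Y" "adj t y" by blast
          have "\<not> adj u y'" if "y' \<in> Y" for y'
            using pair[OF t(1) u(1) u(2)[symmetric] y(1) that y(2)] t(2) by blast
          then have nb: "\<forall>y\<in>Y. \<not> adj u y" by blast
          have "t \<in> L" "u \<in> L" using S(1) t(1) u(1) by blast+
          then show ?thesis using nb u(2) by (intro bexI[of _ t] bexI[of _ u]) simp_all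
        qed
      qed
      ultimately show ?thesis using disj by blast
    next
      case noT: True
      show ?thesis
      proof (cases "\<exists>v\<in>S. \<exists>w\<in>S. v \<noteq> w \<and> (\<exists>y\<in>Y. adj v y) \<and> (\<exists>y\<in>Y. adj w y)")
        case True
        then obtain v w b b' where vw: "v \<in> S" "w \<in> S" "v \<noteq> w" "b \<in> Y" "adj v b" "b' \<in> Y" "adj w b'" by blast
        have b: "b = b'" "b \<notin> T" using pair[OF vw(1-4,6,5,7)] by blast+
        have "y = b" if "x \<in> S" "y \<in> Y" "adj x y" for x y
        proof (cases "x = v")
          case True
          then have "x \<noteq> w" using vw(3) by simp
          from pair[OF that(1) vw(2) this that(2) vw(6) that(3) vw(7)] b(1) show ?thesis by simp
        next
          case False
          then show ?thesis using pair[OF that(1) vw(1) False that(2) vw(4) that(3) vw(5)] by simp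
        qed
        then have "S \<subseteq> ?Only b" using S(1) noT by blast
        then have "card S \<le> card (?Only b)"
          using finL by (intro card_mono) auto
        then show ?thesis using disj b(2) vw(4) by blast
      next
        case False
        have "card S \<le> card ?Free + of_bool ?Att"
        proof (cases "\<exists>v\<in>S. \<exists>y\<in>Y. adj v y")
          case True
          then obtain v where v: "v \<in> S" "\<exists>y\<in>Y. adj v y" by blast
          have "S \<subseteq> insert v ?Free" using False v S(1) noT by blast
          then have "card S \<le> card (insert v ?Free)" using finFree by (intro card_mono) auto
          also have "\<dots> \<le> card ?Free + 1" using finFree by (simp add: card_insert_if)
          finally have "card S \<le> card ?Free + 1" .
          moreover have ?Att using v S(1) noT by blast
          ultimately show ?thesis by simp
        next
          case False
          then have "S \<subseteq> ?Free" using S(1) noT by blast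
          then have "card S \<le> card ?Free" using finFree by (intro card_mono) auto
          then show ?thesis by linarith
        qed
        then show ?thesis using disj by blast
      qed
    qed
  qed
  moreover have "k \<le> maxfit T Y L" if "?A \<or> ?B \<or> ?C \<or> ?D"
    using that
  proof (elim disjE)
    assume ?A
    then show ?thesis by (rule order_trans[OF _ A])
  next
    assume ?B
    then obtain v w where "k \<le> 2" "v \<in> L" "w \<in> L" "v \<noteq> w" "\<forall>y\<in>Y. \<not> adj w y" by blast
    then show ?thesis using order_trans[OF _ B] by blast
  next
    assume ?C
    then show ?thesis by (rule order_trans[OF _ C])
  next
    assume ?D
    then show ?thesis using order_trans[OF _ D] by blast
  qed
  ultimately show ?thesis by blast
qed

end

section \<open>Formulas as terms\<close>

text \<open>Truth is positivity rather than the value 1, since disjunctions are sums and existential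
  quantifiers are \<open>Sum\<close>. The double negation in \<open>tCount\<close> cuts such values
  back to 0 or 1.\<close>

definition sat :: "bool list \<Rightarrow> nat \<Rightarrow> (nat \<Rightarrow> nat) \<Rightarrow> tm \<Rightarrow> bool" where
  "sat bs n e t \<longleftrightarrow> 0 < tval bs n e t"

definition tZero :: tm where "tZero = Sub One One"
definition tNot :: "tm \<Rightarrow> tm" where "tNot t = Sub One t"
definition tAnd :: "tm \<Rightarrow> tm \<Rightarrow> tm" where "tAnd a b = Cond a b tZero"
definition tOr :: "tm \<Rightarrow> tm \<Rightarrow> tm" where "tOr a b = Add a b"
definition tLess :: "nat \<Rightarrow> nat \<Rightarrow> tm" where "tLess x y = Sub (V y) (V x)"
definition tEq :: "nat \<Rightarrow> nat \<Rightarrow> tm" where "tEq x y = tNot (tOr (tLess x y) (tLess y x))"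
definition tEx :: "nat \<Rightarrow> tm \<Rightarrow> tm" where "tEx x t = Sum x t"
definition tCount :: "nat \<Rightarrow> tm \<Rightarrow> tm" where "tCount x t = Sum x (tNot (tNot t))"
definition tLe :: "tm \<Rightarrow> tm \<Rightarrow> tm" where "tLe a b = tNot (Sub a b)"
definition tAndL :: "tm list \<Rightarrow> tm" where "tAndL ts = foldr tAnd ts One"
definition tOrL :: "tm list \<Rightarrow> tm" where "tOrL ts = foldr tOr ts tZero"
text \<open>With truncated subtraction, \<open>a + (b - a)\<close> is the maximum of
  \<open>a\<close> and \<open>b\<close>.\<close>

definition tMaxL :: "tm list \<Rightarrow> tm" where "tMaxL ts = foldr (\<lambda>a b. Add a (Sub b a)) ts tZero"
definition tExL :: "nat list \<Rightarrow> tm \<Rightarrow> tm" where "tExL xs t = foldr tEx xs t"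

lemma tval_tZero [simp]: "tval bs n e tZero = 0"
  by (simp add: tZero_def)

lemma sat_simps [simp]:
  "sat bs n e One"
  "\<not> sat bs n e tZero"
  "sat bs n e (tNot t) \<longleftrightarrow> \<not> sat bs n e t"
  "sat bs n e (tAnd a b) \<longleftrightarrow> sat bs n e a \<and> sat bs n e b"
  "sat bs n e (tOr a b) \<longleftrightarrow> sat bs n e a \<or> sat bs n e b"
  "sat bs n e (tLess x y) \<longleftrightarrow> e x < e y"
  "sat bs n e (tLe a b) \<longleftrightarrow> tval bs n e a \<le> tval bs n e b"
  "sat bs n e (tEx x t) \<longleftrightarrow> (\<exists>i<n. sat bs n (e(x := i)) t)"
proof -
  have "sum g {..<n} > 0 \<longleftrightarrow> (\<exists>i<n. 0 < g i)" for g :: "nat \<Rightarrow> nat"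
    unfolding zero_less_iff_neq_zero by (auto simp del: neq0_conv)
  then show "sat bs n e (tEx x t) \<longleftrightarrow> (\<exists>i<n. sat bs n (e(x := i)) t)" by (simp add: sat_def tEx_def)
qed (auto simp: sat_def tNot_def tAnd_def tOr_def tLess_def tLe_def)

lemma sat_tEq [simp]: "sat bs n e (tEq x y) \<longleftrightarrow> e x = e y"
  by (auto simp: tEq_def)

lemma sat_tAndL [simp]: "sat bs n e (tAndL ts) \<longleftrightarrow> (\<forall>t\<in>set ts. sat bs n e t)"
  by (induction ts) (auto simp: tAndL_def)

lemma sat_tAndL_4: "sat bs n e (tAndL [a, b, c, d]) \<longleftrightarrow> sat bs n e a \<and> sat bs n e b \<and> sat bs n e c \<and> sat bs n e d"
  by simp

lemma sat_tAndL_5: "sat bs n e (tAndL [a, b, c, d, f]) \<longleftrightarrow>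
    sat bs n e a \<and> sat bs n e b \<and> sat bs n e c \<and> sat bs n e d \<and> sat bs n e f"
  by simp

lemma sat_tOrL [simp]: "sat bs n e (tOrL ts) \<longleftrightarrow> (\<exists>t\<in>set ts. sat bs n e t)"
  by (induction ts) (auto simp: tOrL_def)

lemma tval_tNot_tNot: "tval bs n e (tNot (tNot t)) = of_bool (sat bs n e t)"
  by (auto simp: tNot_def sat_def)

lemma tval_tCount: "tval bs n e (tCount x t) = card {i. i < n \<and> sat bs n (e(x := i)) t}"
proof -
  have "tval bs n e (tCount x t) = (\<Sum>i<n. of_bool (sat bs n (e(x := i)) t))"
    by (simp add: tCount_def tval_tNot_tNot del: of_bool_eq)
  also have "\<dots> = card ({..<n} \<inter> {i. sat bs n (e(x := i)) t})"
    by (simp add: sum.inter_restrict[symmetric] of_bool_def sum.If_cases)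
  finally show ?thesis by (simp add: Int_def)
qed

lemma le_tval_tMaxL: "k \<le> tval bs n e (tMaxL ts) \<longleftrightarrow> k = 0 \<or> (\<exists>t\<in>set ts. k \<le> tval bs n e t)"
proof (induction ts)
  case (Cons t ts)
  have "tval bs n e (tMaxL (t # ts)) = max (tval bs n e t) (tval bs n e (tMaxL ts))"
    by (simp add: tMaxL_def)
  then show ?case using Cons.IH by (auto simp: le_max_iff_disj)
qed (simp add: tMaxL_def)

text \<open>Quantifying over a whole environment \<open>e'\<close> instead of a tuple of values
  allows \<open>e'\<close> to be used as a parameter of the locale \<open>term_env\<close>.\<close>

lemma sat_tExL:
  "sat bs n e (tExL xs t) \<longleftrightarrow>
     (\<exists>e'. (\<forall>v. v \<notin> set xs \<longrightarrow> e' v = e v) \<and> (\<forall>v\<in>set xs. e' v < n) \<and> sat bs n e' t)"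
proof (induction xs arbitrary: e)
  case Nil
  have "(\<forall>v. e' v = e v) \<longleftrightarrow> e' = e" for e' :: "nat \<Rightarrow> nat" by auto
  then show ?case by (simp add: tExL_def)
next
  case (Cons x xs)
  have "sat bs n e (tExL (x # xs) t) \<longleftrightarrow> (\<exists>i<n. sat bs n (e(x := i)) (tExL xs t))"
    by (simp add: tExL_def)
  also have "\<dots> \<longleftrightarrow> (\<exists>i<n. \<exists>e'. (\<forall>v. v \<notin> set xs \<longrightarrow> e' v = (e(x := i)) v) \<and> (\<forall>v\<in>set xs. e' v < n) \<and> sat bs n e' t)"
    unfolding Cons.IH ..
  also have "\<dots> \<longleftrightarrow> (\<exists>e'. (\<forall>v. v \<notin> set (x # xs) \<longrightarrow> e' v = e v) \<and> (\<forall>v\<in>set (x # xs). e' v < n) \<and> sat bs n e' t)"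
    (is "?l \<longleftrightarrow> ?r")
  proof
    assume ?l
    then obtain i e' where *: "i < n" "\<forall>v. v \<notin> set xs \<longrightarrow> e' v = (e(x := i)) v" "\<forall>v\<in>set xs. e' v < n" "sat bs n e' t"
      by blast
    have "e' x < n" using * by (cases "x \<in> set xs") auto
    then show ?r using * by (intro exI[of _ e']) auto
  next
    assume ?r
    then obtain e' where *: "\<forall>v. v \<notin> set (x # xs) \<longrightarrow> e' v = e v" "\<forall>v\<in>set (x # xs). e' v < n" "sat bs n e' t"
      by blast
    then show ?l by (intro exI[of _ "e' x"] conjI exI[of _ e']) auto
  qed
  finally show ?case .
qed

lemma proper_simps [simp]:
  "proper tZero"
  "proper (tNot t) \<longleftrightarrow> proper t"
  "proper (tAnd a b) \<longleftrightarrow> proper a \<and> proper b"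
  "proper (tOr a b) \<longleftrightarrow> proper a \<and> proper b"
  "proper (tLess x y) \<longleftrightarrow> 0 < x \<and> 0 < y"
  "proper (tEq x y) \<longleftrightarrow> 0 < x \<and> 0 < y"
  "proper (tEx x t) \<longleftrightarrow> 2 \<le> x \<and> proper t"
  "proper (tCount x t) \<longleftrightarrow> 2 \<le> x \<and> proper t"
  "proper (tLe a b) \<longleftrightarrow> proper a \<and> proper b"
  by (auto simp: tZero_def tNot_def tAnd_def tOr_def tLess_def tEq_def tEx_def tCount_def tLe_def)

lemma proper_tAndL [simp]: "proper (tAndL ts) \<longleftrightarrow> (\<forall>t\<in>set ts. proper t)"
  by (induction ts) (auto simp: tAndL_def)

lemma proper_tOrL [simp]: "proper (tOrL ts) \<longleftrightarrow> (\<forall>t\<in>set ts. proper t)"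
  by (induction ts) (auto simp: tOrL_def)

lemma proper_tMaxL [simp]: "proper (tMaxL ts) \<longleftrightarrow> (\<forall>t\<in>set ts. proper t)"
  by (induction ts) (auto simp: tMaxL_def)

lemma proper_tExL [simp]: "proper (tExL xs t) \<longleftrightarrow> (\<forall>x\<in>set xs. 2 \<le> x) \<and> proper t"
  by (induction xs) (auto simp: tExL_def)

section \<open>Certificates as terms\<close>

text \<open>Variable 1 holds the number \<open>n\<close> of vertices and variable 2 holds \<open>n\<close> minus the budget,
  truncated at zero. The terms below bind the variables 3 to 9; the tuples that list the elements
  of vertex sets are held in variables from 10 on. The table has the adjacency matrix as its rows
  \<open>0, \<dots>, n - 1\<close>, and its row \<open>n\<close> is the characteristic vector of the terminals.\<close>

definition tMember :: "nat list \<Rightarrow> nat \<Rightarrow> tm" where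
  "tMember vs v = tOrL (map (\<lambda>y. tEq v y) vs)"

definition tNear :: "nat list \<Rightarrow> nat \<Rightarrow> tm" where
  "tNear vs v = tOrL (map (\<lambda>y. Look v y) vs)"

definition tTerminal :: "nat \<Rightarrow> tm" where
  "tTerminal v = Look 1 v"

definition tFar :: "nat list \<Rightarrow> nat \<Rightarrow> tm" where
  "tFar xs v = tNot (tNear xs v)"

definition tFreeNear :: "bool \<Rightarrow> nat list \<Rightarrow> nat list \<Rightarrow> nat list \<Rightarrow> nat \<Rightarrow> tm" where
  "tFreeNear f xs ys zs v =
     (if f then tAndL [tNear xs v, tNot (tMember ys v), tNot (tNear ys v), tNot (tNear zs v)] else tZero)"

definition tSpecial :: "bool \<Rightarrow> nat list \<Rightarrow> nat \<Rightarrow> tm" where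
  "tSpecial f zs v = (if f then tOr (tMember zs v) (tNear zs v) else One)"

definition tCluster :: "(nat \<Rightarrow> tm) \<Rightarrow> tm" where
  "tCluster p = tNot (tEx 3 (tEx 4 (tEx 5
     (tAndL [p 3, p 4, p 5, Look 3 4, Look 4 5, tNot (tEq 3 5), tNot (Look 3 5)]))))"

definition tRep :: "(nat \<Rightarrow> tm) \<Rightarrow> nat \<Rightarrow> tm" where
  "tRep p v = tAnd (p v) (tNot (tEx 9 (tAndL [p 9, Look 9 v, tLess 9 v])))"

definition tClq :: "(nat \<Rightarrow> tm) \<Rightarrow> nat \<Rightarrow> nat \<Rightarrow> tm" where
  "tClq p r v = tAnd (p v) (tOr (tEq v r) (Look v r))"

text \<open>The entries of the maximum are the four shapes of \<open>le_maxfit_iff\<close>, the last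
  one with an entry for each candidate \<open>b\<close>.\<close>

definition tMaxfit :: "(nat \<Rightarrow> tm) \<Rightarrow> nat list \<Rightarrow> nat \<Rightarrow> tm" where
  "tMaxfit p ys r = tMaxL
    ([One,
      Cond (tEx 4 (tEx 5 (tAndL [tClq p r 4, tClq p r 5, tNot (tEq 4 5), tNot (tNear ys 5)]))) (Add One One) tZero,
      Add (tCount 4 (tAndL [tClq p r 4, tNot (tTerminal 4), tNot (tNear ys 4)]))
        (tNot (tNot (tEx 4 (tAndL [tClq p r 4, tNot (tTerminal 4), tNear ys 4]))))]
     @ map (\<lambda>b. Cond (tTerminal b) tZero
         (tCount 4 (tAndL [tClq p r 4, tNot (tTerminal 4), tAndL (map (\<lambda>y. tOr (tEq y b) (tNot (Look 4 y))) ys)]))) ys)"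

definition tCertificate :: "bool \<Rightarrow> nat list \<Rightarrow> nat list \<Rightarrow> nat list \<Rightarrow> tm" where
  "tCertificate f xs ys zs = tAndL
    [tCluster (tFar xs), tCluster (tFreeNear f xs ys zs),
     tAndL (map (\<lambda>y. tNot (tNear ys y)) ys),
     tAndL (map (\<lambda>y. tNear xs y) ys),
     tNot (tEx 3 (tEx 4 (tEx 5 (tAndL [tRep (tFar xs) 3, tSpecial f zs 3, tClq (tFar xs) 3 4,
        tFreeNear f xs ys zs 5, Look 4 5,
        tNot (tOrL (map (\<lambda>y. tAnd (Look 4 y) (tOrL (map (\<lambda>y'. tAnd (tNot (tEq y y')) (Look 4 y')) ys))) ys))]))))]"

definition tCertified :: "bool \<Rightarrow> nat list \<Rightarrow> nat list \<Rightarrow> nat list \<Rightarrow> tm" where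
  "tCertified f xs ys zs =
     Add (Add (tCount 3 (tMember ys 3)) (tCount 3 (tRep (tFreeNear f xs ys zs) 3)))
       (Sum 3 (Cond (tRep (tFar xs) 3) (Cond (tSpecial f zs 3) (tMaxfit (tFar xs) ys 3) One) tZero))"

text \<open>Membership in the symmetric difference of the non-terminals and the set listed by
  \<open>fs\<close>.\<close>

definition tFlipped :: "nat list \<Rightarrow> nat \<Rightarrow> tm" where
  "tFlipped fs v = tOr (tAnd (tTerminal v) (tMember fs v)) (tAnd (tNot (tTerminal v)) (tNot (tMember fs v)))"

fun tDistinct :: "nat list \<Rightarrow> tm" where
  "tDistinct [] = One"
| "tDistinct (v # vs) = tAnd (tNot (tMember vs v)) (tDistinct vs)"

definition tCycle :: "nat list \<Rightarrow> nat list \<Rightarrow> tm" where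
  "tCycle fs vs = tAndL
    [tDistinct vs, tAndL (map (tFlipped fs) vs), tOrL (map tTerminal vs),
     tAndL (map (\<lambda>i. Look (vs ! i) (vs ! (Suc i mod length vs))) [0..<length vs])]"

text \<open>The tuple \<open>fs\<close> lists the difference between the solution and the set of
  non-terminals. The cycle lengths to be tested are the odd ones up to the bound
  \<open>4 * s + 5\<close> of \<open>short_odd_T_cycle\<close>.\<close>

definition tSmall :: "nat \<Rightarrow> nat \<Rightarrow> tm" where
  "tSmall s k = (let fs = [10..<10 + k] in tExL fs
     (tAnd (tNot (tOrL (map (\<lambda>l. tExL [10 + k..<10 + k + l] (tCycle fs [10 + k..<10 + k + l]))
                 (filter (\<lambda>l. odd l \<and> 3 \<le> l) [0..<4 * s + 6]))))
       (tLe (V 2) (tCount 3 (tFlipped fs 3)))))"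

definition tLarge :: "bool \<Rightarrow> nat \<Rightarrow> nat \<Rightarrow> nat \<Rightarrow> tm" where
  "tLarge f a b c = (let xs = [10..<10 + a]; ys = [10 + a..<10 + a + b]; zs = [10 + a + b..<10 + a + b + c]
     in tExL [10..<10 + a + b + c]
          (tAnd (tCertificate f xs ys zs) (tLe (V 2) (tCertified f xs ys zs))))"

text \<open>All lengths of tuples up to the bounds are tried, because a tuple of positive length
  cannot list the empty set. The first bound holds since a largest solution misses at most as many
  non-terminals as it has terminals; the others come from
  \<open>splitter_certificate\<close>.\<close>

definition tSolution :: "nat \<Rightarrow> tm" where
  "tSolution s = tOr
    (tOrL (map (tSmall s) [0..<2 * ((s + 4) * (s + 1))]))
    (tOrL (map (\<lambda>f. tOrL (map (\<lambda>b. tOrL (map (\<lambda>c. tLarge f (s + 1) b c) [0..<Suc s])) [0..<Suc ((s + 2) * (s + 2))]))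
       [False, True]))"

lemma proper_tests [simp]:
  "0 < v \<Longrightarrow> \<forall>y\<in>set vs. 0 < y \<Longrightarrow> proper (tMember vs v)"
  "0 < v \<Longrightarrow> \<forall>y\<in>set vs. 0 < y \<Longrightarrow> proper (tNear vs v)"
  "0 < v \<Longrightarrow> proper (tTerminal v)"
  by (auto simp: tMember_def tNear_def tTerminal_def)

lemma proper_tDistinct: "\<forall>y\<in>set vs. 0 < y \<Longrightarrow> proper (tDistinct vs)"
  by (induction vs) auto

lemma proper_tSolution: "proper (tSolution s)"
proof -
  have "proper (tCycle fs vs)" if "\<forall>y\<in>set fs. 0 < y" "\<forall>y\<in>set vs. 0 < y" for fs vs
  proof -
    have "0 < vs ! (Suc i mod length vs)" if "i < length vs" for i
    proof -
      have "Suc i mod length vs < length vs" using that by (intro mod_less_divisor) linarith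
      then show ?thesis using \<open>\<forall>y\<in>set vs. 0 < y\<close> nth_mem by blast
    qed
    then show ?thesis using that by (auto simp: tCycle_def tFlipped_def proper_tDistinct)
  qed
  then have small: "proper (tSmall s k)" for k
    by (auto simp: tSmall_def Let_def tFlipped_def)
  have "proper (tCertificate f xs ys zs)" "proper (tCertified f xs ys zs)"
    if "\<forall>y\<in>set xs. 0 < y" "\<forall>y\<in>set ys. 0 < y" "\<forall>y\<in>set zs. 0 < y" for f xs ys zs
    using that by (auto simp: tCertificate_def tCertified_def tCluster_def tFar_def tFreeNear_def tRep_def
        tSpecial_def tClq_def tMaxfit_def)
  then have "proper (tLarge f a b c)" for f a b c
    by (auto simp: tLarge_def Let_def)
  with small show ?thesis by (auto simp: tSolution_def)
qed

section \<open>Semantics of the terms\<close>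

locale instance_terms = linorder_graph G for G :: "nat ugraph" +
  fixes T :: "nat set" and bs :: "bool list" and n :: nat
  assumes verts: "verts G = {..<n}" and T: "T \<subseteq> verts G"
    and look: "e x < n \<Longrightarrow> e y < n \<Longrightarrow> tval bs n e (Look x y) = of_bool (adj (e x) (e y))"
    and look_T: "e x = n \<Longrightarrow> e y < n \<Longrightarrow> tval bs n e (Look x y) = of_bool (e y \<in> T)"

definition (in instance_terms) flipped :: "nat set \<Rightarrow> nat set" where
  "flipped F = {v. v < n \<and> (v \<in> T \<longleftrightarrow> v \<in> F)}"

locale term_env = instance_terms +
  fixes e :: "nat \<Rightarrow> nat" and ps :: "nat set"
  assumes ps: "ps \<subseteq> {10..}" "\<And>v. v \<in> ps \<Longrightarrow> e v < n" "e 1 = n"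
begin

text \<open>Certificate and counting terms bind only variables from 3 to 9, so the environments met
  under their quantifiers differ from \<open>e\<close> only there.\<close>

definition agrees :: "(nat \<Rightarrow> nat) \<Rightarrow> bool" where
  "agrees e' \<longleftrightarrow> (\<forall>k. k < 3 \<or> 9 < k \<longrightarrow> e' k = e k)"

lemma agrees_self [simp]: "agrees e"
  by (simp add: agrees_def)

lemma agrees_upd [simp]: "agrees e' \<Longrightarrow> 3 \<le> k \<Longrightarrow> k \<le> 9 \<Longrightarrow> agrees (e'(k := i))"
  by (auto simp: agrees_def)

lemma agreesD: "agrees e' \<Longrightarrow> v \<in> ps \<Longrightarrow> e' v = e v"
  using ps(1) by (auto simp: agrees_def)

lemma sat_Look [simp]: "e' x < n \<Longrightarrow> e' y < n \<Longrightarrow> sat bs n e' (Look x y) \<longleftrightarrow> adj (e' x) (e' y)"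
  by (simp only: sat_def look) simp

lemma sat_tTerminal [simp]: "agrees e' \<Longrightarrow> e' v < n \<Longrightarrow> sat bs n e' (tTerminal v) \<longleftrightarrow> e' v \<in> T"
  unfolding sat_def tTerminal_def by (subst look_T) (auto simp: agrees_def ps(3)[unfolded One_nat_def])

lemma sat_tMember [simp]:
  assumes "agrees e'" "set vs \<subseteq> ps"
  shows "sat bs n e' (tMember vs v) \<longleftrightarrow> e' v \<in> e ` set vs"
proof -
  have "e' ` set vs = e ` set vs" using agreesD[OF assms(1)] assms(2) by (intro image_cong) auto
  then show ?thesis by (auto simp: tMember_def image_iff)
qed

lemma sat_tNear [simp]:
  assumes "agrees e'" "set vs \<subseteq> ps" "e' v < n"
  shows "sat bs n e' (tNear vs v) \<longleftrightarrow> (\<exists>x\<in>e ` set vs. adj (e' v) x)"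
proof -
  have "sat bs n e' (Look v y) \<longleftrightarrow> adj (e' v) (e y)" if "y \<in> set vs" for y
    using agreesD[OF assms(1), of y] ps(2)[of y] that assms(2,3) by auto
  then show ?thesis by (simp add: tNear_def)
qed

definition expresses :: "(nat \<Rightarrow> tm) \<Rightarrow> nat set \<Rightarrow> bool" where
  "expresses p S \<longleftrightarrow> S \<subseteq> {..<n} \<and> (\<forall>e' v. agrees e' \<longrightarrow> e' v < n \<longrightarrow> sat bs n e' (p v) = (e' v \<in> S))"

lemma expressesD: "expresses p S \<Longrightarrow> agrees e' \<Longrightarrow> e' v < n \<Longrightarrow> sat bs n e' (p v) \<longleftrightarrow> e' v \<in> S"
  by (simp add: expresses_def)

lemma expresses_subset: "expresses p S \<Longrightarrow> x \<in> S \<Longrightarrow> x < n"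
  by (auto simp: expresses_def)

lemma expresses_tFar: "set xs \<subseteq> ps \<Longrightarrow> expresses (tFar xs) (far (e ` set xs))"
  by (auto simp: expresses_def tFar_def far_def verts)

lemma expresses_tFreeNear:
  "set xs \<subseteq> ps \<Longrightarrow> set ys \<subseteq> ps \<Longrightarrow> set zs \<subseteq> ps \<Longrightarrow>
    expresses (tFreeNear f xs ys zs) (free_near f (e ` set xs) (e ` set ys) (e ` set zs))"
  by (auto simp: expresses_def tFreeNear_def free_near_def verts)

lemma sat_tSpecial:
  "set zs \<subseteq> ps \<Longrightarrow> agrees e' \<Longrightarrow> e' v < n \<Longrightarrow>
    sat bs n e' (tSpecial f zs v) \<longleftrightarrow> e' v \<in> special f (e ` set zs)"
  by (auto simp: tSpecial_def special_def)

lemma sat_tCluster: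
  assumes "expresses p S"
  shows "sat bs n e (tCluster p) \<longleftrightarrow> cluster S"
proof -
  have "sat bs n e (tCluster p) \<longleftrightarrow> \<not> (\<exists>u<n. \<exists>v<n. \<exists>w<n. u \<in> S \<and> v \<in> S \<and> w \<in> S \<and> adj u v \<and> adj v w \<and> u \<noteq> w \<and> \<not> adj u w)"
    by (simp add: tCluster_def expressesD[OF assms] cong: conj_cong)
  also have "\<dots> \<longleftrightarrow> cluster S"
    using expresses_subset[OF assms] unfolding cluster_def by blast
  finally show ?thesis .
qed

text \<open>Variable 9 is excluded as an argument because \<open>tRep\<close> binds it.\<close>

lemma sat_tRep:
  assumes "expresses p S" "agrees e'" "e' v < n" "v \<noteq> 9"
  shows "sat bs n e' (tRep p v) \<longleftrightarrow> e' v \<in> reps S"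
proof -
  have "sat bs n e' (tRep p v) \<longleftrightarrow> e' v \<in> S \<and> \<not> (\<exists>w<n. w \<in> S \<and> adj w (e' v) \<and> w < e' v)"
    using assms(2-) by (simp add: tRep_def expressesD[OF assms(1)] cong: conj_cong)
  then show ?thesis using expresses_subset[OF assms(1)] unfolding reps_def by blast
qed

lemma sat_tClq:
  assumes "expresses p S" "agrees e'" "e' v < n" "e' r < n"
  shows "sat bs n e' (tClq p r v) \<longleftrightarrow> e' v \<in> clq S (e' r)"
  using assms(2-) by (auto simp: tClq_def expressesD[OF assms(1)] clq_def)

text \<open>Two numbers are equal if the same \<open>k\<close> lie below them, and both sides are
  characterised in this form, by \<open>le_tval_tMaxL\<close> and
  \<open>le_maxfit_iff\<close>.\<close>

lemma tval_tMaxfit: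
  assumes p: "expresses p S" and S: "cluster S" and e': "agrees e'" "e' 3 \<in> S" and ys: "set ys \<subseteq> ps"
  shows "tval bs n e' (tMaxfit p ys 3) = maxfit T (e ` set ys) (clq S (e' 3))"
proof -
  define L where "L = clq S (e' 3)"
  define Y where "Y = e ` set ys"
  let ?pair = "tEx 4 (tEx 5 (tAndL [tClq p 3 4, tClq p 3 5, tNot (tEq 4 5), tNot (tNear ys 5)]))" and ?free = "tCount 4 (tAndL [tClq p 3 4, tNot (tTerminal 4), tNot (tNear ys 4)])"
    and ?att = "tEx 4 (tAndL [tClq p 3 4, tNot (tTerminal 4), tNear ys 4])"
  let ?Pair = "\<exists>v\<in>L. \<exists>w\<in>L. v \<noteq> w \<and> (\<forall>y\<in>Y. \<not> adj w y)" and ?Free = "card {v \<in> L. v \<notin> T \<and> (\<forall>y\<in>Y. \<not> adj v y)}"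
    and ?Att = "\<exists>v\<in>L. v \<notin> T \<and> (\<exists>y\<in>Y. adj v y)" and ?Only = "\<lambda>b. card {v \<in> L. v \<notin> T \<and> (\<forall>y\<in>Y. y = e b \<or> \<not> adj v y)}"
  have r: "e' 3 < n" using expresses_subset[OF p e'(2)] .
  have finS: "finite S" using p finite_subset[of S "{..<n}"] by (simp add: expresses_def)
  have Ln: "v < n" if "v \<in> L" for v using that clq_subset expresses_subset[OF p] unfolding L_def by blast
  note simps = sat_tClq[OF p] e'(1) r ys L_def[symmetric] Y_def[symmetric]
  have Lcount: "{i. i < n \<and> (i \<in> L \<and> P i)} = {i \<in> L. P i}" for P using Ln by auto
  have Lex: "(\<exists>i<n. i \<in> L \<and> P i) \<longleftrightarrow> (\<exists>i\<in>L. P i)" for P using Ln by auto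
  have t2: "sat bs n e' ?pair
     \<longleftrightarrow> ?Pair"
  proof -
    have "sat bs n e' ?pair
      \<longleftrightarrow> (\<exists>v<n. \<exists>w<n. v \<in> L \<and> w \<in> L \<and> v \<noteq> w \<and> (\<forall>y\<in>Y. \<not> adj w y))"
      by (simp add: simps cong: conj_cong)
    then show ?thesis using Ln by blast
  qed
  have t3: "tval bs n e' ?free
     = ?Free"
    by (simp add: tval_tCount simps Lcount cong: conj_cong)
  have t4: "sat bs n e' ?att
     \<longleftrightarrow> ?Att"
    by (simp add: simps Lex cong: conj_cong)
  have yval: "(e'(4 := i)) y = e y" "e y < n" "y \<noteq> 4" if "y \<in> set ys" for y i
    using agreesD[OF e'(1), of y] ps that ys by force+
  define only where "only = (\<lambda>b. Cond (tTerminal b) tZero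
    (tCount 4 (tAndL [tClq p 3 4, tNot (tTerminal 4), tAndL (map (\<lambda>y. tOr (tEq y b) (tNot (Look 4 y))) ys)])))"
  define nonadj where "nonadj = Cond ?pair
    (Add One One) tZero"
  define free where "free = Add ?free
    (tNot (tNot ?att))"
  have t5: "tval bs n e' (only b) = (if e b \<in> T then 0 else ?Only b)" if b: "b \<in> set ys" for b
  proof -
    have 1: "sat bs n e' (tTerminal b) \<longleftrightarrow> e b \<in> T"
      using agreesD[OF e'(1), of b] ps(2)[of b] b ys e'(1) by auto
    define q where "q = tAndL (map (\<lambda>y. tOr (tEq y b) (tNot (Look 4 y))) ys)"
    have 2: "sat bs n (e'(4 := i)) q
       \<longleftrightarrow> (\<forall>y\<in>Y. y = e b \<or> \<not> adj i y)" if "i < n" for i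
    proof -
      have "sat bs n (e'(4 := i)) (Look 4 y) \<longleftrightarrow> adj i (e y)" if "y \<in> set ys" for y
        using yval[OF that] \<open>i < n\<close> by simp
      then show ?thesis using yval(1,3) b by (simp add: Y_def q_def)
    qed
    have "tval bs n e' (tCount 4 (tAndL [tClq p 3 4, tNot (tTerminal 4), q]))
      = ?Only b"
      by (simp add: tval_tCount simps 2 Lcount cong: conj_cong)
    then show ?thesis using 1 by (simp add: sat_def q_def only_def)
  qed
  have "k \<le> tval bs n e' (tMaxfit p ys 3) \<longleftrightarrow> k \<le> maxfit T Y L" for k
  proof -
    have "k \<le> tval bs n e' (tMaxfit p ys 3) \<longleftrightarrow> k = 0 \<or> k \<le> 1 \<or>
      k \<le> (if ?Pair then 2 else 0) \<or>
      k \<le> ?Free + of_bool ?Att \<or>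
      (\<exists>b\<in>set ys. k \<le> (if e b \<in> T then 0 else ?Only b))"
    proof -
      have eq: "tMaxfit p ys 3 = tMaxL ([One, nonadj, free] @ map only ys)"
        by (simp add: tMaxfit_def only_def nonadj_def free_def)
      have "tval bs n e' nonadj = (if ?Pair then 2 else 0)"
        unfolding nonadj_def using t2 by (simp only: tval.simps sat_def[symmetric]) simp
      moreover have "tval bs n e' free = ?Free +
          of_bool ?Att"
        unfolding free_def by (simp only: tval.simps t3 tval_tNot_tNot t4)
      moreover have "tval bs n e' One = 1" by simp
      ultimately show ?thesis unfolding eq le_tval_tMaxL using t5 by simp
    qed
    also have "\<dots> \<longleftrightarrow> k \<le> maxfit T Y L"
    proof -
      have "(k = 0 \<or> k \<le> 1 \<or> k \<le> (if E then 2 else 0) \<or> k \<le> m \<or> (\<exists>b\<in>set ys. k \<le> (if e b \<in> T then 0 else c (e b)))) \<longleftrightarrow>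
        k \<le> 1 \<or> k \<le> 2 \<and> E \<or> k \<le> m \<or> (\<exists>b\<in>Y. b \<notin> T \<and> k \<le> c b)" for E m and c :: "nat \<Rightarrow> nat"
        by (auto simp: Y_def split: if_splits)
      then show ?thesis unfolding le_maxfit_iff[OF S finS e'(2) L_def] .
    qed
    finally show ?thesis .
  qed
  then show ?thesis unfolding L_def Y_def by (meson order_antisym order_refl)
qed

lemma sat_two_near:
  assumes "agrees e'" "e' 4 < n" "set ys \<subseteq> ps"
  shows "sat bs n e' (tOrL (map (\<lambda>y. tAnd (Look 4 y) (tOrL (map (\<lambda>y'. tAnd (tNot (tEq y y')) (Look 4 y')) ys))) ys))
    \<longleftrightarrow> (\<exists>y\<in>e ` set ys. \<exists>y'\<in>e ` set ys. y \<noteq> y' \<and> adj (e' 4) y \<and> adj (e' 4) y')"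
proof -
  have y: "e' y = e y" "sat bs n e' (Look 4 y) \<longleftrightarrow> adj (e' 4) (e y)" if "y \<in> set ys" for y
    using agreesD[OF assms(1), of y] ps(2)[of y] that assms(2,3) by auto
  show ?thesis using y by auto
qed

lemma sat_tCertificate:
  assumes ps: "set xs \<subseteq> ps" "set ys \<subseteq> ps" "set zs \<subseteq> ps"
  shows "sat bs n e (tCertificate f xs ys zs) \<longleftrightarrow> certificate f (e ` set xs) (e ` set ys) (e ` set zs)"
proof -
  let ?X = "e ` set xs" and ?Y = "e ` set ys" and ?Z = "e ` set zs"
  let ?two = "\<lambda>v. \<exists>y\<in>?Y. \<exists>y'\<in>?Y. y \<noteq> y' \<and> adj v y \<and> adj v y'"
  note far = expresses_tFar[OF ps(1)] and near = expresses_tFreeNear[OF ps, of f]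
  have yn: "e y < n" if "y \<in> set ys" for y using that ps(2) term_env_axioms by (auto simp: term_env_def term_env_axioms_def)
  define two where "two = tOrL (map (\<lambda>y. tAnd (Look 4 y) (tOrL (map (\<lambda>y'. tAnd (tNot (tEq y y')) (Look 4 y')) ys))) ys)"
  have two: "sat bs n e' two \<longleftrightarrow> ?two (e' 4)"
    if "agrees e'" "e' 4 < n" for e'
    unfolding two_def using sat_two_near[OF that ps(2)] .
  have 1: "sat bs n e (tAndL (map (\<lambda>y. tNot (tNear ys y)) ys)) \<longleftrightarrow> indep ?Y"
    using yn ps(2) by (auto simp: indep_def)
  have 2: "sat bs n e (tAndL (map (\<lambda>y. tNear xs y) ys)) \<longleftrightarrow> (\<forall>y\<in>?Y. \<exists>x\<in>?X. adj y x)"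
    using yn ps(1) by auto
  have 3: "sat bs n e (tNot (tEx 3 (tEx 4 (tEx 5 (tAndL [tRep (tFar xs) 3, tSpecial f zs 3, tClq (tFar xs) 3 4,
        tFreeNear f xs ys zs 5, Look 4 5, tNot two]))))) \<longleftrightarrow>
     \<not> (\<exists>r<n. \<exists>v<n. \<exists>b<n. r \<in> reps (far ?X) \<and> r \<in> special f ?Z \<and> v \<in> clq (far ?X) r \<and> b \<in> free_near f ?X ?Y ?Z \<and>
       adj v b \<and> \<not> ?two v)"
    by (simp add: sat_tRep[OF far] sat_tSpecial[OF ps(3)] sat_tClq[OF far] expressesD[OF near] two cong: conj_cong)
  have 4: "\<not> (\<exists>r<n. \<exists>v<n. \<exists>b<n. r \<in> R \<and> r \<in> D \<and> v \<in> L r \<and> b \<in> P \<and> A v b \<and> \<not> Q v) \<longleftrightarrow>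
     (\<forall>r\<in>R. r \<in> D \<longrightarrow> (\<forall>v\<in>L r. \<forall>b\<in>P. A v b \<longrightarrow> Q v))"
    if "\<forall>r\<in>R. r < n" "\<forall>r. \<forall>v\<in>L r. v < n" "\<forall>b\<in>P. b < n" for R D L P A Q
    using that by blast
  have bound: "\<forall>r\<in>reps (far ?X). r < n" "\<forall>r. \<forall>v\<in>clq (far ?X) r. v < n" "\<forall>b\<in>free_near f ?X ?Y ?Z. b < n"
    using reps_subset clq_subset expresses_subset[OF far] expresses_subset[OF near] by blast+
  note 5 = 4[where R="reps (far ?X)" and D="special f ?Z" and L="clq (far ?X)" and P="free_near f ?X ?Y ?Z" and A=adj
    and Q="?two", OF bound]
  show ?thesis
    unfolding tCertificate_def two_def[symmetric] sat_tAndL_5 certificate_def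
      sat_tCluster[OF far] sat_tCluster[OF near] 1 2 trans[OF 3 5] ..
qed

text \<open>The cluster assumption makes \<open>tval_tMaxfit\<close> applicable. It is available
  because \<open>tLarge\<close> conjoins the size comparison with
  \<open>tCertificate\<close>.\<close>

lemma tval_tCertified:
  assumes ps: "set xs \<subseteq> ps" "set ys \<subseteq> ps" "set zs \<subseteq> ps" and cl: "cluster (far (e ` set xs))"
  shows "tval bs n e (tCertified f xs ys zs) = certified T f (e ` set xs) (e ` set ys) (e ` set zs)"
proof -
  let ?X = "e ` set xs" and ?Y = "e ` set ys" and ?Z = "e ` set zs"
  note far = expresses_tFar[OF ps(1)] and near = expresses_tFreeNear[OF ps, of f]
  have yn: "y < n" if "y \<in> ?Y" for y using that ps(2) term_env_axioms by (auto simp: term_env_def term_env_axioms_def)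
  have 1: "tval bs n e (tCount 3 (tMember ys 3)) = card ?Y"
  proof -
    have "{i. i < n \<and> i \<in> ?Y} = ?Y" using yn by auto
    then show ?thesis using ps(2) by (simp add: tval_tCount)
  qed
  have 2: "tval bs n e (tCount 3 (tRep (tFreeNear f xs ys zs) 3)) = card (reps (free_near f ?X ?Y ?Z))"
  proof -
    have "{i. i < n \<and> i \<in> reps (free_near f ?X ?Y ?Z)} = reps (free_near f ?X ?Y ?Z)"
      using reps_subset expresses_subset[OF near] by blast
    then show ?thesis by (simp add: tval_tCount sat_tRep[OF near] cong: conj_cong)
  qed
  let ?t = "Cond (tRep (tFar xs) 3) (Cond (tSpecial f zs 3) (tMaxfit (tFar xs) ys 3) One) tZero"
  have 3: "tval bs n e (Sum 3 ?t)
    = (\<Sum>r\<in>reps (far ?X). if r \<in> special f ?Z then maxfit T ?Y (clq (far ?X) r) else 1)"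
  proof -
    have "tval bs n (e(3 := i)) ?t
      = (if i \<in> reps (far ?X) then if i \<in> special f ?Z then maxfit T ?Y (clq (far ?X) i) else 1 else 0)" if "i < n" for i
    proof -
      have a: "agrees (e(3 := i))" by simp
      have "0 < tval bs n (e(3 := i)) (tRep (tFar xs) 3) \<longleftrightarrow> i \<in> reps (far ?X)"
        using sat_tRep[OF far a, of 3] that by (simp add: sat_def)
      moreover have "0 < tval bs n (e(3 := i)) (tSpecial f zs 3) \<longleftrightarrow> i \<in> special f ?Z"
        using sat_tSpecial[OF ps(3) a, of 3 f] that by (simp add: sat_def)
      moreover have "tval bs n (e(3 := i)) (tMaxfit (tFar xs) ys 3) = maxfit T ?Y (clq (far ?X) i)" if "i \<in> reps (far ?X)"
        using tval_tMaxfit[OF far cl a _ ps(2)] that reps_subset by auto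
      ultimately show ?thesis by simp
    qed
    then have "tval bs n e (Sum 3 ?t)
      = (\<Sum>i<n. if i \<in> reps (far ?X) then if i \<in> special f ?Z then maxfit T ?Y (clq (far ?X) i) else 1 else 0)"
      unfolding tval.simps by (intro sum.cong) auto
    also have "\<dots> = (\<Sum>i\<in>{..<n} \<inter> reps (far ?X). if i \<in> special f ?Z then maxfit T ?Y (clq (far ?X) i) else 1)"
      by (rule sum.inter_restrict[symmetric]) simp
    also have "{..<n} \<inter> reps (far ?X) = reps (far ?X)"
      using reps_subset expresses_subset[OF far] by blast
    finally show ?thesis .
  qed
  show ?thesis unfolding tCertified_def certified_def tval.simps(4) 1 2 3 ..
qed

lemma sat_tFlipped:
  "agrees e' \<Longrightarrow> set fs \<subseteq> ps \<Longrightarrow> e' v < n \<Longrightarrow> sat bs n e' (tFlipped fs v) \<longleftrightarrow> e' v \<in> flipped (e ` set fs)"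
  by (auto simp: tFlipped_def flipped_def)

lemma sat_tDistinct: "set vs \<subseteq> ps \<Longrightarrow> sat bs n e (tDistinct vs) \<longleftrightarrow> distinct (map e vs)"
  by (induction vs) auto

lemma sat_tCycle:
  assumes "set fs \<subseteq> ps" "set vs \<subseteq> ps" "odd (length vs)" "3 \<le> length vs"
  shows "sat bs n e (tCycle fs vs) \<longleftrightarrow>
    odd_T_cycle G T (map e vs) \<and> set (map e vs) \<subseteq> flipped (e ` set fs)"
proof -
  have vn: "e v < n" if "v \<in> set vs" for v using that ps(2) assms(2) by blast
  have 1: "sat bs n e (Look (vs ! i) (vs ! (Suc i mod length vs))) \<longleftrightarrow>
      {map e vs ! i, map e vs ! (Suc i mod length vs)} \<in> edges G" if "i < length vs" for i
  proof -
    have "Suc i mod length vs < length vs" using that by (intro mod_less_divisor) linarith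
    then show ?thesis using that vn by (simp add: adj_def)
  qed
  have "sat bs n e (tAndL (map (tFlipped fs) vs)) \<longleftrightarrow> set (map e vs) \<subseteq> flipped (e ` set fs)"
    using sat_tFlipped[OF agrees_self assms(1)] vn by auto
  moreover have "sat bs n e (tOrL (map tTerminal vs)) \<longleftrightarrow> set (map e vs) \<inter> T \<noteq> {}"
    using sat_tTerminal[OF agrees_self] vn by auto
  moreover have "sat bs n e (tAndL (map (\<lambda>i. Look (vs ! i) (vs ! (Suc i mod length vs))) [0..<length vs])) \<longleftrightarrow>
     (\<forall>i<length vs. {map e vs ! i, map e vs ! (Suc i mod length vs)} \<in> edges G)"
    using 1 by auto
  ultimately have "sat bs n e (tCycle fs vs) \<longleftrightarrow> distinct (map e vs) \<and> set (map e vs) \<subseteq> flipped (e ` set fs) \<and>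
     set (map e vs) \<inter> T \<noteq> {} \<and>
     (\<forall>i<length vs. {map e vs ! i, map e vs ! (Suc i mod length vs)} \<in> edges G)"
    unfolding tCycle_def sat_tAndL_4 sat_tDistinct[OF assms(2)] by (rule conj_cong[OF refl conj_cong[OF _ conj_cong]])
  moreover have "set (map e vs) \<subseteq> verts G" using vn verts by auto
  ultimately show ?thesis using assms(3,4) unfolding odd_T_cycle_def is_cycle_def by auto
qed

end

lemma ex_map_eq:
  assumes "distinct vs" "length vs = length c"
  shows "\<exists>g. map g vs = c"
proof -
  have "map (\<lambda>v. the (map_of (zip vs c) v)) vs = c"
    using assms by (intro nth_equalityI) (auto simp: map_of_zip_nth)
  then show ?thesis by blast
qed

lemma ex_image_eq:
  assumes "distinct vs" "finite X" "card X = length vs"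
  shows "\<exists>g. g ` set vs = X"
  using finite_same_card_bij[of "set vs" X] assms by (auto simp: distinct_card bij_betw_def)

section \<open>Soundness and completeness of the search\<close>

context instance_terms begin

lemma tLarge_solution:
  assumes "e 1 = n" "sat bs n e (tLarge f a b c)"
  shows "\<exists>W. odd_T_cycle_free G T W \<and> e 2 \<le> card W"
proof -
  let ?ps = "set [10..<10 + a + b + c]"
  define xs ys zs where "xs = [10..<10 + a]" and "ys = [10 + a..<10 + a + b]" and "zs = [10 + a + b..<10 + a + b + c]"
  obtain e' where e': "\<forall>v. v \<notin> ?ps \<longrightarrow> e' v = e v" "\<forall>v\<in>?ps. e' v < n"
    "sat bs n e' (tAnd (tCertificate f xs ys zs) (tLe (V 2) (tCertified f xs ys zs)))"
    using assms(2) unfolding tLarge_def Let_def sat_tExL xs_def ys_def zs_def by blast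
  interpret term_env G T bs n e' ?ps
    using e' assms(1) by unfold_locales auto
  have sub: "set xs \<subseteq> ?ps" "set ys \<subseteq> ?ps" "set zs \<subseteq> ?ps"
    by (auto simp: xs_def ys_def zs_def)
  have cert: "certificate f (e' ` set xs) (e' ` set ys) (e' ` set zs)"
    using e'(3) sat_tCertificate[OF sub] by simp
  then have cl: "cluster (far (e' ` set xs))" by (simp add: certificate_def)
  have "e' 2 = e 2" using e'(1) by simp
  then have "e 2 \<le> certified T f (e' ` set xs) (e' ` set ys) (e' ` set zs)"
    using e'(3) tval_tCertified[OF sub cl] by simp
  then show ?thesis using certificate_solution[OF cert, of T] by auto
qed

lemma tLarge_complete:
  assumes "e 1 = n" "X \<subseteq> {..<n}" "Y \<subseteq> {..<n}" "Z \<subseteq> {..<n}" "certificate f X Y Z" "e 2 \<le> certified T f X Y Z"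
  shows "sat bs n e (tLarge f (card X) (card Y) (card Z))"
proof -
  define a b c where "a = card X" and "b = card Y" and "c = card Z"
  let ?ps = "set [10..<10 + a + b + c]"
  define xs ys zs where "xs = [10..<10 + a]" and "ys = [10 + a..<10 + a + b]" and "zs = [10 + a + b..<10 + a + b + c]"
  have fin: "finite X" "finite Y" "finite Z" using assms(2-4) finite_subset by blast+
  have "\<exists>g. g ` set xs = X" by (rule ex_image_eq[OF _ fin(1)]) (simp_all add: xs_def a_def)
  then obtain g1 where g1: "g1 ` set xs = X" by blast
  have "\<exists>g. g ` set ys = Y" by (rule ex_image_eq[OF _ fin(2)]) (simp_all add: ys_def b_def)
  then obtain g2 where g2: "g2 ` set ys = Y" by blast
  have "\<exists>g. g ` set zs = Z" by (rule ex_image_eq[OF _ fin(3)]) (simp_all add: zs_def c_def)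
  then obtain g3 where g3: "g3 ` set zs = Z" by blast
  define e' where "e' v = (if v \<in> set xs then g1 v else if v \<in> set ys then g2 v else if v \<in> set zs then g3 v else e v)" for v
  have im: "e' ` set xs = X" "e' ` set ys = Y" "e' ` set zs = Z"
  proof -
    have "e' ` set xs = g1 ` set xs" "e' ` set ys = g2 ` set ys" "e' ` set zs = g3 ` set zs"
      by (intro image_cong; auto simp: e'_def xs_def ys_def zs_def)+
    then show "e' ` set xs = X" "e' ` set ys = Y" "e' ` set zs = Z" using g1 g2 g3 by simp_all
  qed
  have sets: "?ps = set xs \<union> set ys \<union> set zs" by (auto simp: xs_def ys_def zs_def)
  have off: "\<forall>v. v \<notin> ?ps \<longrightarrow> e' v = e v" unfolding sets by (simp add: e'_def)
  have lt: "e' v < n" if "v \<in> ?ps" for v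
  proof -
    have "e' v \<in> X \<union> Y \<union> Z" using that unfolding sets im[symmetric] by blast
    then show ?thesis using assms(2-4) by blast
  qed
  interpret term_env G T bs n e' ?ps
    using off lt assms(1) by unfold_locales auto
  have sub: "set xs \<subseteq> ?ps" "set ys \<subseteq> ?ps" "set zs \<subseteq> ?ps"
    unfolding sets by blast+
  have cl: "cluster (far (e' ` set xs))" using assms(5) im by (simp add: certificate_def)
  have "e' 2 = e 2" using off by simp
  then have "sat bs n e' (tAnd (tCertificate f xs ys zs) (tLe (V 2) (tCertified f xs ys zs)))"
    using sat_tCertificate[OF sub] tval_tCertified[OF sub cl] assms(5,6) im by simp
  then show ?thesis
    unfolding tLarge_def Let_def sat_tExL a_def[symmetric] b_def[symmetric] c_def[symmetric]
      xs_def[symmetric] ys_def[symmetric] zs_def[symmetric]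
    using off lt by blast
qed

lemma sat_cycle_search:
  assumes e: "e 1 = n" "\<forall>v\<in>set [10..<10 + k]. e v < n" and l: "odd l" "3 \<le> l"
  shows "sat bs n e (tExL [10 + k..<10 + k + l] (tCycle [10..<10 + k] [10 + k..<10 + k + l])) \<longleftrightarrow>
    (\<exists>c. length c = l \<and> odd_T_cycle G T c \<and> set c \<subseteq> flipped (e ` set [10..<10 + k]))"
proof -
  define fs vs where "fs = [10..<10 + k]" and "vs = [10 + k..<10 + k + l]"
  have lvs: "length vs = l" "distinct vs" by (auto simp: vs_def)
  have eq: "sat bs n e' (tCycle fs vs) \<longleftrightarrow> odd_T_cycle G T (map e' vs) \<and> set (map e' vs) \<subseteq> flipped (e ` set fs)"
    if off: "\<forall>v. v \<notin> set vs \<longrightarrow> e' v = e v" and lt: "\<forall>v\<in>set vs. e' v < n" for e'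
  proof -
    have same: "e' v = e v" if "v \<in> set fs" for v using off that by (auto simp: fs_def vs_def)
    interpret term_env G T bs n e' "set fs \<union> set vs"
    proof
      show "set fs \<union> set vs \<subseteq> {10..}" by (auto simp: fs_def vs_def)
      show "e' v < n" if "v \<in> set fs \<union> set vs" for v
        using that lt same e(2) unfolding fs_def by (metis Un_iff)
      show "e' 1 = n" using off e(1) by (simp add: vs_def)
    qed
    have "e' ` set fs = e ` set fs" using same by (intro image_cong) auto
    then show ?thesis using sat_tCycle[of fs vs] lvs l by simp
  qed
  show ?thesis unfolding fs_def[symmetric] vs_def[symmetric] sat_tExL
  proof
    assume "\<exists>e'. (\<forall>v. v \<notin> set vs \<longrightarrow> e' v = e v) \<and> (\<forall>v\<in>set vs. e' v < n) \<and> sat bs n e' (tCycle fs vs)"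
    then obtain e' where "\<forall>v. v \<notin> set vs \<longrightarrow> e' v = e v" "\<forall>v\<in>set vs. e' v < n" "sat bs n e' (tCycle fs vs)" by blast
    then have "odd_T_cycle G T (map e' vs) \<and> set (map e' vs) \<subseteq> flipped (e ` set fs)" using eq by blast
    then show "\<exists>c. length c = l \<and> odd_T_cycle G T c \<and> set c \<subseteq> flipped (e ` set fs)"
      using lvs(1) by (intro exI[of _ "map e' vs"]) simp
  next
    assume "\<exists>c. length c = l \<and> odd_T_cycle G T c \<and> set c \<subseteq> flipped (e ` set fs)"
    then obtain c where c: "length c = l" "odd_T_cycle G T c" "set c \<subseteq> flipped (e ` set fs)" by blast
    obtain g where g: "map g vs = c" using ex_map_eq[of vs c] lvs c(1) by auto
    define e' where "e' v = (if v \<in> set vs then g v else e v)" for v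
    have m: "map e' vs = c" using g by (auto simp: e'_def)
    have off: "\<forall>v. v \<notin> set vs \<longrightarrow> e' v = e v" by (simp add: e'_def)
    have lt: "\<forall>v\<in>set vs. e' v < n"
    proof
      fix v assume "v \<in> set vs"
      then have "e' v \<in> set c" using m by auto
      then show "e' v < n" using c(3) by (auto simp: flipped_def)
    qed
    have "sat bs n e' (tCycle fs vs)" using eq[OF off lt] c m by simp
    then show "\<exists>e'. (\<forall>v. v \<notin> set vs \<longrightarrow> e' v = e v) \<and> (\<forall>v\<in>set vs. e' v < n) \<and> sat bs n e' (tCycle fs vs)"
      using off lt by blast
  qed
qed

lemma sat_tSmall:
  assumes free: "H_free (sP1_P3 s) G" and e: "e 1 = n"
  shows "sat bs n e (tSmall s k) \<longleftrightarrow> (\<exists>e'. (\<forall>v. v \<notin> set [10..<10 + k] \<longrightarrow> e' v = e v) \<and> (\<forall>v\<in>set [10..<10 + k]. e' v < n) \<and>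
    odd_T_cycle_free G T (flipped (e' ` set [10..<10 + k])) \<and> e 2 \<le> card (flipped (e' ` set [10..<10 + k])))"
proof -
  define fs where "fs = [10..<10 + k]"
  have "sat bs n e' (tAnd (tNot (tOrL (map (\<lambda>l. tExL [10 + k..<10 + k + l] (tCycle fs [10 + k..<10 + k + l]))
                 (filter (\<lambda>l. odd l \<and> 3 \<le> l) [0..<4 * s + 6]))))
       (tLe (V 2) (tCount 3 (tFlipped fs 3)))) \<longleftrightarrow>
     odd_T_cycle_free G T (flipped (e' ` set fs)) \<and> e 2 \<le> card (flipped (e' ` set fs))"
    if off: "\<forall>v. v \<notin> set fs \<longrightarrow> e' v = e v" and lt: "\<forall>v\<in>set fs. e' v < n" for e'
  proof -
    let ?W = "flipped (e' ` set fs)"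
    have 1: "e' 1 = n" "e' 2 = e 2" using off e by (simp_all add: fs_def)
    interpret term_env G T bs n e' "set fs" using lt 1 by unfold_locales (auto simp: fs_def)
    have "{i. i < n \<and> i \<in> ?W} = ?W" by (auto simp: flipped_def)
    then have count: "tval bs n e' (tCount 3 (tFlipped fs 3)) = card ?W"
      by (simp add: tval_tCount sat_tFlipped cong: conj_cong)
    have "(\<exists>l\<in>set (filter (\<lambda>l. odd l \<and> 3 \<le> l) [0..<4 * s + 6]).
        sat bs n e' (tExL [10 + k..<10 + k + l] (tCycle fs [10 + k..<10 + k + l]))) \<longleftrightarrow>
      (\<exists>c. length c \<le> 4 * s + 5 \<and> odd_T_cycle G T c \<and> set c \<subseteq> ?W)" (is "?l \<longleftrightarrow> ?r")
    proof
      assume ?l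
      then obtain l where l: "l \<in> set (filter (\<lambda>l. odd l \<and> 3 \<le> l) [0..<4 * s + 6])"
        "sat bs n e' (tExL [10 + k..<10 + k + l] (tCycle fs [10 + k..<10 + k + l]))" by blast
      have l': "odd l" "3 \<le> l" "l \<le> 4 * s + 5" using l(1) by auto
      show ?r using sat_cycle_search[OF 1(1) lt[unfolded fs_def] l'(1,2)] l(2) l'(3) unfolding fs_def by blast
    next
      assume ?r
      then obtain c where c: "length c \<le> 4 * s + 5" "odd_T_cycle G T c" "set c \<subseteq> ?W" by blast
      have l: "odd (length c)" "3 \<le> length c" using c(2) by (auto simp: odd_T_cycle_def is_cycle_def)
      have "sat bs n e' (tExL [10 + k..<10 + k + length c] (tCycle fs [10 + k..<10 + k + length c]))"
        using sat_cycle_search[OF 1(1) lt[unfolded fs_def] l] c(2,3) unfolding fs_def by blast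
      then show ?l using l c(1) by (intro bexI[of _ "length c"]) auto
    qed
    \<comment> \<open>This is where freeness turns the search among short cycles into a complete
      test.\<close>
    also have "\<dots> \<longleftrightarrow> \<not> odd_T_cycle_free G T ?W"
    proof -
      have "?W \<subseteq> verts G" by (auto simp: flipped_def verts)
      then show ?thesis using short_odd_T_cycle[OF free, of T _ ?W] unfolding odd_T_cycle_free_def by blast
    qed
    finally have cyc: "(\<exists>l\<in>set (filter (\<lambda>l. odd l \<and> 3 \<le> l) [0..<4 * s + 6]).
        sat bs n e' (tExL [10 + k..<10 + k + l] (tCycle fs [10 + k..<10 + k + l]))) \<longleftrightarrow> \<not> odd_T_cycle_free G T ?W" .
    show ?thesis by (simp only: sat_simps sat_tOrL set_map bex_simps cyc count tval.simps 1 not_not)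
  qed
  then show ?thesis unfolding tSmall_def Let_def fs_def[symmetric] sat_tExL by blast
qed

theorem sat_tSolution:
  assumes free: "H_free (sP1_P3 s) G" and e: "e 1 = n"
  shows "sat bs n e (tSolution s) \<longleftrightarrow> (\<exists>W. odd_T_cycle_free G T W \<and> e 2 \<le> card W)"
proof
  assume "sat bs n e (tSolution s)"
  then consider k where "sat bs n e (tSmall s k)" | f b c where "sat bs n e (tLarge f (s + 1) b c)"
    unfolding tSolution_def sat_simps sat_tOrL set_map bex_simps by blast
  then show "\<exists>W. odd_T_cycle_free G T W \<and> e 2 \<le> card W"
  proof cases
    case 1
    then show ?thesis using sat_tSmall[where e=e, OF free e] by blast
  next
    case 2
    then show ?thesis by (rule tLarge_solution[where e=e, OF e])
  qed
next
  assume "\<exists>W. odd_T_cycle_free G T W \<and> e 2 \<le> card W"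
  then obtain W0 where W0: "odd_T_cycle_free G T W0" "e 2 \<le> card W0" by blast
  have bound: "card W \<le> card (verts G)" if "odd_T_cycle_free G T W" for W
    using that finite_verts by (auto simp: odd_T_cycle_free_def intro: card_mono)
  \<comment> \<open>A largest solution is needed, not just a large enough one: comparing it with the
    set of non-terminals bounds what it misses.\<close>
  obtain W where W: "odd_T_cycle_free G T W" and max: "\<And>W'. odd_T_cycle_free G T W' \<Longrightarrow> card W' \<le> card W"
    using ex_has_greatest_nat[of "odd_T_cycle_free G T" W0 card "Suc (card (verts G))"] W0(1) bound by (auto simp: less_Suc_eq_le)
  have q: "e 2 \<le> card W" using W0 max by (meson le_trans)
  have WV: "W \<subseteq> verts G" using W by (simp add: odd_T_cycle_free_def)
  have finW: "finite W" using WV finite_verts finite_subset by blast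
  show "sat bs n e (tSolution s)"
  proof (cases "(s + 4) * (s + 1) \<le> card (W \<inter> T)")
    case False
    define N where "N = verts G - T - W"
    define F where "F = N \<union> (W \<inter> T)"
    have FV: "F \<subseteq> {..<n}" using WV verts by (auto simp: F_def N_def)
    have finN: "finite N" using finite_verts by (simp add: N_def)
    have "card N + card (W - T) = card (verts G - T)"
    proof -
      have "verts G - T = N \<union> (W - T)" "N \<inter> (W - T) = {}" using WV by (auto simp: N_def)
      then show ?thesis using finN finW by (metis card_Un_disjoint finite_Diff)
    qed
    \<comment> \<open>The non-terminals form a solution, as no cycle among them meets
      \<open>T\<close>. With the two counts around it, this gives that \<open>N\<close> has at most
      as many elements as \<open>W \<inter> T\<close>.\<close>
    moreover have "card (verts G - T) \<le> card W"
      by (rule max) (auto simp: odd_T_cycle_free_def odd_T_cycle_def)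
    moreover have "card W = card (W \<inter> T) + card (W - T)"
      using finW by (metis Diff_Diff_Int Int_Diff_Un Int_Diff_disjoint card_Un_disjoint finite_Diff finite_Int)
    moreover have "card F \<le> card N + card (W \<inter> T)" unfolding F_def by (rule card_Un_le)
    ultimately have cF: "card F < 2 * ((s + 4) * (s + 1))" using False by linarith
    have WF: "flipped F = W" using WV verts by (auto simp: flipped_def F_def N_def)
    have "finite F" using FV finite_subset by blast
    then obtain g where g: "g ` set [10..<10 + card F] = F" using ex_image_eq[of "[10..<10 + card F]" F] by auto
    define e' where "e' v = (if v \<in> set [10..<10 + card F] then g v else e v)" for v
    have im: "e' ` set [10..<10 + card F] = F"
    proof -
      have "e' ` set [10..<10 + card F] = g ` set [10..<10 + card F]" by (rule image_cong) (auto simp: e'_def)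
      then show ?thesis using g by simp
    qed
    then have lt: "\<forall>v\<in>set [10..<10 + card F]. e' v < n" using FV by blast
    have "sat bs n e (tSmall s (card F))"
      unfolding sat_tSmall[where e=e, OF free e] using im lt WF W q by (intro exI[of _ e']) (simp add: e'_def)
    then show ?thesis using cF unfolding tSolution_def by auto
  next
    case True
    obtain X where X: "splitter T W X" "card X = s + 1" using ex_splitter[OF free W True] by blast
    obtain f Y Z where YZ: "certificate f X Y Z" "Y \<subseteq> verts G" "Z \<subseteq> verts G"
      "card Y \<le> (s + 2) * (s + 2)" "card Z \<le> s" "card W \<le> certified T f X Y Z"
      using splitter_certificate[OF free WV X] by blast
    have "X \<subseteq> verts G" using X(1) WV by (auto simp: splitter_def)
    then have "sat bs n e (tLarge f (s + 1) (card Y) (card Z))"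
      using tLarge_complete[where e=e, OF e _ _ _ YZ(1)] YZ(2,3,6) q X(2) verts by simp
    moreover have "f \<in> set [False, True]" "card Y \<in> set [0..<Suc ((s + 2) * (s + 2))]" "card Z \<in> set [0..<Suc s]"
      using YZ(4,5) by auto
    ultimately show ?thesis
      unfolding tSolution_def sat_simps sat_tOrL set_map image_image bex_simps by blast
  qed
qed

end

section \<open>The decision problem\<close>

theorem theorem9:
  fixes s :: nat
  shows "solvable_in_poly_time encode_instance
           {I. valid_instance I \<and> H_free (sP1_P3 s) (graph_of I)}
           subset_odd_cycle_transversal"
proof (rule solvable_by_term[OF proper_tSolution[of s]])
  fix I assume I: "I \<in> {I. valid_instance I \<and> H_free (sP1_P3 s) (graph_of I)}"
  define G T where "G = graph_of I" and "T = terminals I"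
  define n where "n = card (verts G)"
  let ?e = "(\<lambda>_. 0)(1 := n, 2 := n - budget I) :: nat \<Rightarrow> nat"
  have G: "simple_graph G" "T \<subseteq> verts G" "H_free (sP1_P3 s) G" and V: "verts G = {..<n}"
    using I by (auto simp: valid_instance_def G_def T_def n_def)
  interpret fin_graph G using G(1) by unfold_locales
  interpret instance_terms G T "instance_bits I" n
  proof
    show "tval (instance_bits I) n e (Look x y) = of_bool (adj (e x) (e y))" if "e x < n" "e y < n" for e x y
      using tval_Look(1)[of n I e y x] that unfolding adj_def by (simp add: G_def n_def)
    show "tval (instance_bits I) n e (Look x y) = of_bool (e y \<in> T)" if "e x = n" "e y < n" for e x y
      using tval_Look(2)[of n I e y x] that by (simp add: G_def n_def T_def)
  qed (use V G in auto)
  have "0 < tval (instance_bits I) n ?e (tSolution s) \<longleftrightarrow> (\<exists>W. odd_T_cycle_free G T W \<and> n - budget I \<le> card W)"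
    using sat_tSolution[OF G(3), of ?e] by (simp add: sat_def)
  \<comment> \<open>Complementation turns size at most the budget into size at least
    \<open>n\<close> minus the budget. Truncation is harmless: if the budget exceeds
    \<open>n\<close>, both conditions hold trivially.\<close>
  also have "\<dots> \<longleftrightarrow> subset_odd_cycle_transversal I"
  proof
    assume "\<exists>W. odd_T_cycle_free G T W \<and> n - budget I \<le> card W"
    then obtain W where W: "odd_T_cycle_free G T W" "n - budget I \<le> card W" by blast
    have WV: "W \<subseteq> verts G" using W(1) by (simp add: odd_T_cycle_free_def)
    then have "verts G - (verts G - W) = W" by blast
    then have "odd_T_cycle_transversal G T (verts G - W)"
      using W(1) by (simp add: odd_T_cycle_transversal_iff)
    moreover have "card (verts G - W) \<le> budget I"
      using W(2) card_Diff_subset[of W "verts G"] WV finite_verts finite_subset unfolding n_def by fastforce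
    ultimately show "subset_odd_cycle_transversal I"
      unfolding subset_odd_cycle_transversal_def G_def T_def by blast
  next
    assume "subset_odd_cycle_transversal I"
    then obtain S where S: "odd_T_cycle_transversal G T S" "card S \<le> budget I"
      unfolding subset_odd_cycle_transversal_def G_def T_def by blast
    have "S \<subseteq> verts G" "odd_T_cycle_free G T (verts G - S)" using S(1) by (auto simp: odd_T_cycle_transversal_iff)
    moreover have "n - budget I \<le> card (verts G - S)"
      using card_Diff_subset[of S "verts G"] \<open>S \<subseteq> verts G\<close> finite_verts finite_subset S(2) unfolding n_def by fastforce
    ultimately show "\<exists>W. odd_T_cycle_free G T W \<and> n - budget I \<le> card W" by blast
  qed
  finally show "0 < tval (instance_bits I) (card (verts (graph_of I)))
      ((\<lambda>_. 0)(1 := card (verts (graph_of I)), 2 := card (verts (graph_of I)) - budget I)) (tSolution s) \<longleftrightarrow>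
    subset_odd_cycle_transversal I"
    by (simp add: n_def G_def)
qed

end
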